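(* Let $(X,\mathcal F)$ be a transitive compact Polish foliated space, and let $X_{0,\mathrm d}\subset X$ be the union of the leaves that are dense and without holonomy. Then the following dichotomy holds: (i) either all leaves in $X_{0,\mathrm d}$ are equi-coarsely quasi-isometric to each other; or else (ii) every leaf in $X$ is coarsely quasi-isometric to meagerly many leaves; in particular, in this case, there are uncountably many coarse quasi-isometry types of leaves in $X_{0,\mathrm d}$.
   Context: Foliated spaces. A (topological) foliated structure $\mathcal F$ of dimension $n$ on a space $X$ is given by an atlas $\{(U_i,\phi_i)\}$, where $\{U_i\}$ is an open cover of $X$ and $\phi_i:U_i\to B_i\times Z_i$ are homeomorphisms, with $B_i\subset\mathbb R^n$ an open ball and $Z_i$ a locally compact Polish space, whose changes of coordinates are locally of the form $\phi_j\phi_i^{-1}(x,z)=(x_{ij}(x,z),h_{ij}(z))$. The sets $\phi_i^{-1}(B_i\times\{z\})$ are the plaques; the leaves are the connected components of $X$ with the (leaf) topology whose basic open sets are the plaques of all foliated charts. $(X,\mathcal F)$ is a compact Polish foliated space if $X$ is compact, Hausdorff and second countable. It is transitive if some leaf is dense in $X$. Regular atlas and holonomy. A foliated atlas $\mathcal U=\{(U_i,\phi_i)\}$ is regular if: each $(U_i,\phi_i)$ is the restriction of a foliated chart $(\widetilde U_i,\tilde\phi_i)$ with $\overline{U_i}\subset\widetilde U_i$; $\{U_i\}$ is locally finite; and the closure of every plaque of $(U_i,\phi_i)$ meets at most the closure of one plaque of $(U_j,\phi_j)$, for all $i,j$. Let $p_i:U_i\to Z_i$ be $\phi_i$ followed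 by the second projection; there are homeomorphisms $h_{ij}:p_i(U_i\cap U_j)\to p_j(U_i\cap U_j)$ with $p_j=h_{ij}p_i$ on $U_i\cap U_j$, generating the holonomy pseudogroup $\mathcal H$ on $\bigsqcup_iZ_i$. The holonomy group of the leaf through $x\in U_i$ is the group of germs at $p_i(x)$ of maps in $\mathcal H$ fixing $p_i(x)$; a leaf is without holonomy if this group is trivial. Leaf metrics. Fix a regular foliated atlas $\mathcal U$. For $x,y$ in the same leaf, $d^*_{\mathcal U}(x,y)=0$ if $x=y$, and otherwise it is the minimum number of $\mathcal U$-plaques whose union is connected and contains $x$ and $y$. Leaves are considered as metric spaces with $d^*_{\mathcal U}$; the notions used do not depend on the choice of $\mathcal U$. Coarse quasi-isometries. For $K\ge0$, $A\subset M$ is a $K$-net in a metric space $M$ if every point of $M$ is at distance $\le K$ from some point of $A$. For $C\ge1$, a $(K,C)$-coarse quasi-isometry of $M$ to $M'$ is a bijection $f:A\to A'$ between $K$-nets $A\subset M$ and $A'\subset M'$ with $\frac1C d(x,y)\le d'(f(x),f(y))\le C\,d(x,y)$ for all $x,y\in A$. $M$ and $M'$ are coarsely quasi-isometric (have the same coarse quasi-isometry type) if such an $f$ exists for some $(K,C)$. The metric spaces in a family are equi-coarsely quasi-isometric to each other if there is a single $(K,C)$ such that any two of them admit a $(K,C)$-coarse quasi-isometry. Meagerly many. A subset is meager if it is a countable union of nowhere dense sets. A property holds for meagerly many leaves if the union of the leaves satisfying it is meager in $X$. *)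

theory Defs
  imports "HOL-Analysis.Analysis"
begin

section \<open>Foliated charts and foliated structures\<close>

definition euclidean_open_ball :: "nat \<Rightarrow> (nat \<Rightarrow> real) set \<Rightarrow> bool" where
  "euclidean_open_ball n B \<longleftrightarrow>
     (\<exists>a r. a \<in> topspace (Euclidean_space n) \<and> r > 0 \<and>
        B = {x \<in> topspace (Euclidean_space n). sqrt (\<Sum>i<n. (x i - a i)\<^sup>2) < r})"

definition Polish_space :: "'z topology \<Rightarrow> bool" where
  "Polish_space Z \<longleftrightarrow> completely_metrizable_space Z \<and> second_countable Z"

text \<open>
  A chart consists of its domain, coordinate map, ball and transversal. The transversals of different
  charts are unrelated topologies on subsets of one type \<open>'z\<close>, which is arbitrary. The values of
  \<open>chart_map\<close> outside \<open>chart_dom\<close> are never used.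
\<close>

record ('a, 'z) chart =
  chart_dom :: "'a set"
  chart_map :: "'a \<Rightarrow> (nat \<Rightarrow> real) \<times> 'z"
  chart_ball :: "(nat \<Rightarrow> real) set"
  chart_trans :: "'z topology"

definition foliated_chart :: "nat \<Rightarrow> 'a topology \<Rightarrow> ('a, 'z) chart \<Rightarrow> bool" where
  "foliated_chart n X c \<longleftrightarrow>
     openin X (chart_dom c) \<and>
     euclidean_open_ball n (chart_ball c) \<and>
     locally_compact_space (chart_trans c) \<and> Polish_space (chart_trans c) \<and>
     homeomorphic_map (subtopology X (chart_dom c))
       (prod_topology (subtopology (Euclidean_space n) (chart_ball c)) (chart_trans c))
       (chart_map c)"

text \<open>
  The change of coordinates from \<open>c\<close> to \<open>d\<close> is locally of the form \<open>(x, z) \<mapsto> (f (x, z), h z)\<close>.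
  Continuity of \<open>f\<close> and \<open>h\<close> on small product neighbourhoods is automatic, the coordinate maps being
  homeomorphisms.
\<close>

definition foliated_change :: "'a topology \<Rightarrow> ('a, 'z) chart \<Rightarrow> ('a, 'z) chart \<Rightarrow> bool" where
  "foliated_change X c d \<longleftrightarrow>
     (\<forall>p \<in> chart_dom c \<inter> chart_dom d. \<exists>W f h.
        openin X W \<and> p \<in> W \<and> W \<subseteq> chart_dom c \<inter> chart_dom d \<and>
        (\<forall>q\<in>W. chart_map d q = (f (chart_map c q), h (snd (chart_map c q)))))"

definition foliated_atlas :: "nat \<Rightarrow> 'a topology \<Rightarrow> ('a, 'z) chart set \<Rightarrow> bool" where
  "foliated_atlas n X A \<longleftrightarrow>
     (\<forall>c\<in>A. foliated_chart n X c) \<and>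
     (\<Union>c\<in>A. chart_dom c) = topspace X \<and>
     (\<forall>c\<in>A. \<forall>d\<in>A. foliated_change X c d)"

text \<open>
  A foliated structure is represented by the maximal atlas of all of its foliated charts; every atlas
  is contained in exactly one maximal atlas.
\<close>

definition foliated_structure :: "nat \<Rightarrow> 'a topology \<Rightarrow> ('a, 'z) chart set \<Rightarrow> bool" where
  "foliated_structure n X F \<longleftrightarrow>
     foliated_atlas n X F \<and>
     (\<forall>c. foliated_chart n X c \<and> (\<forall>d\<in>F. foliated_change X c d \<and> foliated_change X d c) \<longrightarrow> c \<in> F)"

definition compact_Polish_foliated_space ::
    "nat \<Rightarrow> 'a topology \<Rightarrow> ('a, 'z) chart set \<Rightarrow> bool" where
  "compact_Polish_foliated_space n X F \<longleftrightarrow>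
     compact_space X \<and> Hausdorff_space X \<and> second_countable X \<and> foliated_structure n X F"

definition plaque :: "('a, 'z) chart \<Rightarrow> 'z \<Rightarrow> 'a set" where
  "plaque c z = {x \<in> chart_dom c. chart_map c x \<in> chart_ball c \<times> {z}}"

definition plaques :: "('a, 'z) chart \<Rightarrow> 'a set set" where
  "plaques c = plaque c ` topspace (chart_trans c)"

text \<open>
  The plaques of all charts of a foliated structure form a base, so generating a topology by them as
  a subbase is the same as declaring them to be the basic open sets.
\<close>

definition leaf_topology :: "('a, 'z) chart set \<Rightarrow> 'a topology" where
  "leaf_topology F = topology_generated_by (\<Union>c\<in>F. plaques c)"

definition leaves :: "('a, 'z) chart set \<Rightarrow> 'a set set" where
  "leaves F = connected_components_of (leaf_topology F)"

definition dense_in :: "'a topology \<Rightarrow> 'a set \<Rightarrow> bool" where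
  "dense_in X S \<longleftrightarrow> S \<subseteq> topspace X \<and> X closure_of S = topspace X"

definition transitive_foliated_space :: "'a topology \<Rightarrow> ('a, 'z) chart set \<Rightarrow> bool" where
  "transitive_foliated_space X F \<longleftrightarrow> (\<exists>L \<in> leaves F. dense_in X L)"


section \<open>Regular atlases and holonomy\<close>

definition chart_restriction :: "('a, 'z) chart \<Rightarrow> ('a, 'z) chart \<Rightarrow> bool" where
  "chart_restriction c c' \<longleftrightarrow>
     chart_dom c \<subseteq> chart_dom c' \<and>
     chart_ball c \<subseteq> chart_ball c' \<and>
     topspace (chart_trans c) \<subseteq> topspace (chart_trans c') \<and>
     chart_trans c = subtopology (chart_trans c') (topspace (chart_trans c)) \<and>
     (\<forall>x \<in> chart_dom c. chart_map c x = chart_map c' x)"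

text \<open>
  \<open>U\<close> is a regular foliated atlas of the foliated structure \<open>F\<close> on \<open>X\<close>. Local finiteness is that of
  the family of domains indexed by the charts.
\<close>

definition regular_foliated_atlas ::
    "nat \<Rightarrow> 'a topology \<Rightarrow> ('a, 'z) chart set \<Rightarrow> ('a, 'z) chart set \<Rightarrow> bool" where
  "regular_foliated_atlas n X F U \<longleftrightarrow>
     U \<subseteq> F \<and> foliated_atlas n X U \<and>
     (\<forall>c\<in>U. \<exists>c'\<in>F. chart_restriction c c' \<and> X closure_of chart_dom c \<subseteq> chart_dom c') \<and>
     (\<forall>x \<in> topspace X. \<exists>V. openin X V \<and> x \<in> V \<and> finite {c \<in> U. chart_dom c \<inter> V \<noteq> {}}) \<and>
     (\<forall>c\<in>U. \<forall>d\<in>U. \<forall>P \<in> plaques c. \<forall>Q \<in> plaques d. \<forall>Q' \<in> plaques d.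
        X closure_of P \<inter> X closure_of Q \<noteq> {} \<and> X closure_of P \<inter> X closure_of Q' \<noteq> {} \<longrightarrow>
        X closure_of Q = X closure_of Q')"

definition chart_proj :: "('a, 'z) chart \<Rightarrow> 'a \<Rightarrow> 'z" where
  "chart_proj c x = snd (chart_map c x)"

definition transversal :: "('a, 'z) chart set \<Rightarrow> (('a, 'z) chart \<times> 'z) topology" where
  "transversal U = sum_topology chart_trans U"

text \<open>
  Homeomorphisms between open subsets of \<open>transversal U\<close> are represented by their graphs. The
  rule \<open>generator\<close> gives the graph of the map \<open>h\<^sub>i\<^sub>j\<close> determined by \<open>p\<^sub>j = h\<^sub>i\<^sub>j \<circ> p\<^sub>i\<close>; the other rules are
  the closure properties of a pseudogroup.
\<close>

inductive_set holonomy_pseudogroup ::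
    "('a, 'z) chart set \<Rightarrow> ((('a, 'z) chart \<times> 'z) \<times> (('a, 'z) chart \<times> 'z)) set set"
  for U :: "('a, 'z) chart set" where
  generator: "i \<in> U \<Longrightarrow> j \<in> U \<Longrightarrow>
    {((i, chart_proj i x), (j, chart_proj j x)) | x. x \<in> chart_dom i \<inter> chart_dom j}
      \<in> holonomy_pseudogroup U"
| identity: "Id_on (topspace (transversal U)) \<in> holonomy_pseudogroup U"
| inverse: "g \<in> holonomy_pseudogroup U \<Longrightarrow> g\<inverse> \<in> holonomy_pseudogroup U"
| composition: "g \<in> holonomy_pseudogroup U \<Longrightarrow> h \<in> holonomy_pseudogroup U \<Longrightarrow>
    g O h \<in> holonomy_pseudogroup U"
| restriction: "g \<in> holonomy_pseudogroup U \<Longrightarrow> openin (transversal U) W \<Longrightarrow>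
    g \<inter> (W \<times> UNIV) \<in> holonomy_pseudogroup U"
| gluing: "(\<And>g. g \<in> G \<Longrightarrow> g \<in> holonomy_pseudogroup U) \<Longrightarrow>
    single_valued (\<Union>G) \<Longrightarrow> single_valued ((\<Union>G)\<inverse>) \<Longrightarrow> \<Union>G \<in> holonomy_pseudogroup U"

definition germ_at :: "'t topology \<Rightarrow> 't \<Rightarrow> ('t \<times> 't) set \<Rightarrow> ('t \<times> 't) set set" where
  "germ_at T p g = {h. \<exists>W. openin T W \<and> p \<in> W \<and> h \<inter> (W \<times> UNIV) = g \<inter> (W \<times> UNIV)}"

text \<open>The underlying set of the holonomy group at the point \<open>p\<close> of the transversal.\<close>

definition holonomy_group ::
    "('a, 'z) chart set \<Rightarrow> ('a, 'z) chart \<times> 'z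
      \<Rightarrow> ((('a, 'z) chart \<times> 'z) \<times> (('a, 'z) chart \<times> 'z)) set set set" where
  "holonomy_group U p = germ_at (transversal U) p ` {g \<in> holonomy_pseudogroup U. (p, p) \<in> g}"

text \<open>
  Up to conjugation the holonomy group of a leaf is independent of the point and of the chart, so
  triviality is required at all of them.
\<close>

definition without_holonomy :: "('a, 'z) chart set \<Rightarrow> 'a set \<Rightarrow> bool" where
  "without_holonomy U L \<longleftrightarrow>
     (\<forall>x\<in>L. \<forall>i\<in>U. x \<in> chart_dom i \<longrightarrow>
        holonomy_group U (i, chart_proj i x)
          = {germ_at (transversal U) (i, chart_proj i x) (Id_on (topspace (transversal U)))})"

definition dense_leaves_without_holonomy ::
    "'a topology \<Rightarrow> ('a, 'z) chart set \<Rightarrow> ('a, 'z) chart set \<Rightarrow> 'a set" where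
  "dense_leaves_without_holonomy X F U =
     \<Union>{L \<in> leaves F. dense_in X L \<and> without_holonomy U L}"


section \<open>Coarse geometry of the leaves\<close>

text \<open>
  Meant for \<open>x\<close> and \<open>y\<close> in the same leaf. Connectedness of the union of plaques refers to the leaf
  topology.
\<close>

definition plaque_dist :: "('a, 'z) chart set \<Rightarrow> ('a, 'z) chart set \<Rightarrow> 'a \<Rightarrow> 'a \<Rightarrow> real" where
  "plaque_dist F U x y =
     (if x = y then 0
      else real (LEAST k. \<exists>\<P>. \<P> \<subseteq> (\<Union>c\<in>U. plaques c) \<and> finite \<P> \<and> card \<P> = k \<and>
                    connectedin (leaf_topology F) (\<Union>\<P>) \<and> x \<in> \<Union>\<P> \<and> y \<in> \<Union>\<P>))"

definition is_net :: "real \<Rightarrow> 'a set \<Rightarrow> ('a \<Rightarrow> 'a \<Rightarrow> real) \<Rightarrow> 'a set \<Rightarrow> bool" where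
  "is_net K M d A \<longleftrightarrow> A \<subseteq> M \<and> (\<forall>x\<in>M. \<exists>a\<in>A. d x a \<le> K)"

definition coarse_quasi_isometry ::
    "real \<Rightarrow> real \<Rightarrow> 'a set \<Rightarrow> ('a \<Rightarrow> 'a \<Rightarrow> real) \<Rightarrow> 'b set \<Rightarrow> ('b \<Rightarrow> 'b \<Rightarrow> real)
      \<Rightarrow> 'a set \<Rightarrow> 'b set \<Rightarrow> ('a \<Rightarrow> 'b) \<Rightarrow> bool" where
  "coarse_quasi_isometry K C M d M' d' A A' f \<longleftrightarrow>
     0 \<le> K \<and> 1 \<le> C \<and> is_net K M d A \<and> is_net K M' d' A' \<and> bij_betw f A A' \<and>
     (\<forall>x\<in>A. \<forall>y\<in>A. (1 / C) * d x y \<le> d' (f x) (f y) \<and> d' (f x) (f y) \<le> C * d x y)"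

definition coarsely_quasi_isometric ::
    "'a set \<Rightarrow> ('a \<Rightarrow> 'a \<Rightarrow> real) \<Rightarrow> 'b set \<Rightarrow> ('b \<Rightarrow> 'b \<Rightarrow> real) \<Rightarrow> bool" where
  "coarsely_quasi_isometric M d M' d' \<longleftrightarrow>
     (\<exists>K C A A' f. coarse_quasi_isometry K C M d M' d' A A' f)"

text \<open>The family consists of subsets \<open>M\<close> with the restrictions of one function \<open>d\<close>.\<close>

definition equi_coarsely_quasi_isometric :: "'a set set \<Rightarrow> ('a \<Rightarrow> 'a \<Rightarrow> real) \<Rightarrow> bool" where
  "equi_coarsely_quasi_isometric \<M> d \<longleftrightarrow>
     (\<exists>K C. 0 \<le> K \<and> 1 \<le> C \<and>
        (\<forall>M\<in>\<M>. \<forall>M'\<in>\<M>. \<exists>A A' f. coarse_quasi_isometry K C M d M' d A A' f))"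

definition leaves_in :: "('a, 'z) chart set \<Rightarrow> 'a set \<Rightarrow> 'a set set" where
  "leaves_in F S = {L \<in> leaves F. L \<subseteq> S}"

definition cqi_leaves :: "('a, 'z) chart set \<Rightarrow> ('a, 'z) chart set \<Rightarrow> 'a set \<Rightarrow> 'a set \<Rightarrow> bool" where
  "cqi_leaves F U L L' \<longleftrightarrow>
     coarsely_quasi_isometric L (plaque_dist F U) L' (plaque_dist F U)"

definition cqi_types :: "('a, 'z) chart set \<Rightarrow> ('a, 'z) chart set \<Rightarrow> 'a set set \<Rightarrow> 'a set set set" where
  "cqi_types F U \<L> = \<L> // {(L, L'). L \<in> \<L> \<and> L' \<in> \<L> \<and> cqi_leaves F U L L'}"


section \<open>Meager sets\<close>

definition nowhere_dense_in :: "'a topology \<Rightarrow> 'a set \<Rightarrow> bool" where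
  "nowhere_dense_in X S \<longleftrightarrow> S \<subseteq> topspace X \<and> X interior_of (X closure_of S) = {}"

definition meager_in :: "'a topology \<Rightarrow> 'a set \<Rightarrow> bool" where
  "meager_in X S \<longleftrightarrow> (\<exists>\<N>. countable \<N> \<and> (\<forall>N\<in>\<N>. nowhere_dense_in X N) \<and> S = \<Union>\<N>)"

definition meagerly_many_leaves ::
    "'a topology \<Rightarrow> ('a, 'z) chart set \<Rightarrow> ('a set \<Rightarrow> bool) \<Rightarrow> bool" where
  "meagerly_many_leaves X F P \<longleftrightarrow> meager_in X (\<Union>{L \<in> leaves F. P L})"

end

theory Submission
  imports Defs
begin

text \<open>
  Call two points adjacent if some plaque of the atlas contains both. Leaves are the classes of the
  generated equivalence relation \<open>E\<^sup>*\<close>, and \<open>d\<^sup>*(x, y) \<le> k\<close> holds iff \<open>(x, y) \<in> E ^^ k\<close>.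

  Fix a leaf \<open>L\<close> through \<open>x\<close>. The points \<open>y\<close> whose leaf is coarsely quasi-isometric to \<open>L\<close> form a
  countable union of sets \<open>near x m\<close>, where \<open>m\<close> bounds the distortion and the distance from \<open>x\<close> to a
  partner of \<open>y\<close>. If \<open>y\<close> lies in the closure of \<open>near x m\<close> and its leaf has no holonomy, then the
  correspondences of \<open>L\<close> with the leaves of nearby points converge along an ultrafilter to a
  correspondence of \<open>L\<close> with the leaf of \<open>y\<close>: the upper bound on distances in the limit comes from
  compactness, the lower bound from trivial holonomy. Its distortion depends only on \<open>m\<close>. Hence if
  some \<open>near x m\<close> is somewhere dense, every dense leaf without holonomy meets the interior of its
  closure, and all these leaves are uniformly close to \<open>L\<close>. Otherwise the coarse type of every leaf
  is meager. The rest is Baire's theorem, since dense leaves without holonomy fill a residual set.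
\<close>

section \<open>Chains in covers of connected sets\<close>

text \<open>Bijections between nets do not survive a limit, whereas relations do; hence
  \<open>corr\<close> works with total relations and with powers of \<open>E\<close> instead of real
  distances. The leaf of \<open>x\<close> stays fixed while a point \<open>\<eta>\<close> tends to
  \<open>y\<close>, and points of nearby leaves become functions of \<open>\<eta>\<close>. Two
  obstacles shape the limit. Adjacency is not closed: pairs sharing plaques of a chart may converge
  to points outside its domain, so one step may cost several in the limit. Their number is bounded
  for each chart, and only finitely many charts have nonempty domain; this is the origin of the
  constant \<open>N\<close> in \<open>transport_relpow\<close>. Conversely, points close together on
  the leaf of \<open>y\<close> may be shadowed by points on different sheets of a nearby leaf,
  because a loop can carry holonomy. Trivial holonomy is asked of the limit leaf alone, so
  \<open>x\<close> may lie on any leaf, as the second alternative demands. All constants are fixed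
  before \<open>x\<close> and \<open>y\<close>. The alternatives exclude each other because the
  union of the dense leaves without holonomy is not meager.\<close>

lemma relpow_add_iff: "(x, y) \<in> R ^^ (m + n) \<longleftrightarrow> (\<exists>z. (x, z) \<in> R ^^ m \<and> (z, y) \<in> R ^^ n)"
  by (auto simp: relpow_add)

lemma relpow_mono_refl:
  assumes "refl_on A R" "R \<subseteq> A \<times> A" "(x, y) \<in> R ^^ m" "y \<in> A" "m \<le> n"
  shows "(x, y) \<in> R ^^ n"
  using \<open>m \<le> n\<close>
proof (induction rule: dec_induct)
  case (step k)
  then show ?case using assms(1,4) by (auto simp: refl_on_def)
qed (use assms in auto)

lemma relpow_subset_mono:
  fixes R S :: "('a \<times> 'a) set"
  shows "R \<subseteq> S \<Longrightarrow> R ^^ k \<subseteq> S ^^ k"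
  by (induction k) auto

lemma relpow_sym_iff: "sym R \<Longrightarrow> (x, y) \<in> R ^^ n \<longleftrightarrow> (y, x) \<in> R ^^ n"
proof (induction n arbitrary: x y)
  case (Suc n)
  have "(x, y) \<in> R ^^ Suc n \<longleftrightarrow> (\<exists>z. (x, z) \<in> R ^^ n \<and> (z, y) \<in> R)"
    by auto
  also have "\<dots> \<longleftrightarrow> (\<exists>z. (y, z) \<in> R \<and> (z, x) \<in> R ^^ n)"
    using Suc by (meson symD)
  also have "\<dots> \<longleftrightarrow> (y, x) \<in> R ^^ Suc n"
    using relpow_commute[of R n] by (metis relcomp.simps relpow.simps(2))
  finally show ?case .
qed auto

text \<open>The cover members meeting the set reachable from \<open>x\<close> and the remaining
  members split \<open>D\<close> into two disjoint relatively open parts, so connectedness empties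
  the second. A shortest chain uses no member twice, whence the length \<open>card \<W>\<close>. The
  lemma serves both for plaques in the leaf topology and for open sets of \<open>X\<close> along a
  slice of a chart.\<close>

lemma connected_chain:
  assumes D: "connectedin T D" and fin: "finite \<W>"
    and op: "\<And>W. W \<in> \<W> \<Longrightarrow> openin T W" and cov: "D \<subseteq> \<Union>\<W>"
    and x: "x \<in> D" and y: "y \<in> D"
  shows "(x, y) \<in> {(p, q). p \<in> D \<and> q \<in> D \<and> (\<exists>W\<in>\<W>. p \<in> W \<and> q \<in> W)} ^^ card \<W>"
proof -
  define C where "C = {(p, q). p \<in> D \<and> q \<in> D \<and> (\<exists>W\<in>\<W>. p \<in> W \<and> q \<in> W)}"
  define S where "S = {q. (x, q) \<in> C\<^sup>*}"
  define A where "A = \<Union>{W \<in> \<W>. W \<inter> D \<inter> S \<noteq> {}}"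
  define B where "B = \<Union>{W \<in> \<W>. W \<inter> D \<inter> S = {}}"
  have SD: "S \<subseteq> D"
  proof
    fix q assume "q \<in> S"
    then have "(x, q) \<in> C\<^sup>*" by (simp add: S_def)
    then show "q \<in> D" using x by (induction rule: rtrancl_induct) (auto simp: C_def)
  qed
  have AS: "q \<in> S" if q: "q \<in> A" "q \<in> D" for q
  proof -
    from q obtain W p where W: "W \<in> \<W>" "q \<in> W" "p \<in> W" "p \<in> D" "p \<in> S"
      unfolding A_def by blast
    then have "(p, q) \<in> C" using q by (auto simp: C_def)
    then show ?thesis using W(5) by (auto simp: S_def)
  qed
  have opA: "openin T A" and opB: "openin T B"
    unfolding A_def B_def using op by (auto intro!: openin_Union)
  have "A \<inter> D \<noteq> {}"
  proof -
    obtain W where "W \<in> \<W>" "x \<in> W" using cov x by blast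
    moreover have "x \<in> S" by (simp add: S_def)
    ultimately have "W \<in> {W \<in> \<W>. W \<inter> D \<inter> S \<noteq> {}}" using x by auto
    then have "x \<in> A" unfolding A_def using \<open>x \<in> W\<close> by (rule UnionI)
    then show ?thesis using x by auto
  qed
  moreover have "A \<inter> B \<inter> D = {}"
    using AS unfolding B_def by blast
  moreover have "D \<subseteq> A \<union> B"
  proof -
    have "A \<union> B = \<Union>\<W>" unfolding A_def B_def by auto
    then show ?thesis using cov by simp
  qed
  ultimately have "B \<inter> D = {}"
    using D opA opB unfolding connectedin by blast
  then have "y \<in> S" using AS \<open>D \<subseteq> A \<union> B\<close> y by blast
  then have ex: "\<exists>k. (x, y) \<in> C ^^ k" by (auto simp: S_def rtrancl_power)
  define m where "m = (LEAST k. (x, y) \<in> C ^^ k)"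
  have m: "(x, y) \<in> C ^^ m" unfolding m_def using ex by (rule LeastI_ex)
  have min: "m \<le> k" if "(x, y) \<in> C ^^ k" for k unfolding m_def using that by (rule Least_le)
  obtain f where f: "f 0 = x" "f m = y" "\<And>i. i < m \<Longrightarrow> (f i, f (Suc i)) \<in> C"
    using m unfolding relpow_fun_conv by blast
  have "\<forall>i\<in>{..<m}. \<exists>W\<in>\<W>. f i \<in> W \<and> f (Suc i) \<in> W" using f(3) by (auto simp: C_def)
  then obtain g where g: "\<And>i. i < m \<Longrightarrow> g i \<in> \<W> \<and> f i \<in> g i \<and> f (Suc i) \<in> g i"
    by (metis lessThan_iff)
  have seg: "(f i, f (i + j)) \<in> C ^^ j" if "i + j \<le> m" for i j
    using that
  proof (induction j)
    case (Suc j)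
    then have "(f (i + j), f (Suc (i + j))) \<in> C" by (intro f(3)) simp
    then show ?case using Suc by auto
  qed simp
  \<comment> \<open>If one member served the steps \<open>s\<close> and \<open>t\<close>, the chain
    could jump from \<open>f s\<close> to \<open>f (Suc t)\<close>, against minimality of
    \<open>m\<close>.\<close>
  have "inj_on g {..<m}"
  proof (rule linorder_inj_onI)
    fix s t assume st: "s < t" "s \<in> {..<m}" "t \<in> {..<m}"
    show "g s \<noteq> g t"
    proof
      assume eq: "g s = g t"
      have "f s \<in> D" "f (Suc t) \<in> D" using f(3)[of s] f(3)[of t] st by (auto simp: C_def)
      then have 1: "(f s, f (Suc t)) \<in> C" using g[of s] g[of t] st eq by (auto simp: C_def)
      have "(x, f s) \<in> C ^^ s" using seg[of 0 s] st f by auto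
      then have "(x, f (Suc t)) \<in> C ^^ Suc s" using 1 by auto
      moreover have "(f (Suc t), y) \<in> C ^^ (m - Suc t)" using seg[of "Suc t" "m - Suc t"] st f by auto
      ultimately have "(x, y) \<in> C ^^ (Suc s + (m - Suc t))" unfolding relpow_add_iff by blast
      then have "m \<le> Suc s + (m - Suc t)" by (rule min)
      then show False using st by auto
    qed
  qed auto
  then have "m \<le> card \<W>" using card_inj_on_le[of g "{..<m}" \<W>] g fin by auto
  \<comment> \<open>Reflexivity on \<open>D\<close> pads the shortest chain to exactly
    \<open>card \<W>\<close> steps.\<close>
  moreover have "refl_on D C" using cov by (auto simp: refl_on_def C_def)
  moreover have "C \<subseteq> D \<times> D" by (auto simp: C_def)
  ultimately show ?thesis using relpow_mono_refl[of D C x y m] m y unfolding C_def by simp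
qed

section \<open>Ultrafilters\<close>

definition ultrafilter :: "'a filter \<Rightarrow> bool" where
  "ultrafilter F \<longleftrightarrow> F \<noteq> bot \<and> (\<forall>P. eventually P F \<or> eventually (\<lambda>x. \<not> P x) F)"

text \<open>Zorn's lemma for the reversed order gives a minimal proper filter below
  \<open>F\<close>. Adding \<open>P\<close> to it yields either the improper filter, so that the
  negation of \<open>P\<close> holds eventually, or by minimality the same filter.\<close>

lemma ultrafilter_below:
  assumes "F \<noteq> bot"
  obtains G where "ultrafilter G" "G \<le> F"
proof -
  define A where "A = {G. G \<noteq> bot \<and> G \<le> F}"
  have "\<exists>m\<in>A. \<forall>a\<in>A. m \<ge> a \<longrightarrow> a = m"
  proof (rule predicate_Zorn[where P = "\<lambda>x y. x \<ge> y"])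
    show "partial_order_on A (relation_of (\<lambda>x y. x \<ge> y) A)"
      by (rule partial_order_on_relation_ofI) auto
    fix C assume C: "C \<in> Chains (relation_of (\<lambda>x y. y \<le> x) A)"
    then have CA: "C \<subseteq> A" and lin: "\<And>G H. G \<in> C \<Longrightarrow> H \<in> C \<Longrightarrow> G \<le> H \<or> H \<le> G"
      by (auto simp: Chains_def relation_of_def)
    show "\<exists>u\<in>A. \<forall>a\<in>C. u \<le> a"
    proof (cases "C = {}")
      case True
      then show ?thesis using assms by (auto simp: A_def)
    next
      case False
      have "eventually P (Inf C) \<longleftrightarrow> (\<exists>b\<in>C. eventually P b)" for P
      proof (rule eventually_Inf_base[OF False])
        fix G H assume "G \<in> C" "H \<in> C"
        with lin[OF this] show "\<exists>x\<in>C. x \<le> inf G H" by (metis inf.absorb1 inf.absorb2 order_refl)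
      qed
      then have "Inf C \<noteq> bot" using CA unfolding trivial_limit_def A_def by auto
      moreover have "Inf C \<le> F" using False CA by (auto simp: A_def intro: Inf_lower2)
      ultimately show ?thesis by (auto simp: A_def intro!: bexI[of _ "Inf C"] Inf_lower)
    qed
  qed
  then obtain G where G: "G \<in> A" and max: "\<And>H. H \<in> A \<Longrightarrow> H \<le> G \<Longrightarrow> H = G" by blast
  have "eventually P G \<or> eventually (\<lambda>x. \<not> P x) G" for P
  proof (cases "inf G (principal {x. P x}) = bot")
    case True
    then have "eventually (\<lambda>x. False) (inf G (principal {x. P x}))" by simp
    then show ?thesis by (auto simp: eventually_inf_principal)
  next
    case False
    then have "inf G (principal {x. P x}) \<in> A" using G by (auto simp: A_def intro: le_infI1)
    then have "inf G (principal {x. P x}) = G" by (intro max) auto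
    moreover have "eventually P (inf G (principal {x. P x}))"
      by (simp add: eventually_inf_principal)
    ultimately have "eventually P G" by simp
    then show ?thesis ..
  qed
  then show ?thesis using that[of G] G by (auto simp: ultrafilter_def A_def)
qed

text \<open>This makes a choice that varies with the index constant along the filter: below, the
  choice of a chart and the choice of a plaque.\<close>

lemma ultrafilter_finite_split:
  assumes "ultrafilter F" "finite I" "eventually (\<lambda>x. \<exists>i\<in>I. P i x) F"
  obtains i where "i \<in> I" "eventually (P i) F"
proof -
  have "\<exists>i\<in>I. eventually (P i) F"
  proof (rule ccontr)
    assume "\<not> ?thesis"
    then have "\<forall>i\<in>I. eventually (\<lambda>x. \<not> P i x) F" using assms(1) unfolding ultrafilter_def by blast
    then have "eventually (\<lambda>x. \<forall>i\<in>I. \<not> P i x) F" using assms(2) by (simp add: eventually_ball_finite)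
    then have "eventually (\<lambda>x. False) F" using assms(3) by eventually_elim auto
    then show False using assms(1) by (simp add: ultrafilter_def trivial_limit_def)
  qed
  then show ?thesis using that by blast
qed

text \<open>Otherwise every point has a neighbourhood that \<open>u\<close> eventually avoids, since
  the ultrafilter decides membership; a finite subcover then leaves no place for
  \<open>u\<close>.\<close>

lemma compact_space_ultralimit:
  assumes "compact_space X" "ultrafilter F" "eventually (\<lambda>i. u i \<in> topspace X) F"
  obtains x where "limitin X u x F"
proof -
  have "\<exists>x. limitin X u x F"
  proof (rule ccontr)
    assume no: "\<not> ?thesis"
    have "\<exists>V. openin X V \<and> x \<in> V \<and> eventually (\<lambda>i. u i \<notin> V) F" if "x \<in> topspace X" for x
      using no that assms(2) unfolding limitin_def ultrafilter_def by blast
    then obtain V where V: "\<And>x. x \<in> topspace X \<Longrightarrow> openin X (V x) \<and> x \<in> V x \<and> eventually (\<lambda>i. u i \<notin> V x) F"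
      by metis
    have "topspace X \<subseteq> \<Union>(V ` topspace X)" using V by blast
    moreover have "\<And>W. W \<in> V ` topspace X \<Longrightarrow> openin X W" using V by auto
    ultimately obtain \<F> where "finite \<F>" "\<F> \<subseteq> V ` topspace X" "topspace X \<subseteq> \<Union>\<F>"
      using assms(1) unfolding compact_space_alt by meson
    then obtain S where S: "finite S" "S \<subseteq> topspace X" "topspace X \<subseteq> \<Union>(V ` S)"
      by (metis finite_subset_image)
    have "eventually (\<lambda>i. \<forall>x\<in>S. u i \<notin> V x) F"
      using S V by (intro eventually_ball_finite) auto
    then have "eventually (\<lambda>i. False) F"
    using assms(3)
    proof eventually_elim
      case (elim i)
      then show False using S(3) by blast
    qed
    then show False using assms(2) by (simp add: ultrafilter_def trivial_limit_def)
  qed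
  then show ?thesis using that by blast
qed

section \<open>Meager sets\<close>

lemma nowhere_dense_in_subset:
  "nowhere_dense_in X S \<Longrightarrow> T \<subseteq> S \<Longrightarrow> nowhere_dense_in X T"
  unfolding nowhere_dense_in_def
  by (metis closure_of_mono interior_of_mono order_trans subset_empty)

text \<open>Testing \<open>V = X interior_of (X closure_of S)\<close> suffices: an open set that
  misses \<open>S\<close> also misses its closure.\<close>

lemma nowhere_dense_inI:
  assumes "S \<subseteq> topspace X"
    and "\<And>V. openin X V \<Longrightarrow> V \<noteq> {} \<Longrightarrow> \<exists>V'. openin X V' \<and> V' \<noteq> {} \<and> V' \<subseteq> V \<and> V' \<inter> S = {}"
  shows "nowhere_dense_in X S"
proof -
  have "X interior_of (X closure_of S) = {}"
  proof (rule ccontr)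
    assume ne: "\<not> ?thesis"
    obtain V where V: "openin X V" "V \<noteq> {}" "V \<subseteq> X interior_of (X closure_of S)" "V \<inter> S = {}"
      using assms(2)[OF openin_interior_of ne] by blast
    then have "V \<inter> X closure_of S = {}" by (simp add: openin_Int_closure_of_eq_empty)
    then show False using V interior_of_subset[of X "X closure_of S"] by blast
  qed
  then show ?thesis using assms(1) by (simp add: nowhere_dense_in_def)
qed

lemma meager_in_subset:
  assumes "meager_in X S" "T \<subseteq> S"
  shows "meager_in X T"
proof -
  obtain \<N> where N: "countable \<N>" "\<forall>N\<in>\<N>. nowhere_dense_in X N" "S = \<Union>\<N>"
    using assms(1) unfolding meager_in_def by blast
  show ?thesis unfolding meager_in_def
    by (rule exI[of _ "(\<lambda>N. N \<inter> T) ` \<N>"])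
      (use N assms(2) in \<open>auto intro: nowhere_dense_in_subset\<close>)
qed

lemma meager_in_UN:
  assumes "countable I" "\<And>i. i \<in> I \<Longrightarrow> meager_in X (S i)"
  shows "meager_in X (\<Union>i\<in>I. S i)"
proof -
  have "\<forall>i\<in>I. \<exists>\<N>. countable \<N> \<and> (\<forall>N\<in>\<N>. nowhere_dense_in X N) \<and> S i = \<Union>\<N>"
    using assms(2) unfolding meager_in_def by blast
  from bchoice[OF this] obtain \<N>
    where N: "\<forall>i\<in>I. countable (\<N> i) \<and> (\<forall>N\<in>\<N> i. nowhere_dense_in X N) \<and> S i = \<Union>(\<N> i)" ..
  have "countable (\<Union>i\<in>I. \<N> i)" using N by (intro countable_UN assms(1)) simp
  moreover have "\<forall>N\<in>(\<Union>i\<in>I. \<N> i). nowhere_dense_in X N" using N by blast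
  moreover have "(\<Union>i\<in>I. S i) = \<Union>(\<Union>i\<in>I. \<N> i)" 
  proof -
    have "(\<Union>i\<in>I. S i) = (\<Union>i\<in>I. \<Union>(\<N> i))" using N by simp
    then show ?thesis by blast
  qed
  ultimately show ?thesis unfolding meager_in_def by (intro exI[of _ "\<Union>i\<in>I. \<N> i"] conjI)
qed

lemma nowhere_dense_imp_meager: "nowhere_dense_in X S \<Longrightarrow> meager_in X S"
  unfolding meager_in_def by (rule exI[of _ "{S}"]) auto

lemma meager_in_Un: "meager_in X S \<Longrightarrow> meager_in X T \<Longrightarrow> meager_in X (S \<union> T)"
  using meager_in_UN[of "UNIV :: bool set" X "\<lambda>b. if b then S else T"]
  by (simp add: UNIV_bool Un_commute)

text \<open>Baire's theorem, applied to the closures of the nowhere dense pieces, which still have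
  empty interior.\<close>

lemma compact_Hausdorff_not_meager:
  assumes "compact_space X" "Hausdorff_space X" "topspace X \<noteq> {}"
  shows "\<not> meager_in X (topspace X)"
proof
  assume "meager_in X (topspace X)"
  then obtain \<N> where N: "countable \<N>" "\<forall>N\<in>\<N>. nowhere_dense_in X N" "topspace X = \<Union>\<N>"
    unfolding meager_in_def by (elim exE conjE)
  have "X interior_of \<Union>((\<lambda>N. X closure_of N) ` \<N>) = {}"
    by (rule Baire_category_alt)
      (use N(1,2) in \<open>auto simp: assms(1,2) nowhere_dense_in_def compact_imp_locally_compact_space
          compact_Hausdorff_imp_regular_space\<close>)
  moreover have "topspace X \<subseteq> \<Union>((\<lambda>N. X closure_of N) ` \<N>)"
  proof
    fix x assume "x \<in> topspace X"
    then obtain N where "N \<in> \<N>" "x \<in> N" using N(3) by blast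
    moreover have "N \<subseteq> X closure_of N" using N \<open>N \<in> \<N>\<close> by (intro closure_of_subset) auto
    ultimately show "x \<in> \<Union>((\<lambda>N. X closure_of N) ` \<N>)" by blast
  qed
  ultimately show False using assms(3)
    by (metis (no_types, lifting) bot.extremum_uniqueI interior_of_maximal_eq interior_of_mono
        interior_of_topspace)
qed

section \<open>Charts\<close>

lemma foliated_chart_openin: "foliated_chart n X c \<Longrightarrow> openin X (chart_dom c)"
  by (simp add: foliated_chart_def)

lemma foliated_chart_Hausdorff: "foliated_chart n X c \<Longrightarrow> Hausdorff_space (chart_trans c)"
  by (auto simp: foliated_chart_def Polish_space_def completely_metrizable_imp_metrizable_space
      metrizable_imp_Hausdorff_space)

lemma euclidean_open_ball_subset: "euclidean_open_ball n B \<Longrightarrow> B \<subseteq> topspace (Euclidean_space n)"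
  by (auto simp: euclidean_open_ball_def)

lemma foliated_chart_homeomorphic_map:
  assumes "foliated_chart n X c"
  shows "homeomorphic_map (subtopology X (chart_dom c))
    (prod_topology (subtopology (Euclidean_space n) (chart_ball c)) (chart_trans c)) (chart_map c)"
  using assms by (simp add: foliated_chart_def)

lemma foliated_chart_continuous_proj:
  assumes "foliated_chart n X c"
  shows "continuous_map (subtopology X (chart_dom c)) (chart_trans c) (chart_proj c)"
proof -
  have "continuous_map (subtopology X (chart_dom c)) (chart_trans c) (snd \<circ> chart_map c)"
    by (rule continuous_map_compose[OF homeomorphic_imp_continuous_map
          [OF foliated_chart_homeomorphic_map[OF assms]] continuous_map_snd])
  then show ?thesis by (simp add: comp_def chart_proj_def[abs_def])
qed

lemma foliated_chart_open_proj:
  assumes "foliated_chart n X c" "openin X V"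
  shows "openin (chart_trans c) (chart_proj c ` (V \<inter> chart_dom c))"
proof -
  have "open_map (subtopology X (chart_dom c)) (chart_trans c) (snd \<circ> chart_map c)"
    by (rule open_map_compose[OF homeomorphic_imp_open_map
          [OF foliated_chart_homeomorphic_map[OF assms(1)]] open_map_snd])
  moreover have "openin (subtopology X (chart_dom c)) (V \<inter> chart_dom c)"
    using assms(2) by (auto simp: openin_subtopology)
  ultimately show ?thesis by (simp add: open_map_def comp_def chart_proj_def[abs_def])
qed

lemma foliated_chart_openin_vimage:
  assumes "foliated_chart n X c" "openin (chart_trans c) T"
  shows "openin X {x \<in> chart_dom c. chart_proj c x \<in> T}"
proof -
  have "topspace (subtopology X (chart_dom c)) = chart_dom c"
    using foliated_chart_openin[OF assms(1)] by (intro topspace_subtopology_subset openin_subset)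
  then have "openin (subtopology X (chart_dom c)) {x \<in> chart_dom c. chart_proj c x \<in> T}"
    using openin_continuous_map_preimage[OF foliated_chart_continuous_proj[OF assms(1)] assms(2)]
    by simp
  then show ?thesis using foliated_chart_openin[OF assms(1)] openin_trans_full by blast
qed

lemma foliated_chart_image:
  assumes "foliated_chart n X c"
  shows "chart_map c ` chart_dom c = chart_ball c \<times> topspace (chart_trans c)"
proof -
  have "topspace (subtopology X (chart_dom c)) = chart_dom c"
    using foliated_chart_openin[OF assms] by (intro topspace_subtopology_subset openin_subset)
  moreover have "topspace (subtopology (Euclidean_space n) (chart_ball c)) = chart_ball c"
    using assms by (intro topspace_subtopology_subset euclidean_open_ball_subset) (simp add: foliated_chart_def)
  ultimately show ?thesis
    using homeomorphic_imp_surjective_map[OF foliated_chart_homeomorphic_map[OF assms]] by simp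
qed

lemma foliated_chart_proj_in: "foliated_chart n X c \<Longrightarrow> x \<in> chart_dom c \<Longrightarrow> chart_proj c x \<in> topspace (chart_trans c)"
  using foliated_chart_image[of n X c] by (auto simp: chart_proj_def dest!: equalityD1)

lemma foliated_chart_ball_in: "foliated_chart n X c \<Longrightarrow> x \<in> chart_dom c \<Longrightarrow> fst (chart_map c x) \<in> chart_ball c"
  using foliated_chart_image[of n X c] by (auto dest!: equalityD1)

lemma plaque_eq:
  assumes "foliated_chart n X c"
  shows "plaque c z = {x \<in> chart_dom c. chart_proj c x = z}"
  using foliated_chart_ball_in[OF assms]
  by (auto simp: plaque_def chart_proj_def mem_Times_iff)

lemma foliated_chart_inverse:
  assumes "foliated_chart n X c"
  obtains \<psi> where
    "continuous_map (prod_topology (subtopology (Euclidean_space n) (chart_ball c)) (chart_trans c))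
        (subtopology X (chart_dom c)) \<psi>"
    "\<And>x. x \<in> chart_dom c \<Longrightarrow> \<psi> (chart_map c x) = x"
    "\<And>b z. b \<in> chart_ball c \<Longrightarrow> z \<in> topspace (chart_trans c) \<Longrightarrow>
        \<psi> (b, z) \<in> chart_dom c \<and> chart_map c (\<psi> (b, z)) = (b, z)"
proof -
  have ts: "topspace (subtopology X (chart_dom c)) = chart_dom c"
    using foliated_chart_openin[OF assms] by (intro topspace_subtopology_subset openin_subset)
  have tb: "topspace (subtopology (Euclidean_space n) (chart_ball c)) = chart_ball c"
    using assms by (intro topspace_subtopology_subset euclidean_open_ball_subset) (simp add: foliated_chart_def)
  obtain \<psi> where \<psi>: "homeomorphic_maps (subtopology X (chart_dom c))
      (prod_topology (subtopology (Euclidean_space n) (chart_ball c)) (chart_trans c)) (chart_map c) \<psi>"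
    using foliated_chart_homeomorphic_map[OF assms] homeomorphic_map_maps by blast
  have "\<psi> (b, z) \<in> chart_dom c \<and> chart_map c (\<psi> (b, z)) = (b, z)"
    if "b \<in> chart_ball c" "z \<in> topspace (chart_trans c)" for b z
    using \<psi> that ts tb unfolding homeomorphic_maps_def continuous_map_def by fastforce
  then show ?thesis
    using that[of \<psi>] \<psi> ts unfolding homeomorphic_maps_def by blast
qed

lemma foliated_chart_limitin_proj:
  assumes c: "foliated_chart n X c" and u: "limitin X u x G" and x: "x \<in> chart_dom c"
  shows "limitin (chart_trans c) (\<lambda>i. chart_proj c (u i)) (chart_proj c x) G"
    and "eventually (\<lambda>i. u i \<in> chart_dom c) G"
proof -
  show ev: "eventually (\<lambda>i. u i \<in> chart_dom c) G"
    using limitinD[OF u foliated_chart_openin[OF c] x] .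
  have "limitin (subtopology X (chart_dom c)) u x G"
    using u x ev by (simp add: limitin_subtopology)
  from continuous_map_limit[OF foliated_chart_continuous_proj[OF c] this]
  show "limitin (chart_trans c) (\<lambda>i. chart_proj c (u i)) (chart_proj c x) G"
    by (simp add: comp_def)
qed

text \<open>The lift keeps the ball coordinate of \<open>q\<close> and lets the transversal
  coordinate follow \<open>u\<close>. It converges to \<open>q\<close> because \<open>q\<close> and
  \<open>x\<close> have the same transversal coordinate.\<close>

lemma foliated_chart_lift:
  assumes c: "foliated_chart n X c" and u: "limitin X u x G" and x: "x \<in> chart_dom c"
    and q: "q \<in> chart_dom c" "chart_proj c q = chart_proj c x"
  obtains w where "limitin X w q G"
    "eventually (\<lambda>i. w i \<in> chart_dom c \<and> chart_proj c (w i) = chart_proj c (u i)) G"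
proof -
  let ?P = "prod_topology (subtopology (Euclidean_space n) (chart_ball c)) (chart_trans c)"
  obtain \<psi> where \<psi>: "continuous_map ?P (subtopology X (chart_dom c)) \<psi>"
      "\<And>x. x \<in> chart_dom c \<Longrightarrow> \<psi> (chart_map c x) = x"
      "\<And>b z. b \<in> chart_ball c \<Longrightarrow> z \<in> topspace (chart_trans c) \<Longrightarrow>
          \<psi> (b, z) \<in> chart_dom c \<and> chart_map c (\<psi> (b, z)) = (b, z)"
    by (rule foliated_chart_inverse[OF c]) blast
  define b where "b = fst (chart_map c q)"
  have b: "b \<in> chart_ball c" unfolding b_def by (rule foliated_chart_ball_in[OF c q(1)])
  have bq: "chart_map c q = (b, chart_proj c x)" using q(2) by (simp add: b_def chart_proj_def prod_eq_iff)
  define w where "w = (\<lambda>i. \<psi> (b, chart_proj c (u i)))"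
  have "b \<in> topspace (subtopology (Euclidean_space n) (chart_ball c))"
    using b c euclidean_open_ball_subset[of n "chart_ball c"] by (auto simp: foliated_chart_def)
  then have "limitin ?P (\<lambda>i. (b, chart_proj c (u i))) (b, chart_proj c x) G"
    using foliated_chart_limitin_proj(1)[OF c u x]
    by (simp add: limitin_pairwise comp_def)
  from continuous_map_limit[OF \<psi>(1) this]
  have "limitin (subtopology X (chart_dom c)) w q G"
    using \<psi>(2)[OF q(1)] bq by (simp add: w_def comp_def)
  then have "limitin X w q G" by (simp add: limitin_subtopology)
  moreover have "eventually (\<lambda>i. w i \<in> chart_dom c \<and> chart_proj c (w i) = chart_proj c (u i)) G"
    using foliated_chart_limitin_proj(2)[OF c u x]
  proof eventually_elim
    case (elim i)
    show ?case using \<psi>(3)[OF b foliated_chart_proj_in[OF c elim]] by (simp add: w_def chart_proj_def)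
  qed
  ultimately show ?thesis using that by blast
qed

text \<open>The ball is star-shaped about its centre, hence a union of connected segments through
  \<open>a\<close>.\<close>

lemma connected_euclidean_open_ball:
  assumes "euclidean_open_ball n B"
  shows "connectedin (Euclidean_space n) B"
proof -
  obtain a r where a: "a \<in> topspace (Euclidean_space n)" "r > 0"
    and B: "B = {x \<in> topspace (Euclidean_space n). sqrt (\<Sum>i<n. (x i - a i)\<^sup>2) < r}"
    using assms unfolding euclidean_open_ball_def by blast
  have aB: "a \<in> B" using a by (simp add: B)
  have star: "\<exists>S. connectedin (Euclidean_space n) S \<and> S \<subseteq> B \<and> a \<in> S \<and> x \<in> S" if x: "x \<in> B" for x
  proof -
    define \<gamma> where "\<gamma> = (\<lambda>t::real. \<lambda>i. a i + t * (x i - a i))"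
    have "continuous_map (top_of_set {0..1}) (Euclidean_space n) \<gamma>"
      using a x unfolding Euclidean_space_def B
      by (auto simp: continuous_map_in_subtopology continuous_map_componentwise_UNIV \<gamma>_def
          topspace_Euclidean_space intro!: continuous_intros)
    then have "connectedin (Euclidean_space n) (\<gamma> ` {0..1})"
      by (rule connectedin_continuous_map_image) (simp add: connectedin_absolute)
    moreover have "\<gamma> ` {0..1} \<subseteq> B"
    proof (rule image_subsetI)
      fix t :: real assume t: "t \<in> {0..1}"
      have "(\<Sum>i<n. (\<gamma> t i - a i)\<^sup>2) = t\<^sup>2 * (\<Sum>i<n. (x i - a i)\<^sup>2)"
        by (simp add: \<gamma>_def power_mult_distrib sum_distrib_left)
      also have "\<dots> \<le> 1 * (\<Sum>i<n. (x i - a i)\<^sup>2)"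
        using t by (intro mult_right_mono) (auto simp: power_le_one sum_nonneg)
      finally have "sqrt (\<Sum>i<n. (\<gamma> t i - a i)\<^sup>2) < r"
        using x by (simp add: B) (meson le_less_trans real_sqrt_le_mono)
      moreover have "\<gamma> t \<in> topspace (Euclidean_space n)"
        using a x by (auto simp: B \<gamma>_def topspace_Euclidean_space)
      ultimately show "\<gamma> t \<in> B" by (simp add: B)
    qed
    moreover have "a = \<gamma> 0" "x = \<gamma> 1" by (auto simp: \<gamma>_def)
    then have "a \<in> \<gamma> ` {0..1}" "x \<in> \<gamma> ` {0..1}" by (metis atLeastAtMost_iff imageI order_refl zero_le_one)+
    ultimately show ?thesis by blast
  qed
  then obtain S where S: "\<And>x. x \<in> B \<Longrightarrow> connectedin (Euclidean_space n) (S x) \<and> S x \<subseteq> B \<and> a \<in> S x \<and> x \<in> S x"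
    by metis
  have "connectedin (Euclidean_space n) (\<Union>(S ` B))"
    by (rule connectedin_Union) (use S aB in auto)
  moreover have "\<Union>(S ` B) = B" using S by blast
  ultimately show ?thesis by simp
qed

section \<open>Plaques, leaves and the leaf metric\<close>

locale regular_foliation =
  fixes n :: nat and X :: "'a topology" and F U :: "('a, 'z) chart set"
  assumes foliated: "compact_Polish_foliated_space n X F"
    and regular: "regular_foliated_atlas n X F U"
begin

definition E :: "('a \<times> 'a) set" where
  "E = {(x, y). \<exists>c\<in>U. x \<in> chart_dom c \<and> y \<in> chart_dom c \<and> chart_proj c x = chart_proj c y}"

abbreviation leaf :: "'a \<Rightarrow> 'a set" where
  "leaf x \<equiv> E\<^sup>* `` {x}"

lemma compact_X: "compact_space X" and Hausdorff_X: "Hausdorff_space X"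
  and second_countable_X: "second_countable X" and structure_F: "foliated_structure n X F"
  using foliated by (auto simp: compact_Polish_foliated_space_def)

lemma U_subset_F: "c \<in> U \<Longrightarrow> c \<in> F"
  using regular by (auto simp: regular_foliated_atlas_def)

lemma atlas_F: "foliated_atlas n X F"
  using structure_F unfolding foliated_structure_def by (rule conjunct1)

lemma chart_F: "c \<in> F \<Longrightarrow> foliated_chart n X c"
  using atlas_F by (simp add: foliated_atlas_def)

lemma chart_U: "c \<in> U \<Longrightarrow> foliated_chart n X c"
  by (intro chart_F U_subset_F)

lemma dom_subset: "c \<in> F \<Longrightarrow> chart_dom c \<subseteq> topspace X"
  by (rule openin_subset[OF foliated_chart_openin[OF chart_F]])

lemma cover_U: "x \<in> topspace X \<Longrightarrow> \<exists>c\<in>U. x \<in> chart_dom c"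
  using regular by (auto simp: regular_foliated_atlas_def foliated_atlas_def)

lemma change_proj:
  assumes "c \<in> F" "d \<in> F" "x \<in> chart_dom c" "x \<in> chart_dom d"
  obtains W h where "openin X W" "x \<in> W" "W \<subseteq> chart_dom c \<inter> chart_dom d"
    "\<And>q. q \<in> W \<Longrightarrow> chart_proj d q = h (chart_proj c q)"
proof -
  have "foliated_change X c d"
    using atlas_F assms by (simp add: foliated_atlas_def)
  from this[unfolded foliated_change_def, rule_format, OF IntI[OF assms(3,4)]]
  obtain W f h where "openin X W" "x \<in> W" "W \<subseteq> chart_dom c \<inter> chart_dom d"
    "\<forall>q\<in>W. chart_map d q = (f (chart_map c q), h (snd (chart_map c q)))"
    by (elim exE conjE)
  then show ?thesis using that[of W h] by (simp add: chart_proj_def)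
qed

lemma E_subset: "E \<subseteq> topspace X \<times> topspace X"
  using dom_subset U_subset_F by (fastforce simp: E_def)

lemma refl_E: "refl_on (topspace X) E"
  using cover_U by (auto simp: refl_on_def E_def)

lemma E_refl: "x \<in> topspace X \<Longrightarrow> (x, x) \<in> E"
  using refl_E by (simp add: refl_on_def)

lemma sym_E: "sym E"
  by (auto simp: sym_def E_def)

lemma relpow_E_sym: "(x, y) \<in> E ^^ k \<Longrightarrow> (y, x) \<in> E ^^ k"
  using relpow_sym_iff[OF sym_E] by blast

lemma rtrancl_E_sym: "(x, y) \<in> E\<^sup>* \<Longrightarrow> (y, x) \<in> E\<^sup>*"
  using sym_rtrancl[OF sym_E] by (auto simp: sym_def)

lemma relpow_E_in: "(x, y) \<in> E ^^ k \<Longrightarrow> x \<in> topspace X \<Longrightarrow> y \<in> topspace X"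
  using E_subset by (induction k arbitrary: y) auto

lemma rtrancl_E_in: "(x, y) \<in> E\<^sup>* \<Longrightarrow> x \<in> topspace X \<Longrightarrow> y \<in> topspace X"
  by (auto simp: rtrancl_power intro: relpow_E_in)

lemma relpow_E_mono: "(x, y) \<in> E ^^ m \<Longrightarrow> x \<in> topspace X \<Longrightarrow> m \<le> k \<Longrightarrow> (x, y) \<in> E ^^ k"
  by (rule relpow_mono_refl[OF refl_E E_subset]) (auto intro: relpow_E_in)

lemma relpow_E_trans: "(x, y) \<in> E ^^ m \<Longrightarrow> (y, z) \<in> E ^^ k \<Longrightarrow> (x, z) \<in> E ^^ (m + k)"
  by (auto simp: relpow_add_iff)

lemma plaques_U_rel: "P \<in> (\<Union>c\<in>U. plaques c) \<Longrightarrow> x \<in> P \<Longrightarrow> y \<in> P \<Longrightarrow> (x, y) \<in> E"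
  by (auto simp: plaques_def plaque_eq[OF chart_U] E_def)

lemma E_plaque:
  assumes "(x, y) \<in> E"
  obtains P where "P \<in> (\<Union>c\<in>U. plaques c)" "x \<in> P" "y \<in> P"
proof -
  obtain c where c: "c \<in> U" "x \<in> chart_dom c" "y \<in> chart_dom c" "chart_proj c x = chart_proj c y"
    using assms by (auto simp: E_def)
  have "plaque c (chart_proj c x) \<in> plaques c"
    using foliated_chart_proj_in[OF chart_U[OF c(1)] c(2)] by (simp add: plaques_def)
  then show ?thesis
    using that[of "plaque c (chart_proj c x)"] c plaque_eq[OF chart_U[OF c(1)]] by auto
qed

lemma plaques_U_F: "(\<Union>c\<in>U. plaques c) \<subseteq> (\<Union>c\<in>F. plaques c)"
  using U_subset_F by auto

lemma topspace_leaf_topology: "topspace (leaf_topology F) = topspace X"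
proof -
  have "\<Union>(\<Union>c\<in>F. plaques c) \<subseteq> topspace X"
    using dom_subset by (fastforce simp: plaques_def plaque_def)
  moreover have "x \<in> \<Union>(\<Union>c\<in>F. plaques c)" if "x \<in> topspace X" for x
    using E_plaque[OF E_refl[OF that]] plaques_U_F by blast
  ultimately show ?thesis by (auto simp: leaf_topology_def topology_generated_by_topspace)
qed

lemma openin_plaque: "P \<in> (\<Union>c\<in>F. plaques c) \<Longrightarrow> openin (leaf_topology F) P"
  unfolding leaf_topology_def by (rule topology_generated_by_Basis)

text \<open>The parametrisation \<open>g\<close> of the plaque by its ball is continuous even into
  the leaf topology: near any point the projection of another chart is a function of the projection
  of \<open>c\<close>, which is constant on the plaque, so preimages of plaques are open.\<close>

lemma connectedin_plaque:
  assumes P: "P \<in> (\<Union>c\<in>F. plaques c)"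
  shows "connectedin (leaf_topology F) P"
proof -
  obtain c z where c: "c \<in> F" and z: "z \<in> topspace (chart_trans c)" and P: "P = plaque c z"
    using P by (auto simp: plaques_def)
  let ?B = "subtopology (Euclidean_space n) (chart_ball c)"
  obtain \<psi> where \<psi>: "continuous_map (prod_topology ?B (chart_trans c)) (subtopology X (chart_dom c)) \<psi>"
      "\<And>x. x \<in> chart_dom c \<Longrightarrow> \<psi> (chart_map c x) = x"
      "\<And>b z. b \<in> chart_ball c \<Longrightarrow> z \<in> topspace (chart_trans c) \<Longrightarrow>
          \<psi> (b, z) \<in> chart_dom c \<and> chart_map c (\<psi> (b, z)) = (b, z)"
    by (rule foliated_chart_inverse[OF chart_F[OF c]]) blast
  define g where "g = (\<lambda>b. \<psi> (b, z))"
  have ball: "euclidean_open_ball n (chart_ball c)"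
    using chart_F[OF c] by (simp add: foliated_chart_def)
  then have tB: "topspace ?B = chart_ball c"
    by (intro topspace_subtopology_subset euclidean_open_ball_subset)
  have "continuous_map ?B (prod_topology ?B (chart_trans c)) (\<lambda>b. (b, z))"
    using z by (simp add: continuous_map_pairwise comp_def)
  from continuous_map_compose[OF this \<psi>(1)]
  have contX: "continuous_map ?B X g"
    by (simp add: g_def comp_def continuous_map_in_subtopology)
  have gz: "chart_proj c (g b) = z" "g b \<in> chart_dom c" if "b \<in> chart_ball c" for b
    using \<psi>(3)[OF that z] by (auto simp: g_def chart_proj_def)
  have im: "g ` chart_ball c = P"
  proof
    show "g ` chart_ball c \<subseteq> P" using gz plaque_eq[OF chart_F[OF c]] P by auto
    show "P \<subseteq> g ` chart_ball c"
    proof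
      fix x assume "x \<in> P"
      then have x: "x \<in> chart_dom c" "chart_proj c x = z" using plaque_eq[OF chart_F[OF c]] P by auto
      then have "x = g (fst (chart_map c x))"
        using \<psi>(2)[OF x(1)] unfolding g_def by (metis chart_proj_def prod.collapse)
      then show "x \<in> g ` chart_ball c" using foliated_chart_ball_in[OF chart_F[OF c] x(1)] by blast
    qed
  qed
  have "continuous_map ?B (leaf_topology F) g"
    unfolding leaf_topology_def continuous_on_generated_topo_iff
  proof (intro conjI allI impI)
    fix Q assume "Q \<in> (\<Union>d\<in>F. plaques d)"
    then obtain d w where d: "d \<in> F" and Q: "Q = plaque d w" by (auto simp: plaques_def)
    show "openin ?B (g -` Q \<inter> topspace ?B)"
    proof (subst openin_subopen, intro ballI)
      fix b assume "b \<in> g -` Q \<inter> topspace ?B"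
      then have b: "b \<in> chart_ball c" "g b \<in> chart_dom d" "chart_proj d (g b) = w"
        using tB Q plaque_eq[OF chart_F[OF d]] by auto
      obtain W h where W: "openin X W" "g b \<in> W" "W \<subseteq> chart_dom c \<inter> chart_dom d"
        "\<And>q. q \<in> W \<Longrightarrow> chart_proj d q = h (chart_proj c q)"
        using change_proj[OF c d gz(2)[OF b(1)] b(2)] by metis
      have "openin ?B {b' \<in> topspace ?B. g b' \<in> W}"
        by (rule openin_continuous_map_preimage[OF contX W(1)])
      moreover have "{b' \<in> topspace ?B. g b' \<in> W} \<subseteq> g -` Q \<inter> topspace ?B"
      proof
        fix b' assume b': "b' \<in> {b' \<in> topspace ?B. g b' \<in> W}"
        then have "chart_proj d (g b') = chart_proj d (g b)"
          using W(4)[of "g b'"] W(4)[OF W(2)] gz(1)[of b'] gz(1)[OF b(1)] tB by auto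
        then show "b' \<in> g -` Q \<inter> topspace ?B"
          using b' W(3) b(3) Q plaque_eq[OF chart_F[OF d]] by auto
      qed
      ultimately show "\<exists>T. openin ?B T \<and> b \<in> T \<and> T \<subseteq> g -` Q \<inter> topspace ?B"
        using b(1) W(2) tB by blast
    qed
  next
    have "P \<in> (\<Union>c\<in>F. plaques c)" using c z P by (auto simp: plaques_def)
    then have "P \<subseteq> \<Union>(\<Union>c\<in>F. plaques c)" by (rule Union_upper)
    then show "g ` topspace ?B \<subseteq> \<Union>(\<Union>c\<in>F. plaques c)" unfolding tB im .
  qed
  moreover have "connectedin ?B (chart_ball c)"
    using connected_euclidean_open_ball[OF ball] by (simp add: connectedin_subtopology)
  ultimately show ?thesis using connectedin_continuous_map_image im by blast
qed

text \<open>Connected plaques link adjacent points inside a component. Conversely, a class of the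
  generated equivalence relation and the union of all other classes are both unions of plaques,
  hence open in the leaf topology, and no connected set meets both.\<close>

lemma leaves_eq: "leaves F = leaf ` topspace X"
proof -
  have "connected_component_of (leaf_topology F) x y \<longleftrightarrow> (x, y) \<in> E\<^sup>*" if x: "x \<in> topspace X" for x y
  proof
    assume "(x, y) \<in> E\<^sup>*"
    then show "connected_component_of (leaf_topology F) x y"
    proof (induction rule: rtrancl_induct)
      case base
      then show ?case using x topspace_leaf_topology by (simp add: connected_component_of_refl)
    next
      case (step y z)
      obtain P where P: "P \<in> (\<Union>c\<in>U. plaques c)" "y \<in> P" "z \<in> P" by (rule E_plaque[OF step(2)])
      then have "connected_component_of (leaf_topology F) y z"
        using connectedin_plaque plaques_U_F unfolding connected_component_of_def by blast
      then show ?case using step.IH connected_component_of_trans by metis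
    qed
  next
    assume "connected_component_of (leaf_topology F) x y"
    then obtain S where S: "connectedin (leaf_topology F) S" "x \<in> S" "y \<in> S"
      unfolding connected_component_of_def by blast
    have op: "openin (leaf_topology F) (E\<^sup>* `` A)" if A: "A \<subseteq> topspace X" for A
    proof (subst openin_subopen, intro ballI)
      fix z assume "z \<in> E\<^sup>* `` A"
      then obtain a where a: "a \<in> A" "(a, z) \<in> E\<^sup>*" by blast
      then have "z \<in> topspace X" using A rtrancl_E_in by blast
      then obtain P where P: "P \<in> (\<Union>c\<in>U. plaques c)" "z \<in> P" using E_plaque E_refl by metis
      have "P \<subseteq> E\<^sup>* `` A"
        using plaques_U_rel[OF P] a by (blast intro: rtrancl.rtrancl_into_rtrancl)
      then show "\<exists>T. openin (leaf_topology F) T \<and> z \<in> T \<and> T \<subseteq> E\<^sup>* `` A"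
        using openin_plaque[OF subsetD[OF plaques_U_F P(1)]] P(2) by (intro exI[of _ P] conjI)
    qed
    let ?A = "leaf x" and ?B = "E\<^sup>* `` (topspace X - leaf x)"
    have "?A \<inter> ?B = {}"
      by (auto dest: rtrancl_E_sym intro: rtrancl_trans)
    moreover have "S \<subseteq> ?A \<union> ?B"
      using connectedin_subset_topspace[OF S(1)] topspace_leaf_topology by auto
    moreover have "openin (leaf_topology F) ?A" "openin (leaf_topology F) ?B"
      using op[of "{x}"] op[of "topspace X - leaf x"] x by auto
    moreover have "?A \<inter> S \<noteq> {}" using S by auto
    ultimately have "?B \<inter> S = {}" using S(1) unfolding connectedin by blast
    then show "(x, y) \<in> E\<^sup>*" using S \<open>S \<subseteq> ?A \<union> ?B\<close> by blast
  qed
  then have "Collect (connected_component_of (leaf_topology F) x) = leaf x" if "x \<in> topspace X" for x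
    using that by auto
  then show ?thesis
    unfolding leaves_def connected_components_of_def topspace_leaf_topology by (rule image_cong[OF refl])
qed

section \<open>Plaque chains and the leaf metric\<close>

lemma plaque_chain_imp_relpow:
  assumes "\<P> \<subseteq> (\<Union>c\<in>U. plaques c)" "finite \<P>" "connectedin (leaf_topology F) (\<Union>\<P>)"
    "x \<in> \<Union>\<P>" "y \<in> \<Union>\<P>"
  shows "(x, y) \<in> E ^^ card \<P>"
proof -
  let ?C = "{(p, q). p \<in> \<Union>\<P> \<and> q \<in> \<Union>\<P> \<and> (\<exists>W\<in>\<P>. p \<in> W \<and> q \<in> W)}"
  have "(x, y) \<in> ?C ^^ card \<P>"
    by (rule connected_chain[OF assms(3,2)]) (use assms plaques_U_F openin_plaque in blast)+
  moreover have "?C ^^ card \<P> \<subseteq> E ^^ card \<P>"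
    by (rule relpow_subset_mono) (use assms(1) plaques_U_rel in blast)
  ultimately show ?thesis by (rule rev_subsetD)
qed

text \<open>Only \<open>card \<P> \<le> k\<close> can be claimed, as a chain may run through one
  plaque several times; \<open>k > 0\<close> excludes the empty family, which contains no
  point.\<close>

lemma relpow_imp_plaque_chain:
  assumes "(x, y) \<in> E ^^ k" "x \<in> topspace X" "k > 0"
  shows "\<exists>\<P>\<subseteq>(\<Union>c\<in>U. plaques c). finite \<P> \<and> card \<P> \<le> k \<and>
    connectedin (leaf_topology F) (\<Union>\<P>) \<and> x \<in> \<Union>\<P> \<and> y \<in> \<Union>\<P>"
  using assms(3,1)
proof (induction k arbitrary: y rule: nat_induct_non_zero)
  case 1
  then obtain P where P: "P \<in> (\<Union>c\<in>U. plaques c)" "x \<in> P" "y \<in> P" using E_plaque[of x y] by (simp only: relpow_1) blast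
  then show ?case
    using connectedin_plaque[OF subsetD[OF plaques_U_F P(1)]] by (intro exI[of _ "{P}"]) auto
next
  case (Suc k)
  from Suc.prems obtain z where z: "(x, z) \<in> E ^^ k" "(z, y) \<in> E" by auto
  obtain \<P> where \<P>: "\<P>\<subseteq>(\<Union>c\<in>U. plaques c)" "finite \<P>" "card \<P> \<le> k"
    "connectedin (leaf_topology F) (\<Union>\<P>)" "x \<in> \<Union>\<P>" "z \<in> \<Union>\<P>"
    using Suc.IH[OF z(1)] by blast
  obtain P where P: "P \<in> (\<Union>c\<in>U. plaques c)" "z \<in> P" "y \<in> P" by (rule E_plaque[OF z(2)])
  have "connectedin (leaf_topology F) P"
    using P connectedin_plaque plaques_U_F by blast
  then have "connectedin (leaf_topology F) (\<Union>\<P> \<union> P)"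
    by (intro connectedin_Un[OF \<P>(4)]) (use P(2) \<P>(6) in auto)
  then show ?case
    using \<P> P by (intro exI[of _ "insert P \<P>"]) (auto simp: Un_commute card_insert_if)
qed

text \<open>Chain lengths and plaque counts agree only in their minima. The case
  \<open>x = y\<close> is separate: the metric is 0 by definition, as is the shortest chain, while a
  family of plaques containing \<open>x\<close> has at least one member.\<close>

lemma plaque_dist_eq:
  assumes "(x, y) \<in> E\<^sup>*" "x \<in> topspace X"
  shows "plaque_dist F U x y = real (LEAST k. (x, y) \<in> E ^^ k)"
proof (cases "x = y")
  case True
  then have "(LEAST k. (x, y) \<in> E ^^ k) = 0" by (intro Least_equality) auto
  then show ?thesis using True by (simp add: plaque_dist_def)
next
  case False
  define Q where "Q = (\<lambda>k. \<exists>\<P>. \<P> \<subseteq> (\<Union>c\<in>U. plaques c) \<and> finite \<P> \<and> card \<P> = k \<and>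
                    connectedin (leaf_topology F) (\<Union>\<P>) \<and> x \<in> \<Union>\<P> \<and> y \<in> \<Union>\<P>)"
  have QE: "(x, y) \<in> E ^^ k" if "Q k" for k
    using that plaque_chain_imp_relpow unfolding Q_def by blast
  have EQ: "\<exists>j\<le>k. Q j" if "(x, y) \<in> E ^^ k" for k
  proof -
    have "k > 0" using that False by (cases k) auto
    from relpow_imp_plaque_chain[OF that assms(2) this] show ?thesis unfolding Q_def by blast
  qed
  obtain k0 where k0: "(x, y) \<in> E ^^ k0" using assms(1) by (auto simp: rtrancl_power)
  have "Least Q = (LEAST k. (x, y) \<in> E ^^ k)"
  proof (rule antisym)
    have "(x, y) \<in> E ^^ (LEAST k. (x, y) \<in> E ^^ k)" using k0 by (rule LeastI)
    then obtain j where "j \<le> (LEAST k. (x, y) \<in> E ^^ k)" "Q j" using EQ by blast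
    then show "Least Q \<le> (LEAST k. (x, y) \<in> E ^^ k)" using Least_le[of Q j] by linarith
    obtain j0 where "Q j0" using EQ[OF k0] by blast
    then have "Q (Least Q)" by (rule LeastI)
    then show "(LEAST k. (x, y) \<in> E ^^ k) \<le> Least Q" by (intro Least_le QE)
  qed
  then show ?thesis using False unfolding Q_def by (simp add: plaque_dist_def)
qed

lemma plaque_dist_le_iff:
  assumes "(x, y) \<in> E\<^sup>*" "x \<in> topspace X"
  shows "plaque_dist F U x y \<le> real k \<longleftrightarrow> (x, y) \<in> E ^^ k"
proof -
  let ?m = "LEAST k. (x, y) \<in> E ^^ k"
  obtain k0 where k0: "(x, y) \<in> E ^^ k0" using assms(1) by (auto simp: rtrancl_power)
  have "(x, y) \<in> E ^^ ?m" using k0 by (rule LeastI)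
  then have "?m \<le> k \<longleftrightarrow> (x, y) \<in> E ^^ k"
    using relpow_E_mono[OF _ assms(2), of y ?m k] Least_le[of "\<lambda>k. (x, y) \<in> E ^^ k" k] by fast
  then show ?thesis using plaque_dist_eq[OF assms] by simp
qed

section \<open>Regularity\<close>

lemma chart_extension:
  assumes "c \<in> U"
  obtains c' where "c' \<in> F" "chart_dom c \<subseteq> chart_dom c'" "X closure_of chart_dom c \<subseteq> chart_dom c'"
    "\<And>x. x \<in> chart_dom c \<Longrightarrow> chart_map c x = chart_map c' x"
    "\<And>x. x \<in> chart_dom c \<Longrightarrow> chart_proj c x = chart_proj c' x"
proof -
  have "\<exists>c'\<in>F. chart_restriction c c' \<and> X closure_of chart_dom c \<subseteq> chart_dom c'"
    using regular assms by (simp add: regular_foliated_atlas_def)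
  then obtain c' where c': "c' \<in> F" "chart_restriction c c'" "X closure_of chart_dom c \<subseteq> chart_dom c'"
    by (elim bexE conjE)
  then show ?thesis
    using that[OF c'(1) _ c'(3)] by (simp add: chart_restriction_def chart_proj_def)
qed

text \<open>The transversal is Hausdorff, so a plaque is closed relative to the chart
  domain.\<close>

lemma plaque_closure_proj:
  assumes c: "c \<in> F" "x \<in> chart_dom c" and A: "x \<in> X closure_of A" "\<And>a. a \<in> A \<Longrightarrow> a \<in> chart_dom c \<and> chart_proj c a = z"
  shows "chart_proj c x = z"
proof (rule ccontr)
  assume ne: "chart_proj c x \<noteq> z"
  have c': "foliated_chart n X c" by (rule chart_F[OF c(1)])
  have "A \<noteq> {}" using A(1) by auto
  then have "z \<in> topspace (chart_trans c)"
    using A(2) foliated_chart_proj_in[OF c'] by blast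
  then obtain V W where V: "openin (chart_trans c) V" "openin (chart_trans c) W"
      "chart_proj c x \<in> V" "z \<in> W" "disjnt V W"
    using ne foliated_chart_Hausdorff[OF c'] foliated_chart_proj_in[OF c' c(2)]
    unfolding Hausdorff_space_def by metis
  have "openin X {x \<in> chart_dom c. chart_proj c x \<in> V}"
    by (rule foliated_chart_openin_vimage[OF c' V(1)])
  moreover have "x \<in> {x \<in> chart_dom c. chart_proj c x \<in> V}" using c V by simp
  moreover have "\<forall>T. x \<in> T \<and> openin X T \<longrightarrow> (\<exists>y. y \<in> A \<and> y \<in> T)"
    using A(1) by (simp add: in_closure_of)
  ultimately have "\<exists>y. y \<in> A \<and> y \<in> {x \<in> chart_dom c. chart_proj c x \<in> V}"
    by (elim allE[of _ "{x \<in> chart_dom c. chart_proj c x \<in> V}"]) simp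
  then obtain a where "a \<in> A" "chart_proj c a \<in> V" by auto
  then show False using A(2)[of a] V by (auto simp: disjnt_def)
qed

text \<open>Regularity forces equal closures on the plaques of \<open>d\<close> through
  \<open>x\<close> and \<open>y\<close>, since both closures meet that of the common plaque of
  \<open>c\<close>. So \<open>x\<close> is in the closure of the second plaque, and hence has its
  projection. This makes the transition maps single-valued on all of the overlap, not just
  locally.\<close>

lemma proj_eq_transfer:
  assumes c: "c \<in> U" and d: "d \<in> U" and x: "x \<in> chart_dom c" "x \<in> chart_dom d"
    and y: "y \<in> chart_dom c" "y \<in> chart_dom d" and eq: "chart_proj c x = chart_proj c y"
  shows "chart_proj d x = chart_proj d y"
proof -
  let ?P = "plaque c (chart_proj c x)"
  let ?Q = "plaque d (chart_proj d x)" and ?Q' = "plaque d (chart_proj d y)"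
  note pc = plaque_eq[OF chart_U[OF c]] and pd = plaque_eq[OF chart_U[OF d]]
  have sub: "A \<subseteq> X closure_of A" if "A \<subseteq> chart_dom d \<or> A \<subseteq> chart_dom c" for A
    using that dom_subset[OF U_subset_F[OF c]] dom_subset[OF U_subset_F[OF d]]
    by (intro closure_of_subset) blast
  have cl: "?P \<subseteq> X closure_of ?P" "?Q \<subseteq> X closure_of ?Q" "?Q' \<subseteq> X closure_of ?Q'"
    by (rule sub; auto simp: pc pd)+
  have mem: "?P \<in> plaques c" "?Q \<in> plaques d" "?Q' \<in> plaques d"
    using foliated_chart_proj_in[OF chart_U[OF c]] foliated_chart_proj_in[OF chart_U[OF d]] x y
    by (auto simp: plaques_def)
  have "x \<in> X closure_of ?P \<inter> X closure_of ?Q" "y \<in> X closure_of ?P \<inter> X closure_of ?Q'"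
    using cl x y eq by (auto simp: pc pd)
  then have ne: "X closure_of ?P \<inter> X closure_of ?Q \<noteq> {} \<and> X closure_of ?P \<inter> X closure_of ?Q' \<noteq> {}"
    by blast
  have "\<forall>c\<in>U. \<forall>d\<in>U. \<forall>P \<in> plaques c. \<forall>Q \<in> plaques d. \<forall>Q' \<in> plaques d.
        X closure_of P \<inter> X closure_of Q \<noteq> {} \<and> X closure_of P \<inter> X closure_of Q' \<noteq> {} \<longrightarrow>
        X closure_of Q = X closure_of Q'"
    using regular unfolding regular_foliated_atlas_def by (elim conjE)
  from this[rule_format, OF c d mem ne] have "X closure_of ?Q = X closure_of ?Q'" .
  then have xQ': "x \<in> X closure_of ?Q'" using cl x by (auto simp: pd)
  obtain d' where d': "d' \<in> F" "chart_dom d \<subseteq> chart_dom d'"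
    "\<And>x. x \<in> chart_dom d \<Longrightarrow> chart_proj d x = chart_proj d' x"
    using chart_extension[OF d] by metis
  have "chart_proj d' x = chart_proj d y"
    by (rule plaque_closure_proj[OF d'(1) _ xQ']) (use d' x in \<open>auto simp: pd\<close>)
  then show ?thesis using d'(3)[OF x(2)] by simp
qed

text \<open>Local finiteness does not restrict charts with empty domain, so \<open>U\<close> itself
  may be infinite. Compactness makes this subset finite, which bounds the constants and leaves
  countably many words in chart changes.\<close>

definition nonempty_charts :: "('a, 'z) chart set" where
  "nonempty_charts = {c \<in> U. chart_dom c \<noteq> {}}"

lemma finite_nonempty_charts: "finite nonempty_charts"
proof -
  have "\<forall>x \<in> topspace X. \<exists>V. openin X V \<and> x \<in> V \<and> finite {c \<in> U. chart_dom c \<inter> V \<noteq> {}}"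
    using regular unfolding regular_foliated_atlas_def by (elim conjE)
  from bchoice[OF this] obtain V
    where V: "\<forall>x\<in>topspace X. openin X (V x) \<and> x \<in> V x \<and> finite {c \<in> U. chart_dom c \<inter> V x \<noteq> {}}" ..
  have "topspace X \<subseteq> \<Union>(V ` topspace X)" using V by blast
  moreover have "\<And>W. W \<in> V ` topspace X \<Longrightarrow> openin X W" using V by auto
  ultimately obtain \<F> where "finite \<F>" "\<F> \<subseteq> V ` topspace X" "topspace X \<subseteq> \<Union>\<F>"
    using compact_X unfolding compact_space_alt by meson
  then obtain S where S: "finite S" "S \<subseteq> topspace X" "topspace X \<subseteq> \<Union>(V ` S)"
    by (metis finite_subset_image)
  have "nonempty_charts \<subseteq> (\<Union>x\<in>S. {c \<in> U. chart_dom c \<inter> V x \<noteq> {}})"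
  proof
    fix c assume "c \<in> nonempty_charts"
    then obtain y where y: "c \<in> U" "y \<in> chart_dom c" by (auto simp: nonempty_charts_def)
    then have "y \<in> \<Union>(V ` S)" using dom_subset[OF U_subset_F[OF y(1)]] S(3) by blast
    then show "c \<in> (\<Union>x\<in>S. {c \<in> U. chart_dom c \<inter> V x \<noteq> {}})" using y by blast
  qed
  moreover have "finite (\<Union>x\<in>S. {c \<in> U. chart_dom c \<inter> V x \<noteq> {}})"
    using S V by (intro finite_UN_I) auto
  ultimately show ?thesis by (rule finite_subset)
qed

lemma E_iff: "(x, y) \<in> E \<longleftrightarrow>
    (\<exists>c\<in>nonempty_charts. x \<in> chart_dom c \<and> y \<in> chart_dom c \<and> chart_proj c x = chart_proj c y)"
  by (auto simp: E_def nonempty_charts_def)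

text \<open>Bounded geometry of the leaves: a set inside one plaque meets at most one plaque of each
  chart, so each step multiplies the number of sets by at most the number of nonempty charts. In the
  limit argument this confines the partners of a point to finitely many plaques.\<close>

lemma finite_plaques_ball:
  assumes x: "x \<in> topspace X"
  shows "\<exists>\<Q>. finite \<Q> \<and> (E ^^ k) `` {x} \<subseteq> \<Union>\<Q> \<and> (\<forall>Q\<in>\<Q>. \<forall>a\<in>Q. \<forall>b\<in>Q. (a, b) \<in> E)"
proof -
  define flat where "flat = (\<lambda>Q. \<exists>c\<in>U. Q \<subseteq> chart_dom c \<and> (\<forall>a\<in>Q. \<forall>b\<in>Q. chart_proj c a = chart_proj c b))"
  have "\<exists>\<Q>. finite \<Q> \<and> (E ^^ k) `` {x} \<subseteq> \<Union>\<Q> \<and> (\<forall>Q\<in>\<Q>. flat Q)"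
  proof (induction k)
    case 0
    obtain c where "c \<in> U" "x \<in> chart_dom c" using cover_U[OF x] by blast
    then show ?case by (intro exI[of _ "{{x}}"]) (auto simp: flat_def)
  next
    case (Suc k)
    then obtain \<Q> where \<Q>: "finite \<Q>" "(E ^^ k) `` {x} \<subseteq> \<Union>\<Q>" "\<forall>Q\<in>\<Q>. flat Q"
      by (elim exE conjE)
    \<comment> \<open>By \<open>proj_eq_transfer\<close>, a flat \<open>Q\<close> meets at most one
      plaque of \<open>i\<close>; this is that plaque, or empty if \<open>Q\<close> misses the
      domain of \<open>i\<close>.\<close>
    define next_plaque where "next_plaque = (\<lambda>(Q :: 'a set, i :: ('a, 'z) chart). {y \<in> chart_dom i. \<exists>a\<in>Q \<inter> chart_dom i. chart_proj i a = chart_proj i y})"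
    have flat_next: "flat (next_plaque (Q, i))" if Q: "Q \<in> \<Q>" and i: "i \<in> nonempty_charts" for Q i
    proof -
      have iU: "i \<in> U" using i by (simp add: nonempty_charts_def)
      obtain c where c: "c \<in> U" "Q \<subseteq> chart_dom c" "\<forall>a\<in>Q. \<forall>b\<in>Q. chart_proj c a = chart_proj c b"
        using \<Q>(3) Q unfolding flat_def by blast
      have "chart_proj i y = chart_proj i y'" if yy: "y \<in> next_plaque (Q, i)" "y' \<in> next_plaque (Q, i)" for y y'
      proof -
        obtain a a' where a: "a \<in> Q" "a \<in> chart_dom i" "chart_proj i a = chart_proj i y"
          and a': "a' \<in> Q" "a' \<in> chart_dom i" "chart_proj i a' = chart_proj i y'"
          using yy unfolding next_plaque_def by auto
        have "chart_proj i a = chart_proj i a'"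
          by (rule proj_eq_transfer[OF c(1) iU]) (use a(1,2) a'(1,2) c(2,3) in blast)+
        then show ?thesis using a a' by simp
      qed
      then show ?thesis using iU unfolding flat_def by (intro bexI[of _ i]) (auto simp: next_plaque_def)
    qed
    have "(E ^^ Suc k) `` {x} \<subseteq> \<Union>(next_plaque ` (\<Q> \<times> nonempty_charts))"
    proof
      fix y assume "y \<in> (E ^^ Suc k) `` {x}"
      then obtain z where z: "(x, z) \<in> E ^^ k" "(z, y) \<in> E" by auto
      then obtain Q where Q: "Q \<in> \<Q>" "z \<in> Q" using \<Q>(2) by blast
      obtain i where i: "i \<in> nonempty_charts" "z \<in> chart_dom i" "y \<in> chart_dom i" "chart_proj i z = chart_proj i y"
        using z(2) unfolding E_iff by blast
      have "y \<in> next_plaque (Q, i)" using Q i by (auto simp: next_plaque_def)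
      then show "y \<in> \<Union>(next_plaque ` (\<Q> \<times> nonempty_charts))" using Q i by blast
    qed
    moreover have "finite (next_plaque ` (\<Q> \<times> nonempty_charts))" using \<Q>(1) finite_nonempty_charts by simp
    moreover have "\<forall>Q\<in>next_plaque ` (\<Q> \<times> nonempty_charts). flat Q" using flat_next by auto
    ultimately show ?case by (intro exI[of _ "next_plaque ` (\<Q> \<times> nonempty_charts)"] conjI)
  qed
  then obtain \<Q> where \<Q>: "finite \<Q>" "(E ^^ k) `` {x} \<subseteq> \<Union>\<Q>" "\<forall>Q\<in>\<Q>. flat Q"
    by (elim exE conjE)
  moreover have "(a, b) \<in> E" if Q: "Q \<in> \<Q>" "a \<in> Q" "b \<in> Q" for Q a b
  proof -
    obtain c where "c \<in> U" "Q \<subseteq> chart_dom c" "\<forall>a\<in>Q. \<forall>b\<in>Q. chart_proj c a = chart_proj c b"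
      using \<Q>(3) Q(1) unfolding flat_def by meson
    then show ?thesis using Q(2,3) unfolding E_def by blast
  qed
  ultimately show ?thesis by (intro exI[of _ \<Q>] conjI ballI)
qed

section \<open>Dense leaves\<close>

text \<open>The plaques of \<open>c\<close> that meet \<open>V\<close> form the preimage of the
  projection of \<open>V\<close>, and chart projections are open and continuous.\<close>

lemma openin_E_Image: 
  assumes V: "openin X V"
  shows "openin X (E `` V)"
proof -
  have "E `` V = (\<Union>c\<in>U. {y \<in> chart_dom c. chart_proj c y \<in> chart_proj c ` (V \<inter> chart_dom c)})"
    (is "_ = ?R")
  proof (intro equalityI subsetI)
    fix y assume "y \<in> E `` V"
    then obtain x c where "x \<in> V" "c \<in> U" "x \<in> chart_dom c" "y \<in> chart_dom c" "chart_proj c y = chart_proj c x"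
      unfolding E_def by auto
    then show "y \<in> ?R" by blast
  next
    fix y assume "y \<in> ?R"
    then obtain x c where "x \<in> V" "c \<in> U" "x \<in> chart_dom c" "y \<in> chart_dom c" "chart_proj c x = chart_proj c y"
      by auto
    then have "(x, y) \<in> E" unfolding E_def by blast
    then show "y \<in> E `` V" using \<open>x \<in> V\<close> by blast
  qed
  moreover have "openin X {y \<in> chart_dom c. chart_proj c y \<in> chart_proj c ` (V \<inter> chart_dom c)}" if "c \<in> U" for c
    by (rule foliated_chart_openin_vimage[OF chart_U foliated_chart_open_proj[OF chart_U V]]) fact+
  ultimately show ?thesis by (simp only:) (intro openin_Union, auto)
qed

lemma openin_saturation:
  assumes "openin X V"
  shows "openin X (E\<^sup>* `` V)"
proof -
  have "openin X ((E ^^ k) `` V)" for k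
  proof (induction k)
    case (Suc k)
    have "(E ^^ Suc k) `` V = E `` ((E ^^ k) `` V)" by auto
    then show ?case using openin_E_Image[OF Suc] by simp
  qed (use assms in simp)
  moreover have "E\<^sup>* `` V = (\<Union>k. (E ^^ k) `` V)" unfolding rtrancl_is_UN_relpow by blast
  ultimately show ?thesis by (auto intro!: openin_Union)
qed

lemma leaf_sym: "y \<in> leaf x \<Longrightarrow> leaf y = leaf x"
  by (auto intro: rtrancl_trans dest: rtrancl_E_sym)

lemma dense_in_iff:
  "S \<subseteq> topspace X \<Longrightarrow> dense_in X S \<longleftrightarrow> (\<forall>V. openin X V \<and> V \<noteq> {} \<longrightarrow> S \<inter> V \<noteq> {})"
  unfolding dense_in_def dense_intersects_open by simp

lemma leaf_subset: "x \<in> topspace X \<Longrightarrow> leaf x \<subseteq> topspace X"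
  using rtrancl_E_in by blast

text \<open>For a nonempty basic set \<open>V\<close>, the saturation is open, and dense because it
  contains the leaf of \<open>x0\<close>, which meets \<open>V\<close>. A leaf that is not dense
  misses some such \<open>V\<close>.\<close>

lemma meager_nondense:
  assumes "transitive_foliated_space X F"
  shows "meager_in X {x \<in> topspace X. \<not> dense_in X (leaf x)}"
proof -
  obtain x0 where x0: "x0 \<in> topspace X" "dense_in X (leaf x0)"
    using assms by (auto simp: transitive_foliated_space_def leaves_eq)
  obtain \<B> where \<B>: "countable \<B>" "\<forall>V\<in>\<B>. openin X V"
    "\<And>V x. openin X V \<and> x \<in> V \<Longrightarrow> \<exists>W\<in>\<B>. x \<in> W \<and> W \<subseteq> V"
    using second_countable_X unfolding second_countable_def by metis
  have nd: "nowhere_dense_in X (topspace X - E\<^sup>* `` V)" if V: "V \<in> \<B> - {{}}" for V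
  proof (rule nowhere_dense_inI)
    have Vo: "openin X V" "V \<noteq> {}" using V \<B> by auto
    fix W assume W: "openin X W" "W \<noteq> {}"
    obtain v where v: "v \<in> leaf x0" "v \<in> V"
      using x0 Vo dense_in_iff[OF leaf_subset] by blast
    obtain w where w: "w \<in> leaf x0" "w \<in> W"
      using x0 W dense_in_iff[OF leaf_subset] by blast
    have "w \<in> leaf v" using v w leaf_sym by blast
    then have "w \<in> W \<inter> E\<^sup>* `` V" using v w by blast
    moreover have "openin X (W \<inter> E\<^sup>* `` V)" using W openin_saturation[OF Vo(1)] by blast
    ultimately show "\<exists>V'. openin X V' \<and> V' \<noteq> {} \<and> V' \<subseteq> W \<and> V' \<inter> (topspace X - E\<^sup>* `` V) = {}"
      by (intro exI[of _ "W \<inter> E\<^sup>* `` V"]) auto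
  qed auto
  have "{x \<in> topspace X. \<not> dense_in X (leaf x)} \<subseteq> (\<Union>V\<in>\<B> - {{}}. topspace X - E\<^sup>* `` V)"
  proof
    fix x assume "x \<in> {x \<in> topspace X. \<not> dense_in X (leaf x)}"
    then have x: "x \<in> topspace X" "\<not> dense_in X (leaf x)" by auto
    then obtain V where V: "openin X V" "V \<noteq> {}" "leaf x \<inter> V = {}"
      using dense_in_iff[OF leaf_subset] by blast
    then obtain v where "v \<in> V" by blast
    then obtain W where W: "W \<in> \<B>" "v \<in> W" "W \<subseteq> V" using \<B>(3) V(1) by blast
    have "x \<notin> E\<^sup>* `` W" using W V rtrancl_E_sym by blast
    then show "x \<in> (\<Union>V\<in>\<B> - {{}}. topspace X - E\<^sup>* `` V)" using x W by blast
  qed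
  moreover have "meager_in X (\<Union>V\<in>\<B> - {{}}. topspace X - E\<^sup>* `` V)"
    by (intro meager_in_UN nowhere_dense_imp_meager nd) (use \<B> in auto)
  ultimately show ?thesis using meager_in_subset by blast
qed

section \<open>Holonomy\<close>

abbreviation T :: "(('a, 'z) chart \<times> 'z) topology" where
  "T \<equiv> transversal U"

abbreviation pt :: "('a, 'z) chart \<Rightarrow> 'a \<Rightarrow> ('a, 'z) chart \<times> 'z" where
  "pt i x \<equiv> (i, chart_proj i x)"

section \<open>Words in the chart changes\<close>

definition gen :: "('a, 'z) chart \<Rightarrow> ('a, 'z) chart \<Rightarrow> ((('a, 'z) chart \<times> 'z) \<times> (('a, 'z) chart \<times> 'z)) set" where
  "gen i j = {(pt i x, pt j x) | x. x \<in> chart_dom i \<inter> chart_dom j}"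

text \<open>Letters act from left to right. Consecutive letters need not be composable: points of
  \<open>T\<close> carry their chart, so a mismatch gives the empty relation.\<close>

primrec hol :: "(('a, 'z) chart \<times> ('a, 'z) chart) list \<Rightarrow> ((('a, 'z) chart \<times> 'z) \<times> (('a, 'z) chart \<times> 'z)) set" where
  "hol [] = Id_on (topspace T)"
| "hol (e # ws) = gen (fst e) (snd e) O hol ws"

lemma pt_in_T: "i \<in> U \<Longrightarrow> x \<in> chart_dom i \<Longrightarrow> pt i x \<in> topspace T"
  using foliated_chart_proj_in[OF chart_U] by (simp add: transversal_def)

lemma Hausdorff_T:
  assumes "p \<in> topspace T" "q \<in> topspace T" "p \<noteq> q"
  obtains V W where "openin T V" "openin T W" "p \<in> V" "q \<in> W" "V \<inter> W = {}"
proof -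
  obtain i z j w where pq: "p = (i, z)" "q = (j, w)" by fastforce
  then have iz: "i \<in> U" "z \<in> topspace (chart_trans i)" "j \<in> U" "w \<in> topspace (chart_trans j)"
    using assms by (auto simp: transversal_def)
  have op: "openin T ({i} \<times> V)" if "i \<in> U" "openin (chart_trans i) V" for i V
  proof -
    have "{x. (k, x) \<in> {i} \<times> V} = (if k = i then V else {})" for k by auto
    then show ?thesis
      using that openin_subset[OF that(2)] by (auto simp: transversal_def openin_sum_topology)
  qed
  show ?thesis
  proof (cases "i = j")
    case True
    then have "z \<noteq> w" using assms pq by auto
    then obtain V W where "openin (chart_trans i) V" "openin (chart_trans i) W" "z \<in> V" "w \<in> W" "disjnt V W"
      using foliated_chart_Hausdorff[OF chart_U[OF iz(1)]] iz True unfolding Hausdorff_space_def by metis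
    then show ?thesis
      using that[of "{i} \<times> V" "{i} \<times> W"] op iz pq True by (auto simp: disjnt_def)
  next
    case False
    then show ?thesis
      using that[of "{i} \<times> topspace (chart_trans i)" "{j} \<times> topspace (chart_trans j)"] op iz pq by auto
  qed
qed

lemma openin_T_image:
  assumes i: "i \<in> U" and V: "openin X V"
  shows "openin T (pt i ` (V \<inter> chart_dom i))"
proof -
  have "{z. (k, z) \<in> pt i ` (V \<inter> chart_dom i)} = (if k = i then chart_proj i ` (V \<inter> chart_dom i) else {})" for k
    by auto
  then show ?thesis
    using foliated_chart_open_proj[OF chart_U[OF i] V] foliated_chart_proj_in[OF chart_U[OF i]] i
    by (auto simp: transversal_def openin_sum_topology)
qed

lemma openin_T_vimage:
  assumes i: "i \<in> U" and W: "openin T W"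
  shows "openin X {x \<in> chart_dom i. pt i x \<in> W}"
proof -
  have "openin (chart_trans i) {z. (i, z) \<in> W}"
    using W i by (auto simp: transversal_def openin_sum_topology)
  from foliated_chart_openin_vimage[OF chart_U[OF i] this] show ?thesis by simp
qed

lemma gen_subset: "i \<in> U \<Longrightarrow> j \<in> U \<Longrightarrow> gen i j \<subseteq> topspace T \<times> topspace T"
  using pt_in_T by (auto simp: gen_def)

lemma gen_converse: "(gen i j)\<inverse> = gen j i"
  by (auto simp: gen_def)

lemma gen_single_valued: "i \<in> U \<Longrightarrow> j \<in> U \<Longrightarrow> single_valued (gen i j)"
  unfolding single_valued_def gen_def by (auto intro: proj_eq_transfer)

lemma gen_open_image:
  assumes "i \<in> U" "j \<in> U" "openin T A"
  shows "openin T (gen i j `` A)"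
proof -
  have "gen i j `` A = pt j ` ({x \<in> chart_dom i. pt i x \<in> A} \<inter> chart_dom j)"
    by (auto simp: gen_def)
  then show ?thesis using openin_T_image[OF assms(2) openin_T_vimage[OF assms(1,3)]] by simp
qed

lemma hol_subset: "ws \<in> lists (U \<times> U) \<Longrightarrow> hol ws \<subseteq> topspace T \<times> topspace T"
proof (induction ws)
  case (Cons e ws)
  then have "gen (fst e) (snd e) \<subseteq> topspace T \<times> topspace T" "hol ws \<subseteq> topspace T \<times> topspace T"
    using gen_subset[of "fst e" "snd e"] by auto
  then show ?case by auto
qed auto

lemma hol_append: "vs \<in> lists (U \<times> U) \<Longrightarrow> hol (ws @ vs) = hol ws O hol vs"
proof (induction ws)
  case Nil
  then show ?case using hol_subset[of vs] by auto
qed (auto simp: O_assoc)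

lemma hol_single: "i \<in> U \<Longrightarrow> j \<in> U \<Longrightarrow> hol [(i, j)] = gen i j"
  using gen_subset[of i j] by auto

lemma hol_rev: "ws \<in> lists (U \<times> U) \<Longrightarrow> hol (rev (map prod.swap ws)) = (hol ws)\<inverse>"
proof (induction ws)
  case (Cons e ws)
  obtain i j where e: "e = (i, j)" "i \<in> U" "j \<in> U" using Cons.prems by auto
  then have "hol (rev (map prod.swap (e # ws))) = hol (rev (map prod.swap ws)) O hol [(j, i)]"
    by (simp add: hol_append del: hol.simps)
  also have "\<dots> = (hol ws)\<inverse> O (gen i j)\<inverse>"
    using Cons e hol_single[of j i] gen_converse[of i j] by auto
  finally show ?case by (simp add: e converse_relcomp)
qed auto

lemma rev_swap_in_lists: "ws \<in> lists (A \<times> A) \<Longrightarrow> rev (map prod.swap ws) \<in> lists (A \<times> A)"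
  by (induction ws) auto

lemma hol_open_image: "ws \<in> lists (U \<times> U) \<Longrightarrow> openin T A \<Longrightarrow> openin T (hol ws `` A)"
proof (induction ws arbitrary: A)
  case Nil
  have "hol [] `` A = A" using openin_subset[OF Nil(2)] by auto
  then show ?case using Nil by simp
next
  case (Cons e ws)
  have "hol (e # ws) `` A = hol ws `` (gen (fst e) (snd e) `` A)" by auto
  then show ?case using Cons gen_open_image[of "fst e" "snd e" A] by (auto simp del: hol.simps)
qed

lemma hol_open_vimage: "ws \<in> lists (U \<times> U) \<Longrightarrow> openin T A \<Longrightarrow> openin T ((hol ws)\<inverse> `` A)"
  using hol_open_image[OF rev_swap_in_lists] hol_rev by metis

lemma hol_single_valued: "ws \<in> lists (U \<times> U) \<Longrightarrow> single_valued (hol ws)"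
proof (induction ws)
  case (Cons e ws)
  then have "single_valued (gen (fst e) (snd e))" "single_valued (hol ws)"
    using gen_single_valued[of "fst e" "snd e"] by auto
  then show ?case by (simp add: single_valued_relcomp)
qed auto

lemma hol_converse_single_valued: "ws \<in> lists (U \<times> U) \<Longrightarrow> single_valued ((hol ws)\<inverse>)"
  using hol_single_valued[OF rev_swap_in_lists] hol_rev by metis

text \<open>The pseudogroup may be uncountable, being closed under gluing, but its germs come from
  words over a finite alphabet. Inclusion is enough: a single-valued \<open>g\<close> coincides with
  the word near \<open>p\<close>, where the word is defined.\<close>

definition locally_word :: "((('a, 'z) chart \<times> 'z) \<times> (('a, 'z) chart \<times> 'z)) set \<Rightarrow> bool" where
  "locally_word g \<longleftrightarrow> (\<forall>p q. (p, q) \<in> g \<longrightarrow> (\<exists>ws\<in>lists (nonempty_charts \<times> nonempty_charts). \<exists>W. openin T W \<and> p \<in> W \<and>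
      (p, q) \<in> hol ws \<and> hol ws \<inter> (W \<times> UNIV) \<subseteq> g))"

lemma lists_nonempty_charts: "ws \<in> lists (nonempty_charts \<times> nonempty_charts) \<Longrightarrow> ws \<in> lists (U \<times> U)"
  by (auto simp: nonempty_charts_def)

text \<open>Inverse, composition and restriction correspond to reversing a word, concatenating words
  and shrinking \<open>W\<close>; a glued map takes the word of one of its pieces. Single-valuedness
  is carried along so that a word contained in \<open>g\<close> determines it locally.\<close>

lemma pseudogroup_locally_word:
  assumes "g \<in> holonomy_pseudogroup U"
  shows "single_valued g \<and> single_valued (g\<inverse>) \<and> locally_word g"
  using assms
proof (induction rule: holonomy_pseudogroup.induct)
  case (generator i j)
  have "locally_word (gen i j)"
    unfolding locally_word_def
  proof (intro allI impI)
    fix p q assume pq: "(p, q) \<in> gen i j"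
    then have "i \<in> nonempty_charts" "j \<in> nonempty_charts" using generator by (auto simp: gen_def nonempty_charts_def)
    moreover have "p \<in> topspace T" using pq gen_subset[OF generator] by auto
    ultimately show "\<exists>ws\<in>lists (nonempty_charts \<times> nonempty_charts). \<exists>W. openin T W \<and> p \<in> W \<and>
      (p, q) \<in> hol ws \<and> hol ws \<inter> (W \<times> UNIV) \<subseteq> gen i j"
      using pq hol_single[OF generator]
      by (intro bexI[of _ "[(i, j)]"] exI[of _ "topspace T"]) (auto simp del: hol.simps)
  qed
  then show ?case
    using gen_single_valued[OF generator] gen_single_valued[OF generator(2,1)] gen_converse[of i j]
    unfolding gen_def by simp
next
  case identity
  have "locally_word (Id_on (topspace T))"
    unfolding locally_word_def
    by (intro allI impI bexI[of _ "[]"] exI[of _ "topspace T"]) auto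
  then show ?case by auto
next
  case (inverse g)
  have "locally_word (g\<inverse>)"
    unfolding locally_word_def
  proof (intro allI impI)
    fix q p assume "(q, p) \<in> g\<inverse>"
    then have "(p, q) \<in> g" by simp
    then obtain ws W where ws: "ws \<in> lists (nonempty_charts \<times> nonempty_charts)" "openin T W" "p \<in> W" "(p, q) \<in> hol ws"
      "hol ws \<inter> (W \<times> UNIV) \<subseteq> g"
      using inverse unfolding locally_word_def by meson
    note wsU = lists_nonempty_charts[OF ws(1)]
    \<comment> \<open>Words are injective, so points of the image of \<open>W\<close> have no
      preimage outside \<open>W\<close>.\<close>
    have "hol (rev (map prod.swap ws)) \<inter> ((hol ws `` W) \<times> UNIV) \<subseteq> g\<inverse>"
    proof (clarsimp simp: hol_rev[OF wsU])
      fix q' i' z' p'' assume *: "(p'', q') \<in> hol ws" "p'' \<in> W" "((i', z'), q') \<in> hol ws"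
      then have "p'' = (i', z')" using hol_converse_single_valued[OF wsU] unfolding single_valued_def by blast
      then show "((i', z'), q') \<in> g" using * ws(5) by auto
    qed
    moreover have "(q, p) \<in> hol (rev (map prod.swap ws))" using ws hol_rev[OF wsU] by simp
    ultimately show "\<exists>ws\<in>lists (nonempty_charts \<times> nonempty_charts). \<exists>W. openin T W \<and> q \<in> W \<and>
      (q, p) \<in> hol ws \<and> hol ws \<inter> (W \<times> UNIV) \<subseteq> g\<inverse>"
      using ws rev_swap_in_lists[OF ws(1)] hol_open_image[OF wsU ws(2)]
      by (intro bexI[of _ "rev (map prod.swap ws)"] exI[of _ "hol ws `` W"] conjI) auto
  qed
  then show ?case using inverse by simp
next
  case (composition g h)
  have "locally_word (g O h)"
    unfolding locally_word_def
  proof (intro allI impI)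
    fix p r assume "(p, r) \<in> g O h"
    then obtain q where q: "(p, q) \<in> g" "(q, r) \<in> h" by auto
    obtain ws W where ws: "ws \<in> lists (nonempty_charts \<times> nonempty_charts)" "openin T W" "p \<in> W" "(p, q) \<in> hol ws"
      "hol ws \<inter> (W \<times> UNIV) \<subseteq> g"
      using q composition unfolding locally_word_def by meson
    obtain vs V where vs: "vs \<in> lists (nonempty_charts \<times> nonempty_charts)" "openin T V" "q \<in> V" "(q, r) \<in> hol vs"
      "hol vs \<inter> (V \<times> UNIV) \<subseteq> h"
      using q composition unfolding locally_word_def by meson
    note wsU = lists_nonempty_charts[OF ws(1)] and vsU = lists_nonempty_charts[OF vs(1)]
    \<comment> \<open>The smaller neighbourhood makes the first word land in \<open>V\<close>, where
      the second is contained in \<open>h\<close>.\<close>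
    have "hol (ws @ vs) \<inter> ((W \<inter> (hol ws)\<inverse> `` V) \<times> UNIV) \<subseteq> g O h"
    proof (clarsimp simp: hol_append[OF vsU])
      fix i' z' r' q' q'' assume *: "((i', z'), q') \<in> hol ws" "(i', z') \<in> W" "q' \<in> V"
        "((i', z'), q'') \<in> hol ws" "(q'', r') \<in> hol vs"
      then have "q' = q''" using hol_single_valued[OF wsU] unfolding single_valued_def by blast
      then show "((i', z'), r') \<in> g O h" using * ws(5) vs(5) by blast
    qed
    then show "\<exists>ws\<in>lists (nonempty_charts \<times> nonempty_charts). \<exists>W. openin T W \<and> p \<in> W \<and>
      (p, r) \<in> hol ws \<and> hol ws \<inter> (W \<times> UNIV) \<subseteq> g O h"
      using ws vs hol_open_vimage[OF wsU vs(2)] hol_append[OF vsU, of ws]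
      by (intro bexI[of _ "ws @ vs"] exI[of _ "W \<inter> (hol ws)\<inverse> `` V"] conjI) (auto simp: openin_Int)
  qed
  then show ?case using composition by (simp add: single_valued_relcomp converse_relcomp)
next
  case (restriction g W0)
  have "locally_word (g \<inter> (W0 \<times> UNIV))"
    unfolding locally_word_def
  proof (intro allI impI)
    fix p q assume pq: "(p, q) \<in> g \<inter> (W0 \<times> UNIV)"
    then obtain ws W where ws: "ws \<in> lists (nonempty_charts \<times> nonempty_charts)" "openin T W" "p \<in> W" "(p, q) \<in> hol ws"
      "hol ws \<inter> (W \<times> UNIV) \<subseteq> g"
      using restriction unfolding locally_word_def by (meson IntE)
    then show "\<exists>ws\<in>lists (nonempty_charts \<times> nonempty_charts). \<exists>W. openin T W \<and> p \<in> W \<and>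
      (p, q) \<in> hol ws \<and> hol ws \<inter> (W \<times> UNIV) \<subseteq> g \<inter> (W0 \<times> UNIV)"
      using restriction(2) pq
      by (intro bexI[of _ ws] exI[of _ "W \<inter> W0"] conjI) (auto simp: openin_Int)
  qed
  then show ?case using restriction by (auto simp: single_valued_def)
next
  case (gluing G)
  have "locally_word (\<Union>G)"
    unfolding locally_word_def
  proof (intro allI impI)
    fix p q assume "(p, q) \<in> \<Union>G"
    then obtain g where g: "g \<in> G" "(p, q) \<in> g" by auto
    then obtain ws W where ws: "ws \<in> lists (nonempty_charts \<times> nonempty_charts)" "openin T W" "p \<in> W" "(p, q) \<in> hol ws"
      "hol ws \<inter> (W \<times> UNIV) \<subseteq> g"
      using gluing unfolding locally_word_def by meson
    then show "\<exists>ws\<in>lists (nonempty_charts \<times> nonempty_charts). \<exists>W. openin T W \<and> p \<in> W \<and>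
      (p, q) \<in> hol ws \<and> hol ws \<inter> (W \<times> UNIV) \<subseteq> \<Union>G"
      using g(1) by (intro bexI[of _ ws] exI[of _ W] conjI) auto
  qed
  then show ?case using gluing by simp
qed

text \<open>
  The points where a word fixes the transversal coordinate with a nontrivial germ. There are only
  countably many words, and these sets are nowhere dense.
\<close>

definition twisted :: "('a, 'z) chart \<Rightarrow> (('a, 'z) chart \<times> ('a, 'z) chart) list \<Rightarrow> 'a set" where
  "twisted i ws = {x \<in> chart_dom i. (pt i x, pt i x) \<in> hol ws \<and>
      \<not> (\<exists>W. openin T W \<and> pt i x \<in> W \<and> hol ws \<inter> (W \<times> UNIV) \<subseteq> Id)}"

text \<open>Arbitrarily near a twisted point the word moves some \<open>y\<close> to a different
  point \<open>q\<close>. Separating the two by \<open>A\<close> and \<open>B\<close>, every point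
  near \<open>y\<close> is sent from \<open>A\<close> into \<open>B\<close>, so none of them is
  fixed, let alone twisted.\<close>

lemma nowhere_dense_twisted:
  assumes i: "i \<in> U" and ws: "ws \<in> lists (U \<times> U)"
  shows "nowhere_dense_in X (twisted i ws)"
proof (rule nowhere_dense_inI)
  show "twisted i ws \<subseteq> topspace X"
    using dom_subset[OF U_subset_F[OF i]] by (auto simp: twisted_def)
  fix V assume V: "openin X V" "V \<noteq> {}"
  show "\<exists>V'. openin X V' \<and> V' \<noteq> {} \<and> V' \<subseteq> V \<and> V' \<inter> twisted i ws = {}"
  proof (cases "V \<inter> twisted i ws = {}")
    case True
    then show ?thesis using V by blast
  next
    case False
    then obtain x where x: "x \<in> V" "x \<in> twisted i ws" by blast
    then have "\<not> hol ws \<inter> (pt i ` (V \<inter> chart_dom i) \<times> UNIV) \<subseteq> Id"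
      using openin_T_image[OF i V(1)] by (auto simp: twisted_def)
    then obtain y q where y: "y \<in> V" "y \<in> chart_dom i" "(pt i y, q) \<in> hol ws" "q \<noteq> pt i y"
      by auto
    then have "pt i y \<in> topspace T" "q \<in> topspace T" using hol_subset[OF ws] by auto
    then obtain A B where AB: "openin T A" "openin T B" "pt i y \<in> A" "q \<in> B" "A \<inter> B = {}"
      using Hausdorff_T y(4) by metis
    let ?V' = "V \<inter> {z \<in> chart_dom i. pt i z \<in> A \<inter> (hol ws)\<inverse> `` B}"
    have "openin X ?V'"
      by (intro openin_Int V openin_T_vimage[OF i] AB hol_open_vimage[OF ws])
    moreover have "y \<in> ?V'" using y AB by auto
    moreover have "?V' \<inter> twisted i ws = {}"
      using AB(5) hol_single_valued[OF ws] unfolding twisted_def single_valued_def by blast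
    ultimately show ?thesis by blast
  qed
qed

text \<open>Conjugating the word by the change from \<open>c\<close> to \<open>i\<close> transfers
  the nontrivial germ to the chart \<open>c\<close>, where \<open>x\<close> and \<open>y\<close>
  have the same transversal point. Iterated along chains, this makes twistedness a property of the
  leaf.\<close>

lemma twisted_saturated:
  assumes y: "y \<in> twisted i ws" and i: "i \<in> nonempty_charts" and ws: "ws \<in> lists (nonempty_charts \<times> nonempty_charts)" and xy: "(x, y) \<in> E"
  shows "\<exists>j\<in>nonempty_charts. \<exists>vs\<in>lists (nonempty_charts \<times> nonempty_charts). x \<in> twisted j vs"
proof -
  obtain c where c: "c \<in> nonempty_charts" "x \<in> chart_dom c" "y \<in> chart_dom c" "chart_proj c x = chart_proj c y"
    using xy unfolding E_iff by blast
  have iU: "i \<in> U" "c \<in> U" and wsU: "ws \<in> lists (U \<times> U)" using i c lists_nonempty_charts[OF ws] by (auto simp: nonempty_charts_def)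
  define vs where "vs = (c, i) # ws @ [(i, c)]"
  have vs: "vs \<in> lists (nonempty_charts \<times> nonempty_charts)" using ws i c by (auto simp: vs_def)
  have hol_vs: "hol vs = gen c i O (hol ws O gen i c)"
    using hol_append[of "[(i, c)]" ws] hol_single[of i c] iU by (simp add: vs_def del: hol.simps(1))
  have yy: "(pt i y, pt i y) \<in> hol ws" "y \<in> chart_dom i" using y by (auto simp: twisted_def)
  have genci: "(pt c y, pt i y) \<in> gen c i" and genic: "(pt i y, pt c y) \<in> gen i c"
    using yy c by (auto simp: gen_def)
  have "x \<in> twisted c vs"
  proof (rule ccontr)
    assume "x \<notin> twisted c vs"
    moreover have "(pt c x, pt c x) \<in> hol vs" using yy genci genic c(4) by (auto simp: hol_vs)
    ultimately obtain W where W: "openin T W" "pt c x \<in> W" "hol vs \<inter> (W \<times> UNIV) \<subseteq> Id"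
      using c(2) by (auto simp: twisted_def)
    \<comment> \<open>A neighbourhood on which the conjugate starts in \<open>W\<close> and is
      defined: \<open>hol ws\<close> must end in the image of \<open>gen c i\<close> for the return
      to \<open>c\<close> to exist.\<close>
    let ?W = "gen c i `` W \<inter> (hol ws)\<inverse> `` (gen c i `` topspace T)"
    have "openin T ?W"
      by (intro openin_Int gen_open_image hol_open_vimage openin_topspace iU wsU W)
    moreover have "pt i y \<in> ?W"
      using W genci yy c(4) gen_subset[OF iU(2,1)] by auto
    moreover have "hol ws \<inter> (?W \<times> UNIV) \<subseteq> Id"
    proof
      fix e assume e: "e \<in> hol ws \<inter> (?W \<times> UNIV)"
      obtain q q2 where q: "e = (q, q2)" by (cases e)
      then have "(q, q2) \<in> hol ws" "q \<in> gen c i `` W" "q \<in> (hol ws)\<inverse> `` (gen c i `` topspace T)"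
        using e by simp_all
      then obtain p b a where *: "(q, q2) \<in> hol ws" "p \<in> W" "(p, q) \<in> gen c i"
        "(q, b) \<in> hol ws" "(a, b) \<in> gen c i"
        by blast
      have "b = q2" using * hol_single_valued[OF wsU] unfolding single_valued_def by blast
      have "(b, a) \<in> gen i c" using * gen_converse[of c i] by blast
      then have "(p, a) \<in> hol vs" using * by (auto simp: hol_vs)
      then have "p = a" using W(3) * by auto
      then have "q = q2" using * gen_single_valued[OF iU(2,1)] \<open>b = q2\<close> unfolding single_valued_def by blast
      then show "e \<in> Id" using q by simp
    qed
    ultimately show False using y by (auto simp: twisted_def)
  qed
  then show ?thesis using c(1) vs by blast
qed

lemma germ_at_eqI:
  assumes "openin T W" "p \<in> W" "g \<inter> (W \<times> UNIV) = h \<inter> (W \<times> UNIV)"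
  shows "germ_at T p g = germ_at T p h"
proof -
  have *: "germ_at T p g \<subseteq> germ_at T p h" if gh: "g \<inter> (W \<times> UNIV) = h \<inter> (W \<times> UNIV)" for g h
  proof
    fix k assume "k \<in> germ_at T p g"
    then obtain V where V: "openin T V" "p \<in> V" "k \<inter> (V \<times> UNIV) = g \<inter> (V \<times> UNIV)"
      unfolding germ_at_def by blast
    then have "k \<inter> ((V \<inter> W) \<times> UNIV) = h \<inter> ((V \<inter> W) \<times> UNIV)" using gh by blast
    then show "k \<in> germ_at T p h"
      unfolding germ_at_def using V assms(1,2) by (auto intro!: exI[of _ "V \<inter> W"])
  qed
  show ?thesis using *[OF assms(3)] *[OF assms(3)[symmetric]] by (rule antisym)
qed

text \<open>A holonomy germ at a point of the leaf is the germ of a word, and a word that fixes the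
  point and is not twisted there is the identity nearby. Twistedness elsewhere on the leaf would
  pass back to \<open>x\<close>.\<close>

lemma untwisted_without_holonomy:
  assumes x: "x \<in> topspace X" and un: "\<And>i ws. i \<in> nonempty_charts \<Longrightarrow> ws \<in> lists (nonempty_charts \<times> nonempty_charts) \<Longrightarrow> x \<notin> twisted i ws"
  shows "without_holonomy U (leaf x)"
proof -
  have un_leaf: "y \<notin> twisted i ws" if "(x, y) \<in> E\<^sup>*" "i \<in> nonempty_charts" "ws \<in> lists (nonempty_charts \<times> nonempty_charts)" for y i ws
    using that
  proof (induction arbitrary: i ws rule: rtrancl_induct)
    case (step y z)
    then show ?case using twisted_saturated[of z i ws y] by blast
  qed (use un in blast)
  show ?thesis
    unfolding without_holonomy_def
  proof (intro ballI impI)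
    fix y i assume y: "y \<in> leaf x" and i: "i \<in> U" "y \<in> chart_dom i"
    let ?p = "pt i y" and ?I = "Id_on (topspace T)"
    have i1: "i \<in> nonempty_charts" using i by (auto simp: nonempty_charts_def)
    have p: "?p \<in> topspace T" by (rule pt_in_T[OF i])
    have "germ_at T ?p g = germ_at T ?p ?I" if g: "g \<in> holonomy_pseudogroup U" "(?p, ?p) \<in> g" for g
    proof -
      have sv: "single_valued g" and lw: "locally_word g" using pseudogroup_locally_word[OF g(1)] by auto
      obtain ws W where ws: "ws \<in> lists (nonempty_charts \<times> nonempty_charts)" "openin T W" "?p \<in> W" "(?p, ?p) \<in> hol ws"
        "hol ws \<inter> (W \<times> UNIV) \<subseteq> g"
        using lw g(2) unfolding locally_word_def by meson
      note wsU = lists_nonempty_charts[OF ws(1)]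
      have "y \<notin> twisted i ws" using un_leaf y i1 ws(1) by blast
      then obtain V where V: "openin T V" "?p \<in> V" "hol ws \<inter> (V \<times> UNIV) \<subseteq> Id"
        using i(2) ws(4) by (auto simp: twisted_def)
      \<comment> \<open>On \<open>V\<close> the word is contained in \<open>Id\<close>; intersecting
        with its domain makes it equal to the identity, which \<open>g\<close> then
        inherits.\<close>
      let ?W = "W \<inter> V \<inter> (hol ws)\<inverse> `` topspace T"
      have "openin T ?W" by (intro openin_Int ws V hol_open_vimage[OF wsU] openin_topspace)
      moreover have "?p \<in> ?W" using ws V p by auto
      moreover have "(a, b) \<in> g \<longleftrightarrow> (a, b) \<in> ?I" if a: "a \<in> ?W" for a b
      proof -
        obtain r where r: "(a, r) \<in> hol ws" "r \<in> topspace T" using a by auto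
        then have "r = a" using V(3) a by auto
        then have "(a, a) \<in> g" "a \<in> topspace T" using r ws(5) a by auto
        then show ?thesis using sv unfolding single_valued_def by blast
      qed
      then have "g \<inter> (?W \<times> UNIV) = ?I \<inter> (?W \<times> UNIV)" by blast
      ultimately show ?thesis by (rule germ_at_eqI)
    qed
    moreover have "?I \<in> {g \<in> holonomy_pseudogroup U. (?p, ?p) \<in> g}"
      using p holonomy_pseudogroup.identity by auto
    ultimately show "holonomy_group U ?p = {germ_at T ?p ?I}"
      unfolding holonomy_group_def by blast
  qed
qed

text \<open>There are countably many pairs of a nonempty chart and a word, so the twisted points are
  meager. A point that is never twisted and whose leaf is dense lies in the good set.\<close>

lemma meager_complement_dense_leaves_without_holonomy:
  assumes "transitive_foliated_space X F"
  shows "meager_in X (topspace X - dense_leaves_without_holonomy X F U)"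
proof -
  define N where "N = (\<Union>(i, ws)\<in>nonempty_charts \<times> lists (nonempty_charts \<times> nonempty_charts). twisted i ws)"
  have "countable (nonempty_charts \<times> lists (nonempty_charts \<times> nonempty_charts))"
    using finite_nonempty_charts by (intro countable_SIGMA countable_lists) (auto simp: countable_finite)
  then have "meager_in X N"
    unfolding N_def
  proof (rule meager_in_UN)
    fix e assume "e \<in> nonempty_charts \<times> lists (nonempty_charts \<times> nonempty_charts)"
    then obtain i ws where e: "e = (i, ws)" "i \<in> nonempty_charts" "ws \<in> lists (nonempty_charts \<times> nonempty_charts)" by blast
    then have "nowhere_dense_in X (twisted i ws)"
      by (intro nowhere_dense_twisted lists_nonempty_charts) (auto simp: nonempty_charts_def)
    then show "meager_in X (case e of (i, ws) \<Rightarrow> twisted i ws)" using e nowhere_dense_imp_meager by simp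
  qed
  then have "meager_in X ({x \<in> topspace X. \<not> dense_in X (leaf x)} \<union> N)"
    by (intro meager_in_Un meager_nondense assms)
  moreover have "topspace X - dense_leaves_without_holonomy X F U \<subseteq> {x \<in> topspace X. \<not> dense_in X (leaf x)} \<union> N"
  proof
    fix x assume x: "x \<in> topspace X - dense_leaves_without_holonomy X F U"
    show "x \<in> {x \<in> topspace X. \<not> dense_in X (leaf x)} \<union> N"
    proof (rule ccontr)
      assume "\<not> ?thesis"
      then have *: "dense_in X (leaf x)" "x \<notin> N" using x by auto
      have "without_holonomy U (leaf x)"
        by (rule untwisted_without_holonomy) (use x * in \<open>auto simp: N_def\<close>)
      then have "x \<in> dense_leaves_without_holonomy X F U"
        using x * unfolding dense_leaves_without_holonomy_def leaves_eq by blast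
      then show False using x by simp
    qed
  qed
  ultimately show ?thesis by (rule meager_in_subset)
qed

section \<open>Transport of germs along leaves\<close>

text \<open>
  The functions \<open>u\<close> and \<open>v\<close> are read as germs along the filter \<open>G\<close>: holonomy along a plaque carries
  the transversal coordinate of \<open>u\<close> to that of \<open>v\<close>. A chain that returns to its limit point is a
  holonomy germ evaluated along \<open>u\<close>.
\<close>

definition parallel :: "'i filter \<Rightarrow> (('i \<Rightarrow> 'a) \<times> ('i \<Rightarrow> 'a)) set" where
  "parallel G = {(u, v). \<exists>c\<in>U. \<exists>x\<in>chart_dom c. \<exists>y\<in>chart_dom c. limitin X u x G \<and> limitin X v y G \<and>
      eventually (\<lambda>i. chart_proj c (u i) = chart_proj c (v i)) G}"

lemma parallel_I:
  assumes "c \<in> U" "limitin X u x G" "limitin X v y G" "x \<in> chart_dom c" "y \<in> chart_dom c"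
    "eventually (\<lambda>i. chart_proj c (u i) = chart_proj c (v i)) G"
  shows "(u, v) \<in> parallel G"
  using assms unfolding parallel_def by blast

lemma limit_unique: "limitin X u x G \<Longrightarrow> limitin X u y G \<Longrightarrow> G \<noteq> bot \<Longrightarrow> x = y"
  using limitin_Hausdorff_unique Hausdorff_X by metis

lemma limit_proj_eq:
  assumes c: "c \<in> F" and u: "limitin X u x G" "x \<in> chart_dom c" and v: "limitin X v y G" "y \<in> chart_dom c"
    and ev: "eventually (\<lambda>i. chart_proj c (u i) = chart_proj c (v i)) G" and G: "G \<noteq> bot"
  shows "chart_proj c x = chart_proj c y"
proof -
  have "limitin (chart_trans c) (\<lambda>i. chart_proj c (v i)) (chart_proj c x) G"
    by (rule limitin_transform_eventually[OF ev foliated_chart_limitin_proj(1)[OF chart_F[OF c] u]])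
  then show ?thesis
    using limitin_Hausdorff_unique[OF _ foliated_chart_limitin_proj(1)[OF chart_F[OF c] v] G
        foliated_chart_Hausdorff[OF chart_F[OF c]]] by blast
qed

lemma parallel_limit:
  assumes uv: "(u, v) \<in> parallel G" and u: "limitin X u x G" and v: "limitin X v y G" and G: "G \<noteq> bot"
  shows "(x, y) \<in> E"
proof -
  obtain c x' y' where c: "c \<in> U" "x' \<in> chart_dom c" "y' \<in> chart_dom c" "limitin X u x' G"
    "limitin X v y' G" "eventually (\<lambda>i. chart_proj c (u i) = chart_proj c (v i)) G"
    using uv unfolding parallel_def by blast
  have "x' = x" "y' = y" using limit_unique[OF _ _ G] u v c by blast+
  then show ?thesis
    using limit_proj_eq[OF U_subset_F[OF c(1)] c(4,2,5,3,6) G] c unfolding E_def by blast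
qed

lemma parallel_has_limit: "(u, v) \<in> parallel G \<Longrightarrow> \<exists>y. limitin X v y G"
  unfolding parallel_def by blast

text \<open>Intermediate functions converge automatically, because \<open>parallel\<close> includes
  convergence of both of its arguments.\<close>

lemma parallel_relpow_limit:
  assumes "(u, v) \<in> parallel G ^^ k" "limitin X u x G" "limitin X v y G" "G \<noteq> bot"
  shows "(x, y) \<in> E ^^ k"
  using assms(1,3)
proof (induction k arbitrary: v y)
  case 0
  then show ?case using limit_unique[OF assms(2) _ assms(4)] by simp
next
  case (Suc k)
  then obtain w where w: "(u, w) \<in> parallel G ^^ k" "(w, v) \<in> parallel G" by auto
  have "\<exists>z. limitin X w z G"
  proof (cases k)
    case 0
    then show ?thesis using w assms(2) by auto
  next
    case (Suc k')
    then show ?thesis using w(1) parallel_has_limit by auto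
  qed
  then obtain z where z: "limitin X w z G" ..
  have "(x, z) \<in> E ^^ k" by (rule Suc.IH[OF w(1) z])
  moreover have "(z, y) \<in> E" by (rule parallel_limit[OF w(2) z Suc.prems(2) assms(4)])
  ultimately show ?case by auto
qed

lemma sym_parallel: "sym (parallel G)"
proof (rule symI)
  fix u v assume "(u, v) \<in> parallel G"
  then obtain c x y where "c \<in> U" "x \<in> chart_dom c" "y \<in> chart_dom c" "limitin X u x G"
    "limitin X v y G" "eventually (\<lambda>i. chart_proj c (u i) = chart_proj c (v i)) G"
    unfolding parallel_def by blast
  then show "(v, u) \<in> parallel G"
    by (intro parallel_I[of c v y G u x]) (auto elim: eventually_mono)
qed

text \<open>Chains relate functions themselves rather than their classes modulo the filter, so
  replacing a function by an eventually equal one costs a step.\<close>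

lemma parallel_of_eventually_eq:
  assumes u: "limitin X u x G" and ev: "eventually (\<lambda>i. u i = v i) G"
  shows "(u, v) \<in> parallel G"
proof -
  obtain c where c: "c \<in> U" "x \<in> chart_dom c" using cover_U[OF limitin_topspace[OF u]] by blast
  have "eventually (\<lambda>i. chart_proj c (u i) = chart_proj c (v i)) G" using ev by eventually_elim simp
  then show ?thesis
    using parallel_I[OF c(1) u limitin_transform_eventually[OF ev u] c(2,2)] by blast
qed

text \<open>
  A limit of plaques of \<open>c\<close> need not be a plaque of the atlas. It is contained in a connected subset
  of a plaque of the extended chart, which is covered by a number of plaques that does not depend on
  the limit.
\<close>

lemma chart_transport:
  assumes c: "c \<in> U"
  shows "\<exists>N. \<forall>(G :: 'i filter) u v x y. G \<noteq> bot \<longrightarrow> limitin X u x G \<longrightarrow> limitin X v y G \<longrightarrow>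
    eventually (\<lambda>i. u i \<in> chart_dom c \<and> v i \<in> chart_dom c \<and> chart_proj c (u i) = chart_proj c (v i)) G \<longrightarrow>
    (u, v) \<in> parallel G ^^ N"
proof -
  obtain d where d: "d \<in> F" "chart_dom c \<subseteq> chart_dom d" "X closure_of chart_dom c \<subseteq> chart_dom d"
    "\<And>x. x \<in> chart_dom c \<Longrightarrow> chart_map c x = chart_map d x"
    "\<And>x. x \<in> chart_dom c \<Longrightarrow> chart_proj c x = chart_proj d x"
    by (rule chart_extension[OF c]) blast
  note cd = chart_F[OF d(1)]
  define K where "K = X closure_of chart_dom c"
  have Kclosed: "closedin X K" by (simp add: K_def)
  have Kd: "K \<subseteq> chart_dom d" using d(3) by (simp add: K_def)
  have cK: "chart_dom c \<subseteq> K"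
    unfolding K_def by (intro closure_of_subset dom_subset U_subset_F c)
  \<comment> \<open>Sets small enough that points with equal projection in \<open>d\<close> lie on
    one plaque of a single chart of the atlas.\<close>
  define good where "good = (\<lambda>W. openin X W \<and> W \<subseteq> chart_dom d \<and>
    (\<exists>j\<in>U. W \<subseteq> chart_dom j \<and> (\<exists>h. \<forall>q\<in>W. chart_proj j q = h (chart_proj d q))))"
  have ex_good: "\<exists>W. good W \<and> k \<in> W" if k: "k \<in> K" for k
  proof -
    have kd: "k \<in> chart_dom d" using k Kd by blast
    then have "k \<in> topspace X" using dom_subset[OF d(1)] by blast
    then obtain j where j: "j \<in> U" "k \<in> chart_dom j" using cover_U by blast
    obtain W h where "openin X W" "k \<in> W" "W \<subseteq> chart_dom d \<inter> chart_dom j"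
      "\<And>q. q \<in> W \<Longrightarrow> chart_proj j q = h (chart_proj d q)"
      using change_proj[OF d(1) U_subset_F[OF j(1)] kd j(2)] by metis
    then show ?thesis using j(1) unfolding good_def by (intro exI[of _ W]) auto
  qed
  have "compactin X K" by (rule closedin_compact_space[OF compact_X Kclosed])
  moreover have "\<And>W. W \<in> Collect good \<Longrightarrow> openin X W" by (simp add: good_def)
  moreover have "K \<subseteq> \<Union>(Collect good)" using ex_good by blast
  \<comment> \<open>The cover is fixed before the filter and the functions are, hence so is the
    number of steps.\<close>
  ultimately obtain \<W> where \<W>: "finite \<W>" "\<W> \<subseteq> Collect good" "K \<subseteq> \<Union>\<W>"
    using compactinD[of X K "Collect good"] by blast
  have W_parallel: "(w, w') \<in> parallel G"
    if W: "W \<in> \<W>" "q \<in> W" "q' \<in> W" and w: "limitin X w q G" "limitin X w' q' G"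
      "eventually (\<lambda>i. chart_proj d (w i) = chart_proj d (w' i)) G"
    for W q q' w w' and G :: "'i filter"
  proof -
    have "good W" using W(1) \<W>(2) by blast
    then obtain j h where j: "openin X W" "j \<in> U" "W \<subseteq> chart_dom j" "\<forall>q\<in>W. chart_proj j q = h (chart_proj d q)"
      unfolding good_def by blast
    have "eventually (\<lambda>i. chart_proj j (w i) = chart_proj j (w' i)) G"
      using limitinD[OF w(1) j(1) W(2)] limitinD[OF w(2) j(1) W(3)] w(3)
      by eventually_elim (use j(4) in simp)
    then show ?thesis using parallel_I[OF j(2) w(1,2)] W j(3) by blast
  qed
  have "(u, v) \<in> parallel G ^^ Suc (card \<W>)"
    if G: "G \<noteq> bot" and u: "limitin X u x G" and v: "limitin X v y G"
      and ev: "eventually (\<lambda>i. u i \<in> chart_dom c \<and> v i \<in> chart_dom c \<and> chart_proj c (u i) = chart_proj c (v i)) G"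
    for u v x y and G :: "'i filter"
  proof -
    have "eventually (\<lambda>i. u i \<in> K) G" "eventually (\<lambda>i. v i \<in> K) G"
      using ev by (eventually_elim, use cK in blast)+
    then have xK: "x \<in> K" and yK: "y \<in> K"
      using limitin_closedin[OF u Kclosed _ G] limitin_closedin[OF v Kclosed _ G] by blast+
    have evd: "eventually (\<lambda>i. chart_proj d (u i) = chart_proj d (v i)) G"
      using ev
    proof eventually_elim
      case (elim i)
      then show ?case using d(5)[of "u i"] d(5)[of "v i"] by metis
    qed
    define z where "z = chart_proj d x"
    have yz: "chart_proj d y = z"
      using limit_proj_eq[OF d(1) u _ v _ evd G] xK yK Kd unfolding z_def by (metis subsetD)
    \<comment> \<open>The slice of \<open>K\<close> at height \<open>z\<close> contains both limits,
      and it is connected as the image of the closure of the ball of \<open>c\<close>.\<close>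
    define D where "D = {q \<in> K. chart_proj d q = z}"
    let ?B = "subtopology (Euclidean_space n) (chart_ball d)"
    let ?A = "?B closure_of chart_ball c"
    let ?P = "prod_topology ?B (chart_trans d)"
    let ?S = "subtopology X (chart_dom d)"
    have ballc: "euclidean_open_ball n (chart_ball c)" using chart_U[OF c] by (simp add: foliated_chart_def)
    have "?P closure_of (chart_map d ` chart_dom c) = chart_map d ` (?S closure_of chart_dom c)"
    proof (rule homeomorphic_map_closure_of[OF foliated_chart_homeomorphic_map[OF cd]])
      show "chart_dom c \<subseteq> topspace ?S" using d(2) dom_subset[OF d(1)] by auto
    qed
    moreover have "?S closure_of chart_dom c = K"
      using d(2) Kd by (simp add: closure_of_subtopology K_def Int_absorb1)
    moreover have "chart_map d ` chart_dom c = chart_ball c \<times> topspace (chart_trans c)"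
      using foliated_chart_image[OF chart_U[OF c]] d(4) by (metis image_cong)
    ultimately have imK: "chart_map d ` K = ?A \<times> (chart_trans d closure_of topspace (chart_trans c))"
      by (simp add: closure_of_Times)
    obtain \<psi> where \<psi>: "continuous_map ?P ?S \<psi>"
      "\<And>x. x \<in> chart_dom d \<Longrightarrow> \<psi> (chart_map d x) = x"
      "\<And>b z. b \<in> chart_ball d \<Longrightarrow> z \<in> topspace (chart_trans d) \<Longrightarrow>
          \<psi> (b, z) \<in> chart_dom d \<and> chart_map d (\<psi> (b, z)) = (b, z)"
      by (rule foliated_chart_inverse[OF cd]) blast
    have xd: "x \<in> chart_dom d" using xK Kd by blast
    have zt: "z \<in> topspace (chart_trans d)"
      unfolding z_def by (rule foliated_chart_proj_in[OF cd xd])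
    have "chart_map d x \<in> chart_map d ` K" using xK by blast
    then have zcl: "z \<in> chart_trans d closure_of topspace (chart_trans c)"
      unfolding imK z_def chart_proj_def by auto
    have Dim: "D = (\<lambda>b. \<psi> (b, z)) ` ?A"
    proof (intro equalityI subsetI)
      fix q assume "q \<in> D"
      then have q: "q \<in> K" "chart_map d q = (fst (chart_map d q), z)" by (auto simp: D_def chart_proj_def prod_eq_iff)
      then have "fst (chart_map d q) \<in> ?A" using imK by (metis imageI mem_Times_iff)
      moreover have "q = \<psi> (fst (chart_map d q), z)" using \<psi>(2)[of q] q Kd by auto
      ultimately show "q \<in> (\<lambda>b. \<psi> (b, z)) ` ?A" by blast
    next
      fix q assume "q \<in> (\<lambda>b. \<psi> (b, z)) ` ?A"
      then obtain b where b: "b \<in> ?A" "q = \<psi> (b, z)" by blast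
      then have "(b, z) \<in> chart_map d ` K" using zcl imK by simp
      then obtain k where k: "k \<in> K" "chart_map d k = (b, z)" by auto
      then have "q = k" using \<psi>(2)[of k] b Kd by auto
      then show "q \<in> D" using k by (simp add: D_def chart_proj_def)
    qed
    have "continuous_map ?B ?P (\<lambda>b. (b, z))"
      using zt by (simp add: continuous_map_pairwise comp_def)
    from continuous_map_compose[OF this \<psi>(1)]
    have cont: "continuous_map ?B X (\<lambda>b. \<psi> (b, z))"
      by (simp add: comp_def continuous_map_in_subtopology)
    have "chart_ball c \<subseteq> chart_ball d"
    proof
      fix b assume "b \<in> chart_ball c"
      moreover obtain a where "a \<in> chart_dom c"
        using eventually_happens'[OF G ev] by blast
      ultimately have "(b, chart_proj c a) \<in> chart_map c ` chart_dom c"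
        using foliated_chart_image[OF chart_U[OF c]] foliated_chart_proj_in[OF chart_U[OF c]] by simp
      then obtain a' where "a' \<in> chart_dom c" "chart_map c a' = (b, chart_proj c a)" by auto
      then show "b \<in> chart_ball d"
        using foliated_chart_ball_in[OF cd, of a'] d(2) d(4)[of a'] by auto
    qed
    then have "connectedin ?B (chart_ball c)"
      using connected_euclidean_open_ball[OF ballc] by (simp add: connectedin_subtopology)
    then have "connectedin ?B ?A" by (rule connectedin_closure_of)
    then have conD: "connectedin X D" unfolding Dim by (rule connectedin_continuous_map_image[OF cont])
    define C where "C = {(p, q). p \<in> D \<and> q \<in> D \<and> (\<exists>W\<in>\<W>. p \<in> W \<and> q \<in> W)}"
    have "(x, y) \<in> C ^^ card \<W>"
      unfolding C_def
    proof (rule connected_chain[OF conD \<W>(1)])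
      show "\<And>W. W \<in> \<W> \<Longrightarrow> openin X W" using \<W>(2) unfolding good_def by blast
      show "D \<subseteq> \<Union>\<W>" using \<W>(3) by (auto simp: D_def)
      show "x \<in> D" "y \<in> D" using xK yK yz by (auto simp: D_def z_def)
    qed
    \<comment> \<open>Along the chain in \<open>D\<close>, the lifts keep the transversal coordinate
      of \<open>u\<close> in \<open>d\<close>, so consecutive lifts are parallel.\<close>
    moreover have "\<exists>w. limitin X w q G \<and> eventually (\<lambda>i. chart_proj d (w i) = chart_proj d (u i)) G \<and> (u, w) \<in> parallel G ^^ k"
      if "(x, q) \<in> C ^^ k" for q k
      using that
    proof (induction k arbitrary: q)
      case 0
      then show ?case using u by (intro exI[of _ u]) auto
    next
      case (Suc k)
      then obtain p where p: "(x, p) \<in> C ^^ k" "(p, q) \<in> C" by auto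
      obtain w where w: "limitin X w p G" "eventually (\<lambda>i. chart_proj d (w i) = chart_proj d (u i)) G" "(u, w) \<in> parallel G ^^ k"
        using Suc.IH[OF p(1)] by blast
      obtain W where W: "W \<in> \<W>" "p \<in> W" "q \<in> W" "p \<in> D" "q \<in> D" using p(2) by (auto simp: C_def)
      have pq: "p \<in> chart_dom d" "q \<in> chart_dom d" "chart_proj d q = chart_proj d p"
        using W Kd by (auto simp: D_def)
      obtain w' where w': "limitin X w' q G"
        "eventually (\<lambda>i. w' i \<in> chart_dom d \<and> chart_proj d (w' i) = chart_proj d (w i)) G"
        by (rule foliated_chart_lift[OF cd w(1) pq])
      have "eventually (\<lambda>i. chart_proj d (w i) = chart_proj d (w' i)) G"
        using w'(2) by eventually_elim simp
      then have "(w, w') \<in> parallel G" by (rule W_parallel[OF W(1-3) w(1) w'(1)])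
      moreover have "eventually (\<lambda>i. chart_proj d (w' i) = chart_proj d (u i)) G"
        using w'(2) w(2) by eventually_elim simp
      ultimately show ?case using w'(1) w(3) by (intro exI[of _ w']) auto
    qed
    ultimately obtain w where w: "limitin X w y G" "eventually (\<lambda>i. chart_proj d (w i) = chart_proj d (u i)) G"
      "(u, w) \<in> parallel G ^^ card \<W>"
      by blast
    \<comment> \<open>The last lift \<open>w\<close> converges to \<open>y\<close> as
      \<open>v\<close> does, but may differ from \<open>v\<close> within the plaques; one more step
      leads to \<open>v\<close>, hence the \<open>Suc\<close>.\<close>
    obtain W where W: "W \<in> \<W>" "y \<in> W" using \<W>(3) yK by blast
    have "eventually (\<lambda>i. chart_proj d (w i) = chart_proj d (v i)) G"
      using w(2) evd by eventually_elim simp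
    then have "(w, v) \<in> parallel G" by (rule W_parallel[OF W(1,2,2) w(1) v])
    then show ?thesis using w(3) by auto
  qed
  then show ?thesis by (intro exI[of _ "Suc (card \<W>)"] allI impI)
qed

lemma parallel_relpow_mono:
  assumes "(u, v) \<in> parallel G ^^ m" "limitin X v y G" "m \<le> k"
  shows "(u, v) \<in> parallel G ^^ k"
  using assms(3,1)
proof (induction rule: dec_induct)
  case (step j)
  have "(v, v) \<in> parallel G" by (rule parallel_of_eventually_eq[OF assms(2)]) simp
  then show ?case using step by auto
qed

text \<open>The ultrafilter selects one chart that realises the adjacency along \<open>G\<close>;
  the sum over the finitely many nonempty charts dominates each bound.\<close>

lemma transport:
  "\<exists>N. \<forall>(G :: 'i filter) u v x y. ultrafilter G \<longrightarrow> limitin X u x G \<longrightarrow> limitin X v y G \<longrightarrow>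
    eventually (\<lambda>i. (u i, v i) \<in> E) G \<longrightarrow> (u, v) \<in> parallel G ^^ N"
proof -
  have "\<forall>c\<in>nonempty_charts. \<exists>N. \<forall>(G :: 'i filter) u v x y. G \<noteq> bot \<longrightarrow> limitin X u x G \<longrightarrow> limitin X v y G \<longrightarrow>
    eventually (\<lambda>i. u i \<in> chart_dom c \<and> v i \<in> chart_dom c \<and> chart_proj c (u i) = chart_proj c (v i)) G \<longrightarrow>
    (u, v) \<in> parallel G ^^ N"
  proof
    fix c assume "c \<in> nonempty_charts"
    then have "c \<in> U" by (simp add: nonempty_charts_def)
    then show "\<exists>N. \<forall>(G :: 'i filter) u v x y. G \<noteq> bot \<longrightarrow> limitin X u x G \<longrightarrow> limitin X v y G \<longrightarrow>
      eventually (\<lambda>i. u i \<in> chart_dom c \<and> v i \<in> chart_dom c \<and> chart_proj c (u i) = chart_proj c (v i)) G \<longrightarrow>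
      (u, v) \<in> parallel G ^^ N"
      by (rule chart_transport)
  qed
  from bchoice[OF this] obtain N where N: "\<forall>c\<in>nonempty_charts. \<forall>(G :: 'i filter) u v x y. G \<noteq> bot \<longrightarrow> limitin X u x G \<longrightarrow> limitin X v y G \<longrightarrow>
    eventually (\<lambda>i. u i \<in> chart_dom c \<and> v i \<in> chart_dom c \<and> chart_proj c (u i) = chart_proj c (v i)) G \<longrightarrow>
    (u, v) \<in> parallel G ^^ N c" ..
  have "(u, v) \<in> parallel G ^^ (\<Sum>c\<in>nonempty_charts. N c)"
    if G: "ultrafilter G" and u: "limitin X u x G" and v: "limitin X v y G"
      and ev: "eventually (\<lambda>i. (u i, v i) \<in> E) G" for u v x y and G :: "'i filter"
  proof -
    have "eventually (\<lambda>i. \<exists>c\<in>nonempty_charts. u i \<in> chart_dom c \<and> v i \<in> chart_dom c \<and> chart_proj c (u i) = chart_proj c (v i)) G"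
      using ev unfolding E_iff .
    then obtain c where c: "c \<in> nonempty_charts"
      "eventually (\<lambda>i. u i \<in> chart_dom c \<and> v i \<in> chart_dom c \<and> chart_proj c (u i) = chart_proj c (v i)) G"
      by (rule ultrafilter_finite_split[OF G finite_nonempty_charts])
    have "G \<noteq> bot" using G by (simp add: ultrafilter_def)
    then have "(u, v) \<in> parallel G ^^ N c" using N c u v by blast
    moreover have "N c \<le> (\<Sum>c\<in>nonempty_charts. N c)" by (rule member_le_sum) (use c(1) finite_nonempty_charts in auto)
    ultimately show ?thesis using parallel_relpow_mono v by blast
  qed
  then show ?thesis by (intro exI[of _ "\<Sum>c\<in>nonempty_charts. N c"] allI impI)
qed

text \<open>Intermediate points are chosen for each index and converge by compactness, and each link
  costs \<open>N\<close> steps. The extra step covers \<open>k = 0\<close>, where \<open>u\<close>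
  and \<open>v\<close> agree only eventually.\<close>

lemma transport_relpow:
  obtains N where "\<And>(G :: 'i filter) u v x y k. ultrafilter G \<Longrightarrow> limitin X u x G \<Longrightarrow> limitin X v y G \<Longrightarrow>
    eventually (\<lambda>i. (u i, v i) \<in> E ^^ k) G \<Longrightarrow> (u, v) \<in> parallel G ^^ (N * k + 1)"
proof -
  from transport obtain N where N: "\<forall>(G :: 'i filter) u v x y. ultrafilter G \<longrightarrow> limitin X u x G \<longrightarrow> limitin X v y G \<longrightarrow>
    eventually (\<lambda>i. (u i, v i) \<in> E) G \<longrightarrow> (u, v) \<in> parallel G ^^ N" ..
  have "(u, v) \<in> parallel G ^^ (N * k + 1)"
    if G: "ultrafilter G" and u: "limitin X u x G" and v: "limitin X v y G"
      and ev: "eventually (\<lambda>i. (u i, v i) \<in> E ^^ k) G" for u v x y k and G :: "'i filter"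
    using v ev
  proof (induction k arbitrary: v y)
    case 0
    then show ?case using parallel_of_eventually_eq[OF u] by simp
  next
    case (Suc k)
    define w where "w = (\<lambda>i. SOME w. (u i, w) \<in> E ^^ k \<and> (w, v i) \<in> E)"
    have w: "eventually (\<lambda>i. (u i, w i) \<in> E ^^ k \<and> (w i, v i) \<in> E) G"
      using Suc.prems(2)
    proof eventually_elim
      case (elim i)
      then have "\<exists>w. (u i, w) \<in> E ^^ k \<and> (w, v i) \<in> E" by auto
      then show ?case unfolding w_def by (rule someI_ex)
    qed
    then have "eventually (\<lambda>i. w i \<in> topspace X) G"
      by eventually_elim (use E_subset in blast)
    then obtain z where z: "limitin X w z G" by (rule compact_space_ultralimit[OF compact_X G])
    have "(u, w) \<in> parallel G ^^ (N * k + 1)"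
      by (rule Suc.IH[OF z]) (use w in \<open>auto elim: eventually_mono\<close>)
    moreover have "eventually (\<lambda>i. (w i, v i) \<in> E) G" using w by (auto elim: eventually_mono)
    then have "(w, v) \<in> parallel G ^^ N" using N G z Suc.prems(1) by blast
    ultimately have "(u, v) \<in> parallel G ^^ (N * k + 1 + N)" unfolding relpow_add_iff by blast
    then show ?case by (simp add: algebra_simps)
  qed
  then show ?thesis by (rule that)
qed

text \<open>The opposite direction to \<open>transport_relpow\<close>: chains on the limit leaf lift
  to nearby leaves plaque by plaque, with no loss in length.\<close>

lemma lift_relpow:
  assumes u: "limitin X u x G" and xy: "(x, y) \<in> E ^^ k"
  shows "\<exists>w. limitin X w y G \<and> (u, w) \<in> parallel G ^^ k \<and> eventually (\<lambda>i. (u i, w i) \<in> E ^^ k) G"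
  using xy
proof (induction k arbitrary: y)
  case 0
  then show ?case using u by (intro exI[of _ u]) auto
next
  case (Suc k)
  then obtain z where z: "(x, z) \<in> E ^^ k" "(z, y) \<in> E" by auto
  obtain w where w: "limitin X w z G" "(u, w) \<in> parallel G ^^ k" "eventually (\<lambda>i. (u i, w i) \<in> E ^^ k) G"
    using Suc.IH[OF z(1)] by blast
  obtain c where c: "c \<in> U" "z \<in> chart_dom c" "y \<in> chart_dom c" "chart_proj c y = chart_proj c z"
    using z(2) unfolding E_def by force
  note cc = chart_U[OF c(1)]
  obtain w' where w': "limitin X w' y G"
    "eventually (\<lambda>i. w' i \<in> chart_dom c \<and> chart_proj c (w' i) = chart_proj c (w i)) G"
    by (rule foliated_chart_lift[OF cc w(1) c(2,3,4)])
  have "eventually (\<lambda>i. chart_proj c (w i) = chart_proj c (w' i)) G"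
    using w'(2) by eventually_elim simp
  then have 1: "(w, w') \<in> parallel G" by (rule parallel_I[OF c(1) w(1) w'(1) c(2,3)])
  have 2: "eventually (\<lambda>i. (u i, w' i) \<in> E ^^ Suc k) G"
    using w(3) w'(2) foliated_chart_limitin_proj(2)[OF cc w(1) c(2)]
  proof eventually_elim
    case (elim i)
    then have "(w i, w' i) \<in> E" using c(1) unfolding E_def by (simp, metis)
    then show ?case using elim by auto
  qed
  show ?case using w' w(2) 1 2 by (intro exI[of _ w']) auto
qed

text \<open>Each link composes the element obtained so far with one generator. The charts at the two
  ends are arbitrary, so the base case is a generator rather than the identity.\<close>

lemma parallel_rtrancl_holonomy:
  assumes "(u, v) \<in> (parallel G)\<^sup>*" "limitin X u x G" "limitin X v y G" "i \<in> U" "j \<in> U"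
    "x \<in> chart_dom i" "y \<in> chart_dom j" "G \<noteq> bot"
  shows "\<exists>h\<in>holonomy_pseudogroup U. (pt i x, pt j y) \<in> h \<and> eventually (\<lambda>k. (pt i (u k), pt j (v k)) \<in> h) G"
  using assms(1,3,5,7)
proof (induction arbitrary: y j rule: rtrancl_induct)
  case base
  have "x = y" by (rule limit_unique[OF assms(2) base(1) assms(8)])
  have "gen i j \<in> holonomy_pseudogroup U"
    using holonomy_pseudogroup.generator[OF assms(4) base(2)] by (simp add: gen_def)
  moreover have "eventually (\<lambda>k. (pt i (u k), pt j (u k)) \<in> gen i j) G"
    using foliated_chart_limitin_proj(2)[OF chart_U[OF assms(4)] assms(2,6)]
      foliated_chart_limitin_proj(2)[OF chart_U[OF base(2)] base(1,3)]
    by eventually_elim (auto simp: gen_def)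
  moreover have "(pt i x, pt j y) \<in> gen i j" using assms base \<open>x = y\<close> by (auto simp: gen_def)
  ultimately show ?case by blast
next
  case (step v w)
  obtain c z y' where c: "c \<in> U" "z \<in> chart_dom c" "y' \<in> chart_dom c" "limitin X v z G"
    "limitin X w y' G" "eventually (\<lambda>i. chart_proj c (v i) = chart_proj c (w i)) G"
    using step(2) unfolding parallel_def by blast
  have y': "y' = y" by (rule limit_unique[OF c(5) step.prems(1) assms(8)])
  have pz: "chart_proj c z = chart_proj c y"
    using limit_proj_eq[OF U_subset_F[OF c(1)] c(4,2,5,3,6) assms(8)] y' by simp
  obtain h where h: "h \<in> holonomy_pseudogroup U" "(pt i x, pt c z) \<in> h"
    "eventually (\<lambda>k. (pt i (u k), pt c (v k)) \<in> h) G"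
    using step.IH[OF c(4,1,2)] by blast
  have g: "gen c j \<in> holonomy_pseudogroup U"
    using holonomy_pseudogroup.generator[OF c(1) step.prems(2)] by (simp add: gen_def)
  have "h O gen c j \<in> holonomy_pseudogroup U" by (rule holonomy_pseudogroup.composition[OF h(1) g])
  moreover have "(pt c z, pt j y) \<in> gen c j" using pz c(3) y' step.prems(3) by (auto simp: gen_def)
  then have "(pt i x, pt j y) \<in> h O gen c j" using h(2) by blast
  moreover have "eventually (\<lambda>k. (pt i (u k), pt j (w k)) \<in> h O gen c j) G"
    using h(3) c(6) foliated_chart_limitin_proj(2)[OF chart_U[OF c(1)] c(5,3)]
      foliated_chart_limitin_proj(2)[OF chart_U[OF step.prems(2)] step.prems(1,3)]
  proof eventually_elim
    case (elim k)
    then have "(pt c (v k), pt j (w k)) \<in> gen c j" by (auto simp: gen_def)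
    then show ?case using elim(1) by blast
  qed
  ultimately show ?case by blast
qed

text \<open>The chain closes up at \<open>x\<close>, so its holonomy element fixes
  \<open>pt j x\<close> and, the group being trivial, is the identity nearby. Hence \<open>u\<close>
  and \<open>v\<close> eventually share plaques of \<open>j\<close>.\<close>

lemma parallel_loop_without_holonomy:
  assumes uv: "(u, v) \<in> (parallel G)\<^sup>*" and u: "limitin X u x G" and v: "limitin X v x G"
    and L: "without_holonomy U L" "x \<in> L" and G: "G \<noteq> bot"
  shows "eventually (\<lambda>k. (u k, v k) \<in> E) G"
proof -
  obtain j where j: "j \<in> U" "x \<in> chart_dom j" using cover_U[OF limitin_topspace[OF u]] by blast
  let ?p = "pt j x"
  obtain h where h: "h \<in> holonomy_pseudogroup U" "(?p, ?p) \<in> h"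
    "eventually (\<lambda>k. (pt j (u k), pt j (v k)) \<in> h) G"
    using parallel_rtrancl_holonomy[OF uv u v j(1,1,2,2) G] by blast
  have "holonomy_group U ?p = {germ_at T ?p (Id_on (topspace T))}"
    using L j unfolding without_holonomy_def by blast
  then have "germ_at T ?p h = germ_at T ?p (Id_on (topspace T))"
    using h(1,2) unfolding holonomy_group_def by blast
  moreover have "h \<in> germ_at T ?p h"
    using pt_in_T[OF j] unfolding germ_at_def by blast
  ultimately have "h \<in> germ_at T ?p (Id_on (topspace T))" by simp
  then obtain W where W: "openin T W" "?p \<in> W" "h \<inter> (W \<times> UNIV) = Id_on (topspace T) \<inter> (W \<times> UNIV)"
    unfolding germ_at_def by blast
  have "eventually (\<lambda>k. u k \<in> {y \<in> chart_dom j. pt j y \<in> W}) G"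
    by (rule limitinD[OF u openin_T_vimage[OF j(1) W(1)]]) (use j W in auto)
  then show ?thesis
    using h(3) foliated_chart_limitin_proj(2)[OF chart_U[OF j(1)] v j(2)]
  proof eventually_elim
    case (elim k)
    then have "(pt j (u k), pt j (v k)) \<in> Id_on (topspace T) \<inter> (W \<times> UNIV)" using W(3) by blast
    then show ?case using elim j(1) unfolding E_def by auto
  qed
qed

section \<open>Coarse correspondences\<close>

text \<open>One constant serves as multiplicative and as additive error. For \<open>r = 0\<close> it
  says that all partners of a point are within \<open>m\<close> of each other.\<close>

definition corr :: "nat \<Rightarrow> 'a set \<Rightarrow> 'a set \<Rightarrow> ('a \<times> 'a) set \<Rightarrow> bool" where
  "corr m L L' R \<longleftrightarrow> R \<subseteq> L \<times> L' \<and> (\<forall>a\<in>L. \<exists>b. (a, b) \<in> R) \<and> (\<forall>b\<in>L'. \<exists>a. (a, b) \<in> R) \<and>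
    (\<forall>a b a' b' r. (a, b) \<in> R \<longrightarrow> (a', b') \<in> R \<longrightarrow>
      ((a, a') \<in> E ^^ r \<longrightarrow> (b, b') \<in> E ^^ (m * r + m)) \<and>
      ((b, b') \<in> E ^^ r \<longrightarrow> (a, a') \<in> E ^^ (m * r + m)))"

lemma corrI:
  assumes "R \<subseteq> L \<times> L'" "\<And>a. a \<in> L \<Longrightarrow> \<exists>b. (a, b) \<in> R" "\<And>b. b \<in> L' \<Longrightarrow> \<exists>a. (a, b) \<in> R"
    "\<And>a b a' b' r. (a, b) \<in> R \<Longrightarrow> (a', b') \<in> R \<Longrightarrow> (a, a') \<in> E ^^ r \<Longrightarrow> (b, b') \<in> E ^^ (m * r + m)"
    "\<And>a b a' b' r. (a, b) \<in> R \<Longrightarrow> (a', b') \<in> R \<Longrightarrow> (b, b') \<in> E ^^ r \<Longrightarrow> (a, a') \<in> E ^^ (m * r + m)"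
  shows "corr m L L' R"
  unfolding corr_def using assms by (intro conjI allI impI ballI)

lemma corrD:
  assumes "corr m L L' R"
  shows "R \<subseteq> L \<times> L'" "\<And>a. a \<in> L \<Longrightarrow> \<exists>b. (a, b) \<in> R" "\<And>b. b \<in> L' \<Longrightarrow> \<exists>a. (a, b) \<in> R"
    "\<And>a b a' b' r. (a, b) \<in> R \<Longrightarrow> (a', b') \<in> R \<Longrightarrow> (a, a') \<in> E ^^ r \<Longrightarrow> (b, b') \<in> E ^^ (m * r + m)"
    "\<And>a b a' b' r. (a, b) \<in> R \<Longrightarrow> (a', b') \<in> R \<Longrightarrow> (b, b') \<in> E ^^ r \<Longrightarrow> (a, a') \<in> E ^^ (m * r + m)"
proof -
  note c = assms[unfolded corr_def]
  show "R \<subseteq> L \<times> L'" using c by (elim conjE)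
  show "\<And>a. a \<in> L \<Longrightarrow> \<exists>b. (a, b) \<in> R" using c by (elim conjE) (erule bspec)
  show "\<And>b. b \<in> L' \<Longrightarrow> \<exists>a. (a, b) \<in> R" using c by (elim conjE) (erule bspec)
  from c have "\<forall>a b a' b' r. (a, b) \<in> R \<longrightarrow> (a', b') \<in> R \<longrightarrow>
      ((a, a') \<in> E ^^ r \<longrightarrow> (b, b') \<in> E ^^ (m * r + m)) \<and>
      ((b, b') \<in> E ^^ r \<longrightarrow> (a, a') \<in> E ^^ (m * r + m))" by (elim conjE)
  then show "\<And>a b a' b' r. (a, b) \<in> R \<Longrightarrow> (a', b') \<in> R \<Longrightarrow> (a, a') \<in> E ^^ r \<Longrightarrow> (b, b') \<in> E ^^ (m * r + m)"
    "\<And>a b a' b' r. (a, b) \<in> R \<Longrightarrow> (a', b') \<in> R \<Longrightarrow> (b, b') \<in> E ^^ r \<Longrightarrow> (a, a') \<in> E ^^ (m * r + m)"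
    by simp_all
qed

lemma corr_mono:
  assumes R: "corr m L L' R" and "m \<le> k" and L: "L \<subseteq> topspace X" "L' \<subseteq> topspace X"
  shows "corr k L L' R"
proof (rule corrI)
  have le: "m * r + m \<le> k * r + k" for r using \<open>m \<le> k\<close> by (simp add: add_mono)
  fix a b a' b' r assume ab: "(a, b) \<in> R" "(a', b') \<in> R"
  then have t: "a \<in> topspace X" "b \<in> topspace X" using corrD(1)[OF R] L by auto
  show "(a, a') \<in> E ^^ r \<Longrightarrow> (b, b') \<in> E ^^ (k * r + k)"
    by (rule relpow_E_mono[OF corrD(4)[OF R ab] t(2) le])
  show "(b, b') \<in> E ^^ r \<Longrightarrow> (a, a') \<in> E ^^ (k * r + k)"
    by (rule relpow_E_mono[OF corrD(5)[OF R ab] t(1) le])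
qed (use corrD(1-3)[OF R] in auto)

lemma corr_converse: "corr m L L' R \<Longrightarrow> corr m L' L (R\<inverse>)"
  by (rule corrI) (use corrD[of m L L' R] in auto)

lemma corr_comp:
  assumes R: "corr m L L' R" and S: "corr k L' L'' S" and L: "L \<subseteq> topspace X" "L'' \<subseteq> topspace X"
  shows "corr (m * k + m + k) L L'' (R O S)"
proof (rule corrI)
  have le: "k * (m * r + m) + k \<le> (m * k + m + k) * r + (m * k + m + k)"
    "m * (k * r + k) + m \<le> (m * k + m + k) * r + (m * k + m + k)" for r
    by (simp_all add: algebra_simps)
  show "R O S \<subseteq> L \<times> L''" using corrD(1)[OF R] corrD(1)[OF S] by blast
  show "\<exists>b. (a, b) \<in> R O S" if "a \<in> L" for a
  proof -
    obtain b where b: "(a, b) \<in> R" using corrD(2)[OF R \<open>a \<in> L\<close>] ..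
    then have "b \<in> L'" using corrD(1)[OF R] by blast
    then show ?thesis using corrD(2)[OF S] b by blast
  qed
  show "\<exists>a. (a, b) \<in> R O S" if "b \<in> L''" for b
  proof -
    obtain a where a: "(a, b) \<in> S" using corrD(3)[OF S \<open>b \<in> L''\<close>] ..
    then have "a \<in> L'" using corrD(1)[OF S] by blast
    then show ?thesis using corrD(3)[OF R] a by blast
  qed
  fix a c a' c' r assume "(a, c) \<in> R O S" "(a', c') \<in> R O S"
  then obtain b b' where b: "(a, b) \<in> R" "(b, c) \<in> S" "(a', b') \<in> R" "(b', c') \<in> S" by blast
  have t: "a \<in> topspace X" "c \<in> topspace X" using b corrD(1)[OF R] corrD(1)[OF S] L by auto
  show "(c, c') \<in> E ^^ ((m * k + m + k) * r + (m * k + m + k))" if "(a, a') \<in> E ^^ r"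
    by (rule relpow_E_mono[OF _ t(2) le(1)]) (intro corrD(4)[OF S b(2,4)] corrD(4)[OF R b(1,3)] that)
  show "(a, a') \<in> E ^^ ((m * k + m + k) * r + (m * k + m + k))" if "(c, c') \<in> E ^^ r"
    by (rule relpow_E_mono[OF _ t(1) le(2)]) (intro corrD(5)[OF S b(2,4)] corrD(5)[OF R b(1,3)] that)
qed

section \<open>Comparison with coarse quasi-isometries\<close>

abbreviation d :: "'a \<Rightarrow> 'a \<Rightarrow> real" where
  "d \<equiv> plaque_dist F U"

lemma leaves_cases:
  assumes "L \<in> leaves F" "x \<in> L"
  shows "x \<in> topspace X" "L = leaf x"
proof -
  obtain y where y: "y \<in> topspace X" "L = leaf y" using assms by (auto simp: leaves_eq)
  then show "x \<in> topspace X" using assms rtrancl_E_in by blast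
  show "L = leaf x" using y assms leaf_sym by blast
qed

lemma leaves_subset: "L \<in> leaves F \<Longrightarrow> L \<subseteq> topspace X"
  using leaves_cases(1) by blast

lemma leaves_ne: "L \<in> leaves F \<Longrightarrow> \<exists>x. x \<in> L"
  by (auto simp: leaves_eq)

lemma leaves_rtrancl: "L \<in> leaves F \<Longrightarrow> x \<in> L \<Longrightarrow> y \<in> L \<Longrightarrow> (x, y) \<in> E\<^sup>*"
  using leaves_cases(2)[of L x] by blast

lemma d_le_iff: "L \<in> leaves F \<Longrightarrow> x \<in> L \<Longrightarrow> y \<in> L \<Longrightarrow> d x y \<le> real k \<longleftrightarrow> (x, y) \<in> E ^^ k"
  by (intro plaque_dist_le_iff leaves_rtrancl leaves_cases(1))

lemma d_nat:
  assumes "L \<in> leaves F" "x \<in> L" "y \<in> L"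
  obtains k where "d x y = real k" "(x, y) \<in> E ^^ k" "x \<noteq> y \<Longrightarrow> k > 0"
proof -
  obtain k where k: "d x y = real k"
    using plaque_dist_eq[OF leaves_rtrancl[OF assms] leaves_cases(1)[OF assms(1,2)]] by blast
  moreover have xy: "(x, y) \<in> E ^^ k" using d_le_iff[OF assms, of k] k by simp
  moreover have "k > 0" if "x \<noteq> y" using xy that by (cases k) auto
  ultimately show ?thesis by (rule that)
qed

text \<open>The bijection of nets is thickened by the net constant: \<open>a\<close> and
  \<open>b\<close> are related if some \<open>s\<close> is within \<open>N\<close> of
  \<open>a\<close> and \<open>f s\<close> within \<open>N\<close> of \<open>b\<close>. Rounding
  \<open>K\<close> and \<open>C\<close> up to \<open>N\<close> and \<open>M\<close> turns distances
  into chain lengths.\<close>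

lemma cqi_imp_corr:
  assumes L: "L \<in> leaves F" "L' \<in> leaves F" and f: "coarse_quasi_isometry K C L d L' d A A' f"
  shows "\<exists>m R. corr m L L' R"
proof -
  define N where "N = nat \<lceil>K\<rceil>"
  define M where "M = nat \<lceil>C\<rceil>"
  have KC: "0 \<le> K" "1 \<le> C" "K \<le> real N" "C \<le> real M"
    and nA: "A \<subseteq> L" "\<And>x. x \<in> L \<Longrightarrow> \<exists>a\<in>A. d x a \<le> K"
    and nA': "A' \<subseteq> L'" "\<And>x. x \<in> L' \<Longrightarrow> \<exists>a\<in>A'. d x a \<le> K"
    and bij: "bij_betw f A A'"
    and Lip: "\<And>x y. x \<in> A \<Longrightarrow> y \<in> A \<Longrightarrow> (1 / C) * d x y \<le> d (f x) (f y) \<and> d (f x) (f y) \<le> C * d x y"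
    using f unfolding coarse_quasi_isometry_def is_net_def N_def M_def by (auto simp: real_nat_ceiling_ge)
  have fA: "f s \<in> L'" if "s \<in> A" for s using bij nA'(1) that by (auto simp: bij_betw_def)
  have net: "\<exists>s\<in>A. (x, s) \<in> E ^^ N" if x: "x \<in> L" for x
  proof -
    obtain s where s: "s \<in> A" "d x s \<le> K" using nA(2)[OF x] by blast
    then have "d x s \<le> real N" using KC by linarith
    then show ?thesis using d_le_iff[OF L(1) x] s nA(1) by blast
  qed
  have net': "\<exists>s\<in>A. (x, f s) \<in> E ^^ N" if x: "x \<in> L'" for x
  proof -
    obtain t where t: "t \<in> A'" "d x t \<le> K" using nA'(2)[OF x] by blast
    then obtain s where s: "s \<in> A" "t = f s" using bij by (auto simp: bij_betw_def)
    have "d x t \<le> real N" using t KC by linarith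
    then show ?thesis using d_le_iff[OF L(2) x] s t nA'(1) by blast
  qed
  have fw: "(f s, f t) \<in> E ^^ (M * k)" if st: "s \<in> A" "t \<in> A" "(s, t) \<in> E ^^ k" for s t k
  proof -
    have "d s t \<le> real k" using d_le_iff[OF L(1)] st nA(1) by blast
    then have "C * d s t \<le> real M * real k" 
      using KC by (intro mult_mono) (auto simp: plaque_dist_def)
    then have "d (f s) (f t) \<le> real (M * k)" using Lip[OF st(1,2)] by simp
    then show ?thesis using d_le_iff[OF L(2) fA[OF st(1)] fA[OF st(2)]] by blast
  qed
  have bw: "(s, t) \<in> E ^^ (M * k)" if st: "s \<in> A" "t \<in> A" "(f s, f t) \<in> E ^^ k" for s t k
  proof -
    have "d (f s) (f t) \<le> real k" using d_le_iff[OF L(2) fA[OF st(1)] fA[OF st(2)]] st by blast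
    then have "C * d (f s) (f t) \<le> real M * real k"
      using KC by (intro mult_mono) (auto simp: plaque_dist_def)
    moreover have "d s t \<le> C * d (f s) (f t)" using Lip[OF st(1,2)] KC by (simp add: field_simps)
    ultimately have "d s t \<le> real (M * k)" by simp
    then show ?thesis using d_le_iff[OF L(1)] st nA(1) by blast
  qed
  define R where "R = {(a, b). a \<in> L \<and> b \<in> L' \<and> (\<exists>s\<in>A. (a, s) \<in> E ^^ N \<and> (b, f s) \<in> E ^^ N)}"
  \<comment> \<open>A detour through the nets takes \<open>N + M * (N + r + N) + N\<close> steps;
    \<open>m\<close> dominates the coefficient of \<open>r\<close> and the constant part.\<close>
  define m where "m = N + M * (N + N) + N + M"
  have le: "N + M * (N + r + N) + N \<le> m * r + m" for r
    by (simp add: m_def algebra_simps)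
  have "corr m L L' R"
  proof (rule corrI)
    show "R \<subseteq> L \<times> L'" by (auto simp: R_def)
    have refl: "(x, x) \<in> E ^^ N" if "x \<in> topspace X" for x
      by (rule relpow_E_mono[of x x 0]) (use that in auto)
    show "\<exists>b. (a, b) \<in> R" if a: "a \<in> L" for a
    proof -
      obtain s where s: "s \<in> A" "(a, s) \<in> E ^^ N" using net[OF a] by blast
      have "(f s, f s) \<in> E ^^ N" using refl fA[OF s(1)] leaves_subset[OF L(2)] by blast
      then show ?thesis using a s fA unfolding R_def by blast
    qed
    show "\<exists>a. (a, b) \<in> R" if b: "b \<in> L'" for b
    proof -
      obtain s where s: "s \<in> A" "(b, f s) \<in> E ^^ N" using net'[OF b] by blast
      have "(s, s) \<in> E ^^ N" using refl s(1) nA(1) leaves_subset[OF L(1)] by blast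
      then show ?thesis using b s nA(1) unfolding R_def by blast
    qed
    fix a b a' b' r assume ab: "(a, b) \<in> R" "(a', b') \<in> R"
    then obtain s s' where s: "s \<in> A" "(a, s) \<in> E ^^ N" "(b, f s) \<in> E ^^ N"
      and s': "s' \<in> A" "(a', s') \<in> E ^^ N" "(b', f s') \<in> E ^^ N"
      unfolding R_def by blast
    have t: "a \<in> topspace X" "b \<in> topspace X"
      using ab leaves_subset[OF L(1)] leaves_subset[OF L(2)] unfolding R_def by auto
    show "(b, b') \<in> E ^^ (m * r + m)" if "(a, a') \<in> E ^^ r"
    proof -
      have "(s, s') \<in> E ^^ (N + r + N)"
        by (intro relpow_E_trans[OF relpow_E_trans[OF relpow_E_sym[OF s(2)] that] s'(2)])
      then have "(f s, f s') \<in> E ^^ (M * (N + r + N))" by (rule fw[OF s(1) s'(1)])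
      then have "(b, b') \<in> E ^^ (N + M * (N + r + N) + N)"
        by (intro relpow_E_trans[OF relpow_E_trans[OF s(3)] relpow_E_sym[OF s'(3)]])
      then show ?thesis by (rule relpow_E_mono[OF _ t(2) le])
    qed
    show "(a, a') \<in> E ^^ (m * r + m)" if "(b, b') \<in> E ^^ r"
    proof -
      have "(f s, f s') \<in> E ^^ (N + r + N)"
        by (intro relpow_E_trans[OF relpow_E_trans[OF relpow_E_sym[OF s(3)] that] s'(3)])
      then have "(s, s') \<in> E ^^ (M * (N + r + N))" by (rule bw[OF s(1) s'(1)])
      then have "(a, a') \<in> E ^^ (N + M * (N + r + N) + N)"
        by (intro relpow_E_trans[OF relpow_E_trans[OF s(2)] relpow_E_sym[OF s'(2)]])
      then show ?thesis by (rule relpow_E_mono[OF _ t(1) le])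
    qed
  qed
  then show ?thesis by blast
qed

text \<open>Zorn's lemma: a point far from every member of a maximal separated set could be added to
  it.\<close>

lemma maximal_separated:
  obtains S where "S \<subseteq> L" "\<And>s t. s \<in> S \<Longrightarrow> t \<in> S \<Longrightarrow> (s, t) \<in> E ^^ m \<Longrightarrow> s = t"
    "\<And>x. x \<in> L \<Longrightarrow> L \<subseteq> topspace X \<Longrightarrow> \<exists>s\<in>S. (x, s) \<in> E ^^ m"
proof -
  define P where "P = {S. S \<subseteq> L \<and> (\<forall>s\<in>S. \<forall>t\<in>S. (s, t) \<in> E ^^ m \<longrightarrow> s = t)}"
  have "\<exists>S\<in>P. \<forall>S'\<in>P. S \<subseteq> S' \<longrightarrow> S' = S"
  proof (rule Zorn_Lemma, intro ballI)
    fix C assume C: "C \<in> chains P"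
    then have CP: "C \<subseteq> P" and lin: "\<And>A B. A \<in> C \<Longrightarrow> B \<in> C \<Longrightarrow> A \<subseteq> B \<or> B \<subseteq> A"
      unfolding chains_def chain_subset_def by auto
    have "s = t" if st: "A \<in> C" "B \<in> C" "s \<in> A" "t \<in> B" "(s, t) \<in> E ^^ m" for A B s t
    proof -
      obtain D where "D \<in> C" "s \<in> D" "t \<in> D" using lin[OF st(1,2)] st by blast
      then show ?thesis using CP st(5) unfolding P_def by blast
    qed
    moreover have "\<Union>C \<subseteq> L" using CP unfolding P_def by blast
    ultimately show "\<Union>C \<in> P" unfolding P_def by blast
  qed
  then obtain S where S: "S \<in> P" "\<And>S'. S' \<in> P \<Longrightarrow> S \<subseteq> S' \<Longrightarrow> S' = S" by blast
  have "\<exists>s\<in>S. (x, s) \<in> E ^^ m" if x: "x \<in> L" "L \<subseteq> topspace X" for x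
  proof (rule ccontr)
    assume no: "\<not> ?thesis"
    have "insert x S \<in> P"
      unfolding P_def
    proof (intro CollectI conjI ballI impI)
      show "insert x S \<subseteq> L" using S(1) x unfolding P_def by blast
      fix s t assume st: "s \<in> insert x S" "t \<in> insert x S" "(s, t) \<in> E ^^ m"
      show "s = t"
      proof (cases "s = x \<or> t = x")
        case True
        then show ?thesis using st no relpow_E_sym[OF st(3)] by blast
      next
        case False
        then show ?thesis using st S(1) unfolding P_def by blast
      qed
    qed
    then have "x \<in> S" using S(2)[of "insert x S"] by blast
    moreover have "(x, x) \<in> E ^^ m" by (rule relpow_E_mono[of x x 0]) (use x in auto)
    ultimately show False using no by blast
  qed
  then show ?thesis using that[of S] S(1) unfolding P_def by blast
qed

text \<open>A separated net makes the choice of partners injective. The additive error is absorbed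
  because distinct points have distance at least 1, so \<open>m * k + m \<le> 2 * m * k\<close>. The
  image is a net: if a partner of \<open>y\<close> is within \<open>m\<close> of \<open>s\<close>,
  then \<open>y\<close> is within \<open>m * m + m\<close> of \<open>g s\<close>.\<close>

lemma corr_imp_cqi:
  assumes L: "L \<in> leaves F" "L' \<in> leaves F" and R: "corr m L L' R" and m: "m \<ge> 1"
  shows "\<exists>A A' f. coarse_quasi_isometry (real (m * m + m)) (real (2 * m)) L d L' d A A' f"
proof -
  obtain S where S: "S \<subseteq> L" "\<And>s t. s \<in> S \<Longrightarrow> t \<in> S \<Longrightarrow> (s, t) \<in> E ^^ m \<Longrightarrow> s = t"
    "\<And>x. x \<in> L \<Longrightarrow> \<exists>s\<in>S. (x, s) \<in> E ^^ m"
    using maximal_separated[of L m] leaves_subset[OF L(1)] by metis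
  have "\<forall>s\<in>S. \<exists>b. (s, b) \<in> R" using corrD(2)[OF R] S(1) by blast
  from bchoice[OF this] obtain g where g: "\<And>s. s \<in> S \<Longrightarrow> (s, g s) \<in> R" by blast
  have gL: "g s \<in> L'" if "s \<in> S" for s using g[OF that] corrD(1)[OF R] by blast
  have inj: "inj_on g S"
  proof (rule inj_onI)
    fix s t assume st: "s \<in> S" "t \<in> S" "g s = g t"
    \<comment> \<open>Equal images put \<open>s\<close> and \<open>t\<close> within
      \<open>m * 0 + m\<close> of each other, which separation allows only for equal points.\<close>
    then have "(g s, g t) \<in> E ^^ 0" by simp
    from corrD(5)[OF R g[OF st(1)] g[OF st(2)] this] show "s = t" using S(2) st by simp
  qed
  have Lip: "d (g s) (g t) \<le> real (2 * m) * d s t" "d s t \<le> real (2 * m) * d (g s) (g t)"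
    if st: "s \<in> S" "t \<in> S" for s t
  proof -
    have stL: "s \<in> L" "t \<in> L" using st S(1) by auto
    obtain k where k: "d s t = real k" "(s, t) \<in> E ^^ k" "s \<noteq> t \<Longrightarrow> k > 0" by (rule d_nat[OF L(1) stL]) blast
    obtain j where j: "d (g s) (g t) = real j" "(g s, g t) \<in> E ^^ j" "g s \<noteq> g t \<Longrightarrow> j > 0"
      by (rule d_nat[OF L(2) gL[OF st(1)] gL[OF st(2)]]) blast
    show "d (g s) (g t) \<le> real (2 * m) * d s t"
    proof (cases "s = t")
      case False
      have "d (g s) (g t) \<le> real (m * k + m)"
        using corrD(4)[OF R g[OF st(1)] g[OF st(2)] k(2)] d_le_iff[OF L(2) gL[OF st(1)] gL[OF st(2)]] by blast
      also have "m * k + m \<le> 2 * m * k" using k(3)[OF False] by (cases k) auto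
      finally show ?thesis using k(1) by simp
    qed (simp add: plaque_dist_def)
    show "d s t \<le> real (2 * m) * d (g s) (g t)"
    proof (cases "s = t")
      case False
      then have "g s \<noteq> g t" using inj st by (auto dest: inj_onD)
      have "d s t \<le> real (m * j + m)"
        using corrD(5)[OF R g[OF st(1)] g[OF st(2)] j(2)] d_le_iff[OF L(1) stL] by blast
      also have "m * j + m \<le> 2 * m * j" using j(3)[OF \<open>g s \<noteq> g t\<close>] by (cases j) auto
      finally show ?thesis using j(1) by simp
    qed (simp add: plaque_dist_def)
  qed
  have net: "\<exists>s\<in>S. d x s \<le> real (m * m + m)" if x: "x \<in> L" for x
  proof -
    obtain s where s: "s \<in> S" "(x, s) \<in> E ^^ m" using S(3)[OF x] by blast
    then have "(x, s) \<in> E ^^ (m * m + m)"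
      using relpow_E_mono[of x s m "m * m + m"] x leaves_subset[OF L(1)] by auto
    then show ?thesis using d_le_iff[OF L(1) x] s S(1) by blast
  qed
  have net': "\<exists>t\<in>g ` S. d y t \<le> real (m * m + m)" if y: "y \<in> L'" for y
  proof -
    obtain x where x: "(x, y) \<in> R" using corrD(3)[OF R y] by blast
    then have "x \<in> L" using corrD(1)[OF R] by blast
    then obtain s where s: "s \<in> S" "(x, s) \<in> E ^^ m" using S(3) by blast
    have "(y, g s) \<in> E ^^ (m * m + m)" by (rule corrD(4)[OF R x g[OF s(1)] s(2)])
    then show ?thesis using d_le_iff[OF L(2) y gL[OF s(1)]] s by blast
  qed
  have "coarse_quasi_isometry (real (m * m + m)) (real (2 * m)) L d L' d S (g ` S) g"
    unfolding coarse_quasi_isometry_def is_net_def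
  proof (intro conjI ballI)
    show "bij_betw g S (g ` S)" using inj by (simp add: bij_betw_def)
    show "1 \<le> real (2 * m)" using m by simp
    fix s t assume st: "s \<in> S" "t \<in> S"
    show "1 / real (2 * m) * d s t \<le> d (g s) (g t)"
      using Lip(2)[OF st] m by (simp add: field_simps)
    show "d (g s) (g t) \<le> real (2 * m) * d s t" by (rule Lip(1)[OF st])
  qed (use S(1) gL net net' in auto)
  then show ?thesis by blast
qed

section \<open>Limits of correspondences\<close>

text \<open>The base point prevents escape: as \<open>y\<close> varies in this set, a partner of
  \<open>y\<close> stays within \<open>m\<close> of \<open>x\<close>. Otherwise the points could be
  matched with ever more remote parts of the leaf of \<open>x\<close>, leaving nothing in the
  limit.\<close>

definition near :: "'a \<Rightarrow> nat \<Rightarrow> 'a set" where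
  "near x m = {y \<in> topspace X. \<exists>R a. corr m (leaf x) (leaf y) R \<and> (x, a) \<in> E ^^ m \<and> (a, y) \<in> R}"

text \<open>The index set of the limit is \<open>X\<close> itself: the ultrafilter lives on
  \<open>near x m\<close> and converges to \<open>y\<close>, so the identity function is the moving
  base point. \<open>m'\<close> precedes \<open>x\<close> and \<open>y\<close>, as the uniform
  conclusion requires.\<close>

lemma corr_limit:
  "\<exists>m'. \<forall>x\<in>topspace X. \<forall>y. y \<in> X closure_of near x m \<longrightarrow> without_holonomy U (leaf y) \<longrightarrow>
    (\<exists>R. corr m' (leaf x) (leaf y) R)"
proof -
  obtain N where N: "\<And>(G :: 'a filter) u v x y k. ultrafilter G \<Longrightarrow> limitin X u x G \<Longrightarrow> limitin X v y G \<Longrightarrow>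
    eventually (\<lambda>i. (u i, v i) \<in> E ^^ k) G \<Longrightarrow> (u, v) \<in> parallel G ^^ (N * k + 1)"
    by (rule transport_relpow) blast
  \<comment> \<open>The upper estimate takes \<open>N * (m * (r + 2) + m) + 1\<close> steps and the
    lower one \<open>m * (r + 1) + m + 2\<close>; \<open>m'\<close> dominates coefficients and
    constants of both.\<close>
  define m' where "m' = 3 * N * m + 2 * m + 3"
  have "\<exists>R. corr m' (leaf x0) (leaf y) R"
    if x0: "x0 \<in> topspace X" and y: "y \<in> X closure_of near x0 m" and nh: "without_holonomy U (leaf y)" for x0 y
  proof -
    have yX: "y \<in> topspace X" using y by (simp add: in_closure_of)
    define G0 where "G0 = inf (nhdsin X y) (principal (near x0 m))"
    have "G0 \<noteq> bot"
    proof
      assume "G0 = bot"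
      then have "eventually (\<lambda>x. x \<notin> near x0 m) (nhdsin X y)"
        by (simp add: G0_def trivial_limit_def eventually_inf_principal)
      then obtain V where "openin X V" "y \<in> V" "\<forall>x\<in>V. x \<notin> near x0 m"
        using yX unfolding eventually_nhdsin by blast
      then show False using y unfolding in_closure_of by blast
    qed
    then obtain G where G: "ultrafilter G" "G \<le> G0" by (rule ultrafilter_below)
    have Gb: "G \<noteq> bot" using G by (simp add: ultrafilter_def)
    have "eventually (\<lambda>x. x \<in> near x0 m) G0"
      by (simp add: G0_def eventually_inf_principal)
    then have ev_near: "eventually (\<lambda>\<eta>. \<eta> \<in> near x0 m) G" using G(2) by (rule filter_leD[rotated])
    have id: "limitin X (\<lambda>\<eta>. \<eta>) y G"
      unfolding limitin_def
    proof (intro conjI yX allI impI)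
      fix V assume "openin X V \<and> y \<in> V"
      then have "eventually (\<lambda>x. x \<in> V) (nhdsin X y)" using yX by (auto simp: eventually_nhdsin)
      then have "eventually (\<lambda>x. x \<in> V) G0"
        unfolding G0_def by (rule filter_leD[rotated]) simp
      then show "eventually (\<lambda>x. x \<in> V) G" using G(2) by (rule filter_leD[rotated])
    qed
    have "\<forall>\<eta>\<in>near x0 m. \<exists>p. corr m (leaf x0) (leaf \<eta>) (fst p) \<and> (x0, snd p) \<in> E ^^ m \<and> (snd p, \<eta>) \<in> fst p"
      unfolding near_def by auto
    from bchoice[OF this] obtain f where f: "\<forall>\<eta>\<in>near x0 m. corr m (leaf x0) (leaf \<eta>) (fst (f \<eta>)) \<and>
      (x0, snd (f \<eta>)) \<in> E ^^ m \<and> (snd (f \<eta>), \<eta>) \<in> fst (f \<eta>)" ..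
    define R where "R = (\<lambda>\<eta>. fst (f \<eta>))"
    define \<alpha> where "\<alpha> = (\<lambda>\<eta>. snd (f \<eta>))"
    have R: "corr m (leaf x0) (leaf \<eta>) (R \<eta>)" "(x0, \<alpha> \<eta>) \<in> E ^^ m" "(\<alpha> \<eta>, \<eta>) \<in> R \<eta>" "\<eta> \<in> topspace X"
      if "\<eta> \<in> near x0 m" for \<eta>
      using f that unfolding R_def \<alpha>_def near_def by auto
    \<comment> \<open>One plaque of slack: partners of \<open>u \<eta>\<close> vary with
      \<open>\<eta>\<close>, and the ultrafilter can fix only one of finitely many plaques
      containing them, not a point.\<close>
    define track where "track = (\<lambda>a u. eventually (\<lambda>\<eta>. \<exists>a'. (a, a') \<in> E \<and> (a', u \<eta>) \<in> R \<eta>) G)"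
    \<comment> \<open>The partner \<open>\<alpha> \<eta>\<close> of \<open>\<eta>\<close> is within
      \<open>m\<close> of \<open>x0\<close>, so \<open>u \<eta>\<close> stays at bounded distance
      from \<open>\<eta>\<close>; this keeps its limit on the leaf of \<open>y\<close>.\<close>
    have bounded: "\<exists>k. eventually (\<lambda>\<eta>. (\<eta>, u \<eta>) \<in> E ^^ k) G" if a: "a \<in> leaf x0" "track a u" for a u
    proof -
      obtain q where q: "(x0, a) \<in> E ^^ q" using a(1) by (auto simp: rtrancl_power)
      have "eventually (\<lambda>\<eta>. (\<eta>, u \<eta>) \<in> E ^^ (m * (m + (q + 1)) + m)) G"
        using a(2)[unfolded track_def] ev_near
      proof eventually_elim
        case (elim \<eta>)
        then obtain a' where a': "(a, a') \<in> E" "(a', u \<eta>) \<in> R \<eta>" by blast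
        have "(x0, a') \<in> E ^^ (q + 1)" using q a'(1) by auto
        then have "(\<alpha> \<eta>, a') \<in> E ^^ (m + (q + 1))"
          by (rule relpow_E_trans[OF relpow_E_sym[OF R(2)[OF elim(2)]]])
        then show ?case by (rule corrD(4)[OF R(1)[OF elim(2)] R(3)[OF elim(2)] a'(2)])
      qed
      then show ?thesis by blast
    qed
    have near_top: "eventually (\<lambda>\<eta>. \<eta> \<in> topspace X) G"
      using ev_near by eventually_elim (rule R(4))
    have track_parallel: "((\<lambda>\<eta>. \<eta>), u) \<in> (parallel G)\<^sup>*" "b \<in> leaf y"
      if a: "a \<in> leaf x0" "track a u" and u: "limitin X u b G" for a u b
    proof -
      obtain k where k: "eventually (\<lambda>\<eta>. (\<eta>, u \<eta>) \<in> E ^^ k) G" using bounded[OF a] by blast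
      have parallel: "((\<lambda>\<eta>. \<eta>), u) \<in> parallel G ^^ (N * k + 1)" by (rule N[OF G(1) id u k])
      then show "((\<lambda>\<eta>. \<eta>), u) \<in> (parallel G)\<^sup>*" by (rule relpow_imp_rtrancl)
      have "(y, b) \<in> E ^^ (N * k + 1)" by (rule parallel_relpow_limit[OF parallel id u Gb])
      then show "b \<in> leaf y" using relpow_imp_rtrancl by blast
    qed
    define R' where "R' = {(a, b). a \<in> leaf x0 \<and> b \<in> leaf y \<and> (\<exists>u. limitin X u b G \<and> track a u)}"
    have "corr m' (leaf x0) (leaf y) R'"
    proof (rule corrI)
      show "R' \<subseteq> leaf x0 \<times> leaf y" by (auto simp: R'_def)
    next
      fix a assume a: "a \<in> leaf x0"
      define u where "u = (\<lambda>\<eta>. SOME b. (a, b) \<in> R \<eta>)"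
      have aX: "a \<in> topspace X" using a x0 rtrancl_E_in by blast
      have "track a u"
        unfolding track_def using ev_near
      proof eventually_elim
        case (elim \<eta>)
        have "(a, u \<eta>) \<in> R \<eta>" unfolding u_def by (rule someI_ex[OF corrD(2)[OF R(1)[OF elim] a]])
        then show ?case using E_refl[OF aX] by blast
      qed
      moreover obtain k where k: "eventually (\<lambda>\<eta>. (\<eta>, u \<eta>) \<in> E ^^ k) G"
        using bounded[OF a \<open>track a u\<close>] by blast
      have "eventually (\<lambda>\<eta>. u \<eta> \<in> topspace X) G"
        using k near_top by eventually_elim (rule relpow_E_in)
      then obtain b where "limitin X u b G" by (rule compact_space_ultralimit[OF compact_X G(1)])
      ultimately show "\<exists>b. (a, b) \<in> R'"
        using a track_parallel(2)[OF a] unfolding R'_def by blast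
    next
      fix b assume b: "b \<in> leaf y"
      then obtain k where k: "(y, b) \<in> E ^^ k" by (auto simp: rtrancl_power)
      obtain w where w: "limitin X w b G" "eventually (\<lambda>\<eta>. (\<eta>, w \<eta>) \<in> E ^^ k) G"
        using lift_relpow[OF id k] by blast
      \<comment> \<open>A partner of \<open>w \<eta>\<close> is within \<open>m * k + m\<close> of
        \<open>\<alpha> \<eta>\<close>, which is within \<open>m\<close> of
        \<open>x0\<close>.\<close>
      define q where "q = m + (m * k + m)"
      obtain \<Q> where \<Q>: "finite \<Q>" "(E ^^ q) `` {x0} \<subseteq> \<Union>\<Q>" "\<forall>Q\<in>\<Q>. \<forall>a\<in>Q. \<forall>b\<in>Q. (a, b) \<in> E"
        using finite_plaques_ball[OF x0, of q] by (elim exE conjE)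
      have "eventually (\<lambda>\<eta>. \<exists>Q\<in>\<Q>. \<exists>a\<in>Q. (x0, a) \<in> E ^^ q \<and> (a, w \<eta>) \<in> R \<eta>) G"
        using w(2) ev_near
      proof eventually_elim
        case (elim \<eta>)
        have "w \<eta> \<in> leaf \<eta>" using elim(1) relpow_imp_rtrancl by blast
        then obtain a where a: "(a, w \<eta>) \<in> R \<eta>" using corrD(3)[OF R(1)[OF elim(2)]] by blast
        have "(\<alpha> \<eta>, a) \<in> E ^^ (m * k + m)"
          by (rule corrD(5)[OF R(1)[OF elim(2)] R(3)[OF elim(2)] a elim(1)])
        then have "(x0, a) \<in> E ^^ q" unfolding q_def by (rule relpow_E_trans[OF R(2)[OF elim(2)]])
        then show ?case using a \<Q>(2) by blast
      qed
      then obtain Q where Q: "Q \<in> \<Q>" "eventually (\<lambda>\<eta>. \<exists>a\<in>Q. (x0, a) \<in> E ^^ q \<and> (a, w \<eta>) \<in> R \<eta>) G"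
        by (rule ultrafilter_finite_split[OF G(1) \<Q>(1)])
      \<comment> \<open>Any member of \<open>Q\<close> represents it: the partners found eventually
        are all adjacent to \<open>a0\<close>, as \<open>track\<close> allows.\<close>
      then obtain a0 where a0: "a0 \<in> Q" "(x0, a0) \<in> E ^^ q"
        using eventually_happens'[OF Gb Q(2)] by blast
      have "track a0 w"
        unfolding track_def using Q(2) by eventually_elim (use \<Q>(3) Q(1) a0(1) in blast)
      moreover have "a0 \<in> leaf x0" using a0(2) relpow_imp_rtrancl by blast
      ultimately show "\<exists>a. (a, b) \<in> R'" using b w(1) unfolding R'_def by blast
    next
      fix a b a1 b1 r assume "(a, b) \<in> R'" "(a1, b1) \<in> R'"
      then obtain u u1 where a: "a \<in> leaf x0" "b \<in> leaf y" "limitin X u b G" "track a u"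
        and a1: "a1 \<in> leaf x0" "b1 \<in> leaf y" "limitin X u1 b1 G" "track a1 u1"
        unfolding R'_def by blast
      have aX: "a \<in> topspace X" and bX: "b \<in> topspace X" using a(1,2) x0 yX rtrancl_E_in by blast+
      {
        assume r: "(a, a1) \<in> E ^^ r"
        \<comment> \<open>The two extra steps in \<open>1 + r + 1\<close> are the slack of
          \<open>track\<close> at both ends.\<close>
        have "eventually (\<lambda>\<eta>. (u \<eta>, u1 \<eta>) \<in> E ^^ (m * (1 + r + 1) + m)) G"
          using a(4)[unfolded track_def] a1(4)[unfolded track_def] ev_near
        proof eventually_elim
          case (elim \<eta>)
          then obtain a' a1' where a': "(a, a') \<in> E ^^ 1" "(a', u \<eta>) \<in> R \<eta>"
            and a1': "(a1, a1') \<in> E ^^ 1" "(a1', u1 \<eta>) \<in> R \<eta>" by auto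
          have "(a', a1') \<in> E ^^ (1 + r + 1)"
            by (rule relpow_E_trans[OF relpow_E_trans[OF relpow_E_sym[OF a'(1)] r] a1'(1)])
          then show ?case by (rule corrD(4)[OF R(1)[OF elim(3)] a'(2) a1'(2)])
        qed
        from parallel_relpow_limit[OF N[OF G(1) a(3) a1(3) this] a(3) a1(3) Gb]
        have "(b, b1) \<in> E ^^ (N * (m * (1 + r + 1) + m) + 1)" .
        then show "(b, b1) \<in> E ^^ (m' * r + m')"
          by (rule relpow_E_mono[OF _ bX]) (simp add: m'_def algebra_simps)
      }
      {
        assume r: "(b, b1) \<in> E ^^ r"
        \<comment> \<open>The path from \<open>b\<close> to \<open>b1\<close> lifts to nearby leaves
          and ends at \<open>w\<close>. Both \<open>w\<close> and \<open>u1\<close> converge to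
          \<open>b1\<close>, and parallels running back through the identity function join them,
          that is, around a loop at \<open>b1\<close>. Trivial holonomy makes them adjacent, so
          \<open>u\<close> and \<open>u1\<close> are within \<open>r + 1\<close>.\<close>
        obtain w where w: "limitin X w b1 G" "(u, w) \<in> parallel G ^^ r" "eventually (\<lambda>\<eta>. (u \<eta>, w \<eta>) \<in> E ^^ r) G"
          using lift_relpow[OF a(3) r] by blast
        have "(u, w) \<in> (parallel G)\<^sup>*" using w(2) by (rule relpow_imp_rtrancl)
        then have "((\<lambda>\<eta>. \<eta>), w) \<in> (parallel G)\<^sup>*" by (rule rtrancl_trans[OF track_parallel(1)[OF a(1,4,3)]])
        then have "(w, (\<lambda>\<eta>. \<eta>)) \<in> (parallel G)\<^sup>*" using sym_rtrancl[OF sym_parallel] by (rule symD[rotated])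
        then have "(w, u1) \<in> (parallel G)\<^sup>*" using track_parallel(1)[OF a1(1,4,3)] by (rule rtrancl_trans)
        then have "eventually (\<lambda>\<eta>. (w \<eta>, u1 \<eta>) \<in> E) G"
          by (rule parallel_loop_without_holonomy[OF _ w(1) a1(3) nh a1(2) Gb])
        then have "eventually (\<lambda>\<eta>. (a, a1) \<in> E ^^ (1 + (m * (r + 1) + m) + 1)) G"
          using w(3) a(4)[unfolded track_def] a1(4)[unfolded track_def] ev_near
        proof eventually_elim
          case (elim \<eta>)
          then obtain a' a1' where a': "(a, a') \<in> E ^^ 1" "(a', u \<eta>) \<in> R \<eta>"
            and a1': "(a1, a1') \<in> E ^^ 1" "(a1', u1 \<eta>) \<in> R \<eta>" by auto
          have "(u \<eta>, u1 \<eta>) \<in> E ^^ (r + 1)" using elim(1,2) by auto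
          then have "(a', a1') \<in> E ^^ (m * (r + 1) + m)"
            by (rule corrD(5)[OF R(1)[OF elim(5)] a'(2) a1'(2)])
          then show ?case by (intro relpow_E_trans[OF relpow_E_trans[OF a'(1)] relpow_E_sym[OF a1'(1)]])
        qed
        \<comment> \<open>The bound no longer mentions \<open>\<eta>\<close>, so it holds as soon as
          it holds eventually along a proper filter.\<close>
        then have "(a, a1) \<in> E ^^ (1 + (m * (r + 1) + m) + 1)" using eventually_happens'[OF Gb] by blast
        then show "(a, a1) \<in> E ^^ (m' * r + m')"
          by (rule relpow_E_mono[OF _ aX]) (simp add: m'_def algebra_simps)
      }
    qed
    then show ?thesis by blast
  qed
  then show ?thesis by blast
qed

section \<open>The dichotomy for leaves\<close>

lemma dense_leaf_cases:
  assumes "L \<in> leaves_in F (dense_leaves_without_holonomy X F U)"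
  shows "L \<in> leaves F" "dense_in X L" "without_holonomy U L"
proof -
  show L: "L \<in> leaves F" using assms by (simp add: leaves_in_def)
  obtain x where x: "x \<in> L" using leaves_ne[OF L] by blast
  then have "x \<in> dense_leaves_without_holonomy X F U" using assms by (auto simp: leaves_in_def)
  then obtain L' where L': "L' \<in> leaves F" "dense_in X L'" "without_holonomy U L'" "x \<in> L'"
    unfolding dense_leaves_without_holonomy_def by blast
  \<comment> \<open>Leaves that share a point coincide, so a leaf inside the union is one of the
    leaves united.\<close>
  have "L = L'" using leaves_cases(2)[OF L x] leaves_cases(2)[OF L'(1,4)] by simp
  then show "dense_in X L" "without_holonomy U L" using L' by auto
qed

lemma somewhere_dense_imp_equi:
  assumes x0: "x0 \<in> topspace X" and nd: "\<not> nowhere_dense_in X (near x0 m)"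
  shows "equi_coarsely_quasi_isometric (leaves_in F (dense_leaves_without_holonomy X F U)) d"
proof -
  obtain m' where m': "\<And>y. y \<in> X closure_of near x0 m \<Longrightarrow> without_holonomy U (leaf y) \<Longrightarrow>
    \<exists>R. corr m' (leaf x0) (leaf y) R"
    using corr_limit[of m] x0 by blast
  have "near x0 m \<subseteq> topspace X" by (auto simp: near_def)
  then have V: "X interior_of (X closure_of near x0 m) \<noteq> {}" using nd by (simp add: nowhere_dense_in_def)
  have ex: "\<exists>R. corr m' (leaf x0) L R" if L: "L \<in> leaves_in F (dense_leaves_without_holonomy X F U)" for L
  proof -
    note L' = dense_leaf_cases[OF L]
    have "L \<inter> X interior_of (X closure_of near x0 m) \<noteq> {}"
      using L'(2) V dense_in_iff[OF leaves_subset[OF L'(1)]] openin_interior_of by metis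
    then obtain y where y: "y \<in> L" "y \<in> X closure_of near x0 m"
      using interior_of_subset[of X "X closure_of near x0 m"] by blast
    then show ?thesis using m'[OF y(2)] L'(3) leaves_cases(2)[OF L'(1) y(1)] by simp
  qed
  \<comment> \<open>The distortion of the composite through the leaf of \<open>x0\<close>; the
    successor ensures \<open>k \<ge> 1\<close>.\<close>
  define k where "k = Suc (m' * m' + m' + m')"
  have "\<exists>A A' f. coarse_quasi_isometry (real (k * k + k)) (real (2 * k)) L d L' d A A' f"
    if L: "L \<in> leaves_in F (dense_leaves_without_holonomy X F U)"
      "L' \<in> leaves_in F (dense_leaves_without_holonomy X F U)" for L L'
  proof -
    note l = dense_leaf_cases(1)[OF L(1)] dense_leaf_cases(1)[OF L(2)]
    obtain R R' where R: "corr m' (leaf x0) L R" "corr m' (leaf x0) L' R'" using ex L by blast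
    have "corr (m' * m' + m' + m') L L' (R\<inverse> O R')"
      by (rule corr_comp[OF corr_converse[OF R(1)] R(2) leaves_subset[OF l(1)] leaves_subset[OF l(2)]])
    then have "corr k L L' (R\<inverse> O R')"
      by (rule corr_mono[OF _ _ leaves_subset[OF l(1)] leaves_subset[OF l(2)]]) (simp add: k_def)
    then show ?thesis by (rule corr_imp_cqi[OF l]) (simp add: k_def)
  qed
  then show ?thesis
    unfolding equi_coarsely_quasi_isometric_def
    by (intro exI[of _ "real (k * k + k)"] exI[of _ "real (2 * k)"]) (auto simp: k_def)
qed

lemma cqi_leaves_subset_near:
  assumes x0: "x0 \<in> topspace X"
  shows "\<Union>{L' \<in> leaves F. cqi_leaves F U (leaf x0) L'} \<subseteq> (\<Union>m. near x0 m)"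
proof
  fix y assume "y \<in> \<Union>{L' \<in> leaves F. cqi_leaves F U (leaf x0) L'}"
  then obtain L' where L': "L' \<in> leaves F" "cqi_leaves F U (leaf x0) L'" "y \<in> L'" by blast
  have L: "leaf x0 \<in> leaves F" using x0 by (simp add: leaves_eq)
  obtain K C A A' f where "coarse_quasi_isometry K C (leaf x0) d L' d A A' f"
    using L'(2) unfolding cqi_leaves_def coarsely_quasi_isometric_def by blast
  then obtain m R where R: "corr m (leaf x0) L' R" using cqi_imp_corr[OF L L'(1)] by blast
  obtain a where a: "(a, y) \<in> R" using corrD(3)[OF R L'(3)] by blast
  then have "a \<in> leaf x0" using corrD(1)[OF R] by blast
  then obtain q where q: "(x0, a) \<in> E ^^ q" by (auto simp: rtrancl_power)
  \<comment> \<open>Distortion and distance to the base point share one index in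
    \<open>near\<close>.\<close>
  let ?k = "max m q"
  have "corr ?k (leaf x0) (leaf y) R"
    using corr_mono[OF R _ leaves_subset[OF L] leaves_subset[OF L'(1)], of ?k] leaves_cases(2)[OF L'(1,3)] by simp
  moreover have "(x0, a) \<in> E ^^ ?k" by (rule relpow_E_mono[OF q x0]) simp
  ultimately have "y \<in> near x0 ?k" using a leaves_cases(1)[OF L'(1,3)] unfolding near_def by blast
  then show "y \<in> (\<Union>m. near x0 m)" by blast
qed

lemma equi_or_meager:
  assumes "\<not> equi_coarsely_quasi_isometric (leaves_in F (dense_leaves_without_holonomy X F U)) d"
    and L: "L \<in> leaves F"
  shows "meagerly_many_leaves X F (\<lambda>L'. cqi_leaves F U L L')"
proof -
  obtain x0 where x0: "x0 \<in> topspace X" "L = leaf x0" using L by (auto simp: leaves_eq)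
  have "meager_in X (\<Union>m. near x0 m)"
    using somewhere_dense_imp_equi[OF x0(1)] assms(1)
    by (intro meager_in_UN nowhere_dense_imp_meager) auto
  then show ?thesis
    unfolding meagerly_many_leaves_def x0(2) using meager_in_subset cqi_leaves_subset_near[OF x0(1)] by blast
qed

end

theorem theorem1p2:
  fixes n :: nat
    and X :: "'a topology"
    and F U :: "('a, 'z) chart set"
  assumes "compact_Polish_foliated_space n X F"
    and "transitive_foliated_space X F"
    and "regular_foliated_atlas n X F U"
  defines "X0d \<equiv> dense_leaves_without_holonomy X F U"
  defines "all_equi_cqi \<equiv>
      equi_coarsely_quasi_isometric (leaves_in F X0d) (plaque_dist F U)"
    and "all_meager \<equiv>
      (\<forall>L \<in> leaves F. meagerly_many_leaves X F (\<lambda>L'. cqi_leaves F U L L'))"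
    and "uncountably_many_types \<equiv> uncountable (cqi_types F U (leaves_in F X0d))"
  shows "(all_equi_cqi \<or> (all_meager \<and> uncountably_many_types)) \<and> \<not> (all_equi_cqi \<and> all_meager)"
proof -
  interpret regular_foliation n X F U
    using assms(1,3) by unfold_locales
  have "topspace X \<noteq> {}"
    using assms(2) by (auto simp: transitive_foliated_space_def leaves_eq)
  \<comment> \<open>Otherwise \<open>X\<close>, covered by \<open>X0d\<close> and its meager
    complement, would be meager, against Baire's theorem.\<close>
  then have not_meager: "\<not> meager_in X X0d"
    using meager_complement_dense_leaves_without_holonomy[OF assms(2)] compact_Hausdorff_not_meager[OF compact_X Hausdorff_X]
      meager_in_Un[of X "topspace X - X0d" X0d] meager_in_subset[of X "topspace X - X0d \<union> X0d" "topspace X"]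
    unfolding X0d_def by blast
  have leaf_in: "\<exists>L\<in>leaves_in F X0d. x \<in> L" if "x \<in> X0d" for x
    using that unfolding X0d_def dense_leaves_without_holonomy_def leaves_in_def by blast
  have "all_meager" if "\<not> all_equi_cqi"
    using equi_or_meager that unfolding all_meager_def all_equi_cqi_def X0d_def by blast
  \<comment> \<open>Countably many types would make \<open>X0d\<close> a countable union of meager
    sets, since each class consists of leaves coarsely quasi-isometric to one leaf.\<close>
  moreover have "uncountably_many_types" if "all_meager"
    unfolding uncountably_many_types_def
  proof
    define r where "r = {(L, L'). L \<in> leaves_in F X0d \<and> L' \<in> leaves_in F X0d \<and> cqi_leaves F U L L'}"
    assume "countable (cqi_types F U (leaves_in F X0d))"
    then have "countable (leaves_in F X0d // r)" by (simp add: cqi_types_def r_def)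
    then have "meager_in X (\<Union>\<C>\<in>leaves_in F X0d // r. \<Union>\<C>)"
    proof (rule meager_in_UN)
      fix \<C> assume "\<C> \<in> leaves_in F X0d // r"
      then obtain L where L: "L \<in> leaves_in F X0d" "\<C> = r `` {L}" by (rule quotientE)
      have "meager_in X (\<Union>{L' \<in> leaves F. cqi_leaves F U L L'})"
        using \<open>all_meager\<close> L(1) unfolding all_meager_def meagerly_many_leaves_def leaves_in_def by blast
      moreover have "\<Union>\<C> \<subseteq> \<Union>{L' \<in> leaves F. cqi_leaves F U L L'}"
        unfolding L(2) r_def leaves_in_def by blast
      ultimately show "meager_in X (\<Union>\<C>)" by (rule meager_in_subset)
    qed
    moreover have "X0d \<subseteq> (\<Union>\<C>\<in>leaves_in F X0d // r. \<Union>\<C>)"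
    proof
      fix x assume "x \<in> X0d"
      then obtain L where L: "L \<in> leaves_in F X0d" "x \<in> L" using leaf_in by blast
      \<comment> \<open>The identity map shows that \<open>L\<close> lies in its own class.\<close>
      have "coarse_quasi_isometry 0 1 L d L d L L id"
        by (auto simp: coarse_quasi_isometry_def is_net_def plaque_dist_def)
      then have "(L, L) \<in> r"
        using L(1) unfolding r_def cqi_leaves_def coarsely_quasi_isometric_def by blast
      then show "x \<in> (\<Union>\<C>\<in>leaves_in F X0d // r. \<Union>\<C>)"
        using L quotientI[OF L(1), of r] by blast
    qed
    ultimately show False using not_meager meager_in_subset by blast
  qed
  \<comment> \<open>Both alternatives together would place all of \<open>X0d\<close> in the meager
    type of a single leaf.\<close>
  moreover have False if "all_equi_cqi" "all_meager"
  proof -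
    have "X0d \<noteq> {}" using not_meager by (auto simp: meager_in_def)
    then obtain L where L: "L \<in> leaves_in F X0d" using leaf_in by blast
    have "X0d \<subseteq> \<Union>{L' \<in> leaves F. cqi_leaves F U L L'}"
    proof
      fix x assume "x \<in> X0d"
      then obtain L' where L': "L' \<in> leaves_in F X0d" "x \<in> L'" using leaf_in by blast
      have "cqi_leaves F U L L'"
        using \<open>all_equi_cqi\<close> L L'(1)
        unfolding all_equi_cqi_def equi_coarsely_quasi_isometric_def cqi_leaves_def coarsely_quasi_isometric_def
        by blast
      then show "x \<in> \<Union>{L' \<in> leaves F. cqi_leaves F U L L'}" using L' by (auto simp: leaves_in_def)
    qed
    moreover have "meager_in X (\<Union>{L' \<in> leaves F. cqi_leaves F U L L'})"
      using \<open>all_meager\<close> L unfolding all_meager_def meagerly_many_leaves_def leaves_in_def by blast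
    ultimately show False using not_meager meager_in_subset by blast
  qed
  ultimately show ?thesis by blast
qed

end
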